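(* Let $\Lambda$ be a discrete valuation ring with uniformizer $\varpi$, let $r,s,t$ be positive integers, let $d\in\mathrm{Mat}_{s\times t}(\Lambda)$ and $\Sigma_1,\dots,\Sigma_s\in\mathrm{Mat}_{r\times r}(\Lambda)$. For $x\in\Lambda^{\oplus r}$ write $x^t\Sigma x:=(x^t\Sigma_1x,\dots,x^t\Sigma_sx)^t\in\Lambda^{\oplus s}$. Assume (H1) $\operatorname{coker}(d:\Lambda^{\oplus t}\to\Lambda^{\oplus s})$ is isomorphic to $\Lambda$ or to $\Lambda/\varpi^n$ for some $n>0$; and (H2) there exists $f\in\Lambda^{\oplus r}$ with $f^t\Sigma f\notin \varpi\Lambda^{\oplus s}+\operatorname{Im}(d)$. Suppose $(\bar x,\bar y)\in(\Lambda/\varpi)^{\oplus r+t}$ is a mod $\varpi$ solution of $x^t\Sigma x+dy=0$, i.e. $\bar x^t\Sigma\bar x+d\bar y\in\varpi\Lambda^{\oplus s}$ (computed with any lifts). Then there is an extension of discrete valuation rings $\Lambda\subset\Lambda'$ and a solution $(x,y)\in\Lambda'^{\oplus r+t}$ of $x^t\Sigma x+dy=0$ lifting $(\bar x,\bar y)$. *)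

theory Defs
  imports "HOL-Algebra.Algebra"
begin

section \<open>Discrete valuation rings\<close>

definition dvr :: "('a, 'm) ring_scheme \<Rightarrow> bool" where
  "dvr R \<longleftrightarrow> principal_domain R \<and> (\<exists>!M. maximalideal M R) \<and> \<not> field R"

definition uniformizer :: "('a, 'm) ring_scheme \<Rightarrow> 'a \<Rightarrow> bool" where
  "uniformizer R p \<longleftrightarrow> p \<in> carrier R \<and> maximalideal (PIdl\<^bsub>R\<^esub> p) R"

text \<open>
  An extension of discrete valuation rings is an injective local homomorphism; the inclusion is
  carried by an explicit embedding \<open>i\<close>.
\<close>

definition dvr_extension ::
  "('a, 'm) ring_scheme \<Rightarrow> ('b, 'n) ring_scheme \<Rightarrow> ('a \<Rightarrow> 'b) \<Rightarrow> bool" where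
  "dvr_extension R S i \<longleftrightarrow>
     dvr R \<and> dvr S \<and> i \<in> ring_hom R S \<and> inj_on i (carrier R) \<and>
     (\<forall>a \<in> carrier R. i a \<in> Units S \<longrightarrow> a \<in> Units R)"


section \<open>Modules\<close>

text \<open>
  The record type of modules extends that of rings, so the multiplicative fields must be filled in,
  but they play no role for modules.
\<close>

definition free_module :: "('a, 'm) ring_scheme \<Rightarrow> nat \<Rightarrow> ('a, nat \<Rightarrow> 'a) module" where
  "free_module R n =
     \<lparr>carrier = {..<n} \<rightarrow>\<^sub>E carrier R, monoid.mult = undefined, one = undefined,
      ring.zero = (\<lambda>k\<in>{..<n}. \<zero>\<^bsub>R\<^esub>),
      ring.add = (\<lambda>v w. \<lambda>k\<in>{..<n}. v k \<oplus>\<^bsub>R\<^esub> w k),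
      smult = (\<lambda>a v. \<lambda>k\<in>{..<n}. a \<otimes>\<^bsub>R\<^esub> v k)\<rparr>"

definition regular_module :: "('a, 'm) ring_scheme \<Rightarrow> ('a, 'a) module" where
  "regular_module R =
     \<lparr>carrier = carrier R, monoid.mult = monoid.mult R, one = one R,
      ring.zero = ring.zero R, ring.add = ring.add R,
      smult = monoid.mult R\<rparr>"

definition quotient_module :: "('a, 'b, 'm) module_scheme \<Rightarrow> 'b set \<Rightarrow> ('a, 'b set) module" where
  "quotient_module M N =
     \<lparr>carrier = a_rcosets\<^bsub>M\<^esub> N, monoid.mult = undefined, one = undefined,
      ring.zero = N,
      ring.add = set_add M,
      smult = (\<lambda>a C. \<Union>x\<in>C. N +>\<^bsub>M\<^esub> (a \<odot>\<^bsub>M\<^esub> x))\<rparr>"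

definition module_isomorphic ::
  "('a, 'm) ring_scheme \<Rightarrow> ('a, 'b, 'k) module_scheme \<Rightarrow> ('a, 'c, 'l) module_scheme \<Rightarrow> bool" where
  "module_isomorphic R M N \<longleftrightarrow>
     (\<exists>h. bij_betw h (carrier M) (carrier N) \<and>
          (\<forall>x \<in> carrier M. \<forall>y \<in> carrier M. h (x \<oplus>\<^bsub>M\<^esub> y) = h x \<oplus>\<^bsub>N\<^esub> h y) \<and>
          (\<forall>a \<in> carrier R. \<forall>x \<in> carrier M. h (a \<odot>\<^bsub>M\<^esub> x) = a \<odot>\<^bsub>N\<^esub> h x))"


section \<open>Matrices and quadratic maps\<close>

text \<open>
  Matrices are functions of the row and column index, counted from 0; only the entries within the
  stated dimensions matter.
\<close>

definition is_mat :: "('a, 'm) ring_scheme \<Rightarrow> nat \<Rightarrow> nat \<Rightarrow> (nat \<Rightarrow> nat \<Rightarrow> 'a) \<Rightarrow> bool" where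
  "is_mat R m n A \<longleftrightarrow> (\<forall>k<m. \<forall>l<n. A k l \<in> carrier R)"

definition mat_vec ::
  "('a, 'm) ring_scheme \<Rightarrow> nat \<Rightarrow> nat \<Rightarrow> (nat \<Rightarrow> nat \<Rightarrow> 'a) \<Rightarrow> (nat \<Rightarrow> 'a) \<Rightarrow> nat \<Rightarrow> 'a" where
  "mat_vec R m n A v = (\<lambda>k\<in>{..<m}. \<Oplus>\<^bsub>R\<^esub>l\<in>{..<n}. A k l \<otimes>\<^bsub>R\<^esub> v l)"

text \<open>The vector with entries \<open>x\<^sup>t Q\<^sub>k x\<close>, \<open>k < m\<close>, for \<open>n \<times> n\<close> matrices \<open>Q\<^sub>k\<close>.\<close>

definition quad_vec ::
  "('a, 'm) ring_scheme \<Rightarrow> nat \<Rightarrow> nat \<Rightarrow> (nat \<Rightarrow> nat \<Rightarrow> nat \<Rightarrow> 'a) \<Rightarrow> (nat \<Rightarrow> 'a) \<Rightarrow> nat \<Rightarrow> 'a" where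
  "quad_vec R m n Q x =
     (\<lambda>k\<in>{..<m}. \<Oplus>\<^bsub>R\<^esub>i\<in>{..<n}. \<Oplus>\<^bsub>R\<^esub>j\<in>{..<n}. x i \<otimes>\<^bsub>R\<^esub> Q k i j \<otimes>\<^bsub>R\<^esub> x j)"

definition mat_image ::
  "('a, 'm) ring_scheme \<Rightarrow> nat \<Rightarrow> nat \<Rightarrow> (nat \<Rightarrow> nat \<Rightarrow> 'a) \<Rightarrow> (nat \<Rightarrow> 'a) set" where
  "mat_image R m n A = mat_vec R m n A ` carrier (free_module R n)"

definition coker ::
  "('a, 'm) ring_scheme \<Rightarrow> nat \<Rightarrow> nat \<Rightarrow> (nat \<Rightarrow> nat \<Rightarrow> 'a) \<Rightarrow> ('a, (nat \<Rightarrow> 'a) set) module" where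
  "coker R m n A = quotient_module (free_module R m) (mat_image R m n A)"

definition multiples :: "('a, 'm) ring_scheme \<Rightarrow> 'a \<Rightarrow> nat \<Rightarrow> (nat \<Rightarrow> 'a) set" where
  "multiples R a n = (\<lambda>v. a \<odot>\<^bsub>free_module R n\<^esub> v) ` carrier (free_module R n)"

text \<open>The left-hand side of the system \<open>x\<^sup>t Q x + A y = 0\<close>.\<close>

definition system ::
  "('a, 'm) ring_scheme \<Rightarrow> nat \<Rightarrow> nat \<Rightarrow> nat \<Rightarrow> (nat \<Rightarrow> nat \<Rightarrow> nat \<Rightarrow> 'a) \<Rightarrow> (nat \<Rightarrow> nat \<Rightarrow> 'a) \<Rightarrow>
   (nat \<Rightarrow> 'a) \<Rightarrow> (nat \<Rightarrow> 'a) \<Rightarrow> nat \<Rightarrow> 'a" where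
  "system R r s t Q A x y = quad_vec R s r Q x \<oplus>\<^bsub>free_module R s\<^esub> mat_vec R s t A y"


section \<open>Reduction and lifting\<close>

definition residue_ring_mod :: "('a, 'm) ring_scheme \<Rightarrow> 'a \<Rightarrow> 'a set ring" where
  "residue_ring_mod R p = R Quot (PIdl\<^bsub>R\<^esub> p)"

definition is_lift ::
  "('a, 'm) ring_scheme \<Rightarrow> nat \<Rightarrow> (nat \<Rightarrow> 'a set) \<Rightarrow> (nat \<Rightarrow> 'a) \<Rightarrow> bool" where
  "is_lift R n xbar x \<longleftrightarrow> x \<in> carrier (free_module R n) \<and> (\<forall>k<n. x k \<in> xbar k)"

definition mod_solution ::
  "('a, 'm) ring_scheme \<Rightarrow> 'a \<Rightarrow> nat \<Rightarrow> nat \<Rightarrow> nat \<Rightarrow> (nat \<Rightarrow> nat \<Rightarrow> nat \<Rightarrow> 'a) \<Rightarrow>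
   (nat \<Rightarrow> nat \<Rightarrow> 'a) \<Rightarrow> (nat \<Rightarrow> 'a set) \<Rightarrow> (nat \<Rightarrow> 'a set) \<Rightarrow> bool" where
  "mod_solution R p r s t Q A xbar ybar \<longleftrightarrow>
     xbar \<in> carrier (free_module (residue_ring_mod R p) r) \<and>
     ybar \<in> carrier (free_module (residue_ring_mod R p) t) \<and>
     (\<forall>x y. is_lift R r xbar x \<longrightarrow> is_lift R t ybar y \<longrightarrow>
            system R r s t Q A x y \<in> multiples R p s)"

text \<open>
  For an extension \<open>i\<close> from \<open>R\<close> to \<open>S\<close> with uniformizers \<open>p\<close> and \<open>q\<close>, a vector \<open>x\<close> over \<open>S\<close> lifts
  \<open>xbar\<close> over \<open>R/p\<close> if its reduction in \<open>S/q\<close> is the image of \<open>xbar\<close> under the residue field map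
  \<open>R/p \<rightarrow> S/q\<close> induced by \<open>i\<close>.  Working modulo \<open>q\<close> rather than modulo \<open>i p\<close> is essential when the
  extension is ramified.
\<close>

definition lifts_along ::
  "('b, 'n) ring_scheme \<Rightarrow> 'b \<Rightarrow> ('a \<Rightarrow> 'b) \<Rightarrow> nat \<Rightarrow> (nat \<Rightarrow> 'a set) \<Rightarrow> (nat \<Rightarrow> 'b) \<Rightarrow> bool" where
  "lifts_along S q i n xbar x \<longleftrightarrow>
     x \<in> carrier (free_module S n) \<and>
     (\<forall>k<n. \<forall>a \<in> xbar k. x k \<ominus>\<^bsub>S\<^esub> i a \<in> PIdl\<^bsub>S\<^esub> q)"

end

theory Submission
  imports Defs
begin

text \<open>
  Put \<open>F = f\<^sup>t \<Sigma> f\<close>. The cokernel of \<open>d\<close> is cyclic and \<open>F\<close> does not lie in \<open>p\<close> times it, so \<open>F\<close> generates it: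
  \<open>\<Lambda>\<^sup>s = \<Lambda> F + Im d\<close>. Let \<open>x\<^sub>0, y\<^sub>0\<close> lift the given solution and write
  \<open>x\<^sub>0\<^sup>t \<Sigma> x\<^sub>0 + d y\<^sub>0 = p (\<alpha> F + d u)\<close> and \<open>x\<^sub>0\<^sup>t \<Sigma> f + f\<^sup>t \<Sigma> x\<^sub>0 = \<beta> F + d v\<close>. Then \<open>x = x\<^sub>0 + z f\<close>,
  \<open>y = y\<^sub>0 - p u - z v\<close> is a solution whenever \<open>z\<^sup>2 + \<beta> z + p \<alpha> = 0\<close>, so one needs an extension in which
  this monic quadratic polynomial \<open>g\<close> has a root in the maximal ideal.

  If \<open>g(c)\<close>, for \<open>c\<close> in the maximal ideal, can be made divisible by arbitrarily high powers of \<open>p\<close>, then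
  such \<open>c\<close>, replaced by their conjugates \<open>-\<beta> - c\<close> where necessary, form a Cauchy sequence, and the required
  ring is the intersection of the fraction field of \<open>\<Lambda>[z]\<close> with the completion of \<open>\<Lambda>\<close>. (A finite
  extension need not suffice here, as \<open>\<Lambda>\<close> need not be excellent.) Otherwise choose \<open>c\<close> with \<open>g(c)\<close> of
  maximal valuation \<open>m\<close> and put \<open>k = m div 2\<close>. The minimal polynomial of \<open>(z - c)/p\<^sup>k\<close> is then Eisenstein
  if \<open>m\<close> is odd, and irreducible modulo \<open>p\<close> if \<open>m\<close> is even, and adjoining this element gives a discrete
  valuation ring.
\<close>

section \<open>Discrete valuation rings\<close>

(* As a simp rule this makes the simplifier loop on mult_of (mult_of ...). *)
declare divides_mult_imp_divides [simp del]

text \<open>Hensel's lemma does not produce the root z: \<beta> may lie in the maximal ideal, so the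
  root modulo p may be double, and 2 may be a nonunit, so the square cannot be completed in general.
  The valuation of g(c) takes over: if it is unbounded, there is a limit; if it is bounded,
  translating by an optimal c forces enough divisibility of the linear coefficient to rescale the
  polynomial. A second obstacle is typing. The extension must have elements of the same type as
  those of \<Lambda>, so it must not be too large. Being infinite, \<Lambda> absorbs quadruples of
  its elements, which covers pairs x + y Z as well as fractions with numerator and denominator in
  \<Lambda>[z]. The completion itself may be too large, which is why only its intersection with the
  fraction field is kept. The correction of x runs along f alone because the coefficient of z^2 in
  the system is then F, a generator modulo Im d. Hence all s equations reduce to a single one, with
  leading coefficient 1.\<close>

lemma (in cring) mem_PIdl_iff_divides: "x \<in> PIdl a \<longleftrightarrow> a divides x" if "a \<in> carrier R"
  using that unfolding cgenideal_def factor_def by (auto simp: m_comm)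

lemma (in cring) divides_add:
  assumes "a \<in> carrier R" "a divides b" "a divides c" shows "a divides (b \<oplus> c)"
proof -
  obtain u v where "u \<in> carrier R" "b = a \<otimes> u" "v \<in> carrier R" "c = a \<otimes> v"
    using assms unfolding factor_def by auto
  then have "b \<oplus> c = a \<otimes> (u \<oplus> v)" "u \<oplus> v \<in> carrier R"
    using assms by (auto simp: r_distr)
  then show ?thesis unfolding factor_def by blast
qed

lemma (in cring) divides_minus:
  assumes "a \<in> carrier R" "a divides b" "a divides c" shows "a divides (b \<ominus> c)"
proof -
  obtain u v where uv: "u \<in> carrier R" "b = a \<otimes> u" "v \<in> carrier R" "c = a \<otimes> v"
    using assms unfolding factor_def by auto
  have "b \<ominus> c = a \<otimes> (u \<ominus> v)" using assms(1) uv(1,3) unfolding uv(2,4) by algebra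
  with uv show ?thesis unfolding factor_def by blast
qed

lemma (in cring) divides_mult_right:
  assumes "a \<in> carrier R" "a divides b" "c \<in> carrier R" shows "a divides (b \<otimes> c)" "a divides (c \<otimes> b)"
proof -
  obtain u where u: "u \<in> carrier R" "b = a \<otimes> u" using assms unfolding factor_def by auto
  have "b \<otimes> c = a \<otimes> (u \<otimes> c)" using assms u by (simp add: m_assoc)
  then show "a divides (b \<otimes> c)" using u assms by (auto intro: dividesI)
  then show "a divides (c \<otimes> b)" using u assms by (simp add: m_comm)
qed

lemma (in cring) divides_mult_both:
  assumes "a \<in> carrier R" "a' \<in> carrier R" "a divides b" "a' divides b'"
  shows "(a \<otimes> a') divides (b \<otimes> b')"
proof -
  obtain u v where uv: "u \<in> carrier R" "b = a \<otimes> u" "v \<in> carrier R" "b' = a' \<otimes> v"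
    using assms unfolding factor_def by auto
  have "b \<otimes> b' = a \<otimes> a' \<otimes> (u \<otimes> v)" using assms(1,2) uv(1,3) unfolding uv(2,4) by algebra
  with uv show ?thesis unfolding factor_def by blast
qed

text \<open>A discrete valuation ring described through its elements, so that it can be checked on
  rings that are known only to be commutative, such as quadratic extensions and the completion. The
  condition \<open>separated\<close> says that no nonzero element is divisible by all powers of
  \<open>p\<close>. The domain property and principality are derived below.\<close>

locale uniformized = cring R for R (structure) + fixes p
  assumes p_closed [simp]: "p \<in> carrier R"
    and p_nonunit: "p \<notin> Units R"
    and p_regular: "x \<in> carrier R \<Longrightarrow> p \<otimes> x = \<zero> \<Longrightarrow> x = \<zero>"
    and nonunit_dvd: "x \<in> carrier R \<Longrightarrow> x \<notin> Units R \<Longrightarrow> p divides x"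
    and separated: "x \<in> carrier R \<Longrightarrow> (\<And>n::nat. p [^] n divides x) \<Longrightarrow> x = \<zero>"
begin

lemma one_nonzero: "\<one> \<noteq> \<zero>"
proof
  assume "\<one> = \<zero>"
  then have "p = \<one>" by (metis p_closed l_one l_null)
  then show False using p_nonunit by simp
qed

lemma p_nonzero: "p \<noteq> \<zero>"
  using p_regular[of \<one>] one_nonzero by auto

lemma pow_regular: "x \<in> carrier R \<Longrightarrow> p [^] (n::nat) \<otimes> x = \<zero> \<Longrightarrow> x = \<zero>"
proof (induction n)
  case (Suc n)
  have "p \<otimes> (p [^] n \<otimes> x) = \<zero>" using Suc by (simp add: m_assoc m_lcomm)
  then show ?case using p_regular[of "p [^] n \<otimes> x"] Suc by simp
qed simp

lemma p_pow_nonzero: "p [^] (n::nat) \<noteq> \<zero>"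
  using pow_regular[of \<one> n] one_nonzero by auto

lemma pow_divides_pow: "m \<le> n \<Longrightarrow> p [^] (m::nat) divides p [^] (n::nat)"
  by (rule dividesI[of "p [^] (n - m)"]) (simp_all add: nat_pow_mult)

lemma pow_divides_le: "m \<le> n \<Longrightarrow> p [^] (n::nat) divides x \<Longrightarrow> p [^] (m::nat) divides x"
  by (meson divides_trans p_closed nat_pow_closed pow_divides_pow)

lemma unit_iff: "x \<in> carrier R \<Longrightarrow> x \<in> Units R \<longleftrightarrow> \<not> p divides x"
  using nonunit_dvd p_nonunit
  by (metis Units_closed divides_one divides_trans p_closed divides_mult_right(1) Units_r_inv Units_inv_closed)

text \<open>This is the valuation: by \<open>separated\<close> some power of \<open>p\<close> fails
  to divide \<open>x\<close>, and the cofactor of the last power that does divide is not a multiple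
  of \<open>p\<close>, hence a unit.\<close>

lemma unit_power_decomp:
  assumes "x \<in> carrier R" "x \<noteq> \<zero>"
  obtains n :: nat and u where "u \<in> Units R" "x = p [^] n \<otimes> u"
proof -
  define P where "P n \<longleftrightarrow> \<not> p [^] n divides x" for n :: nat
  define m where "m = (LEAST n. P n)"
  have ex: "\<exists>n. P n" using separated assms unfolding P_def by blast
  then have m: "P m" unfolding m_def by (rule LeastI_ex)
  have "\<not> P 0" unfolding P_def using assms by (simp add: one_divides)
  with m obtain n where n: "m = Suc n" by (cases m) auto
  then have "\<not> P n" unfolding m_def using not_less_Least by (metis lessI)
  then obtain u where u: "u \<in> carrier R" "x = p [^] n \<otimes> u" unfolding P_def factor_def by auto
  have "\<not> p divides u"
  proof
    assume "p divides u"
    then obtain v where "v \<in> carrier R" "u = p \<otimes> v" unfolding factor_def by auto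
    then have "x = p [^] m \<otimes> v" "v \<in> carrier R" using u n by (auto simp: m_assoc)
    then show False using m unfolding P_def factor_def by auto
  qed
  then show thesis using that u unit_iff by blast
qed

text \<open>Nonzero factors are powers of \<open>p\<close> times units. Since powers of
  \<open>p\<close> can be cancelled, a vanishing product would make a product of two units
  zero.\<close>

sublocale domain R
proof (unfold_locales)
  show "\<one> \<noteq> \<zero>" by (rule one_nonzero)
next
  fix a b assume ab: "a \<otimes> b = \<zero>" "a \<in> carrier R" "b \<in> carrier R"
  show "a = \<zero> \<or> b = \<zero>"
  proof (rule ccontr)
    assume "\<not> ?thesis"
    then obtain n m :: nat and u v where u: "u \<in> Units R" "a = p [^] n \<otimes> u" and v: "v \<in> Units R" "b = p [^] m \<otimes> v"
      using unit_power_decomp ab by metis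
    have cl: "u \<in> carrier R" "v \<in> carrier R" using u v by auto
    have "p [^] (n + m) \<otimes> (u \<otimes> v) = a \<otimes> b"
      using cl unfolding u(2) v(2) nat_pow_mult[OF p_closed, symmetric]
      by (simp add: m_ac)
    then have "u \<otimes> v = \<zero>" using pow_regular[of "u \<otimes> v"] ab cl by simp
    moreover have "u \<otimes> v \<in> Units R" using u v by simp
    ultimately show False using one_nonzero by (metis Units_r_inv Units_inv_closed l_null)
  qed
qed

text \<open>Unit factors can be stripped, so a nonzero ideal contains a power of \<open>p\<close>,
  and the least exponent that occurs gives a generator.\<close>

lemma ideal_principal: assumes "ideal I R" shows "\<exists>a\<in>carrier R. I = PIdl a"
proof (cases "I = {\<zero>}")
  case True
  then have "I = PIdl \<zero>" using mem_PIdl_iff_divides[OF zero_closed] zero_divides by blast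
  then show ?thesis by blast
next
  case False
  interpret I: ideal I R by fact
  have key: "p [^] n \<in> I" if "p [^] n \<otimes> u \<in> I" "u \<in> Units R" for n :: nat and u
  proof -
    have "p [^] n \<otimes> u \<otimes> inv u \<in> I" using I.I_r_closed[OF that(1) Units_inv_closed[OF that(2)]] .
    then show ?thesis using that by (simp add: m_assoc Units_closed)
  qed
  obtain x where "x \<in> I" "x \<noteq> \<zero>" using False I.zero_closed by auto
  then have ex: "\<exists>n::nat. p [^] n \<in> I" using unit_power_decomp key by (metis I.Icarr)
  define n where "n = (LEAST n::nat. p [^] n \<in> I)"
  have n: "p [^] n \<in> I" unfolding n_def using ex by (rule LeastI_ex)
  have "I \<subseteq> PIdl (p [^] n)"
  proof
    fix x assume x: "x \<in> I"
    show "x \<in> PIdl (p [^] n)"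
    proof (cases "x = \<zero>")
      case True then show ?thesis by (simp add: mem_PIdl_iff_divides divides_zero)
    next
      case False
      then obtain m :: nat and u where u: "u \<in> Units R" "x = p [^] m \<otimes> u"
        using unit_power_decomp x I.Icarr by metis
      then have "p [^] m \<in> I" using key x by simp
      then have "n \<le> m" unfolding n_def by (rule Least_le)
      then have "p [^] n divides x" using u divides_mult_right(1)[OF _ pow_divides_pow] by (simp add: Units_closed)
      then show ?thesis by (simp add: mem_PIdl_iff_divides)
    qed
  qed
  then have "I = PIdl (p [^] n)" using cgenideal_minimal[OF assms n] by blast
  then show ?thesis by auto
qed

text \<open>A proper ideal contains no unit, so it consists of multiples of \<open>p\<close>. This
  gives both the maximality of \<open>PIdl p\<close> and its uniqueness.\<close>

lemma maximalideal_iff: "maximalideal M R \<longleftrightarrow> M = PIdl p"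
proof -
  have unitI: "J = carrier R" if "ideal J R" "u \<in> J" "u \<in> Units R" for J u
  proof -
    interpret J: ideal J R by fact
    have "u \<otimes> inv u \<in> J" using J.I_r_closed[OF that(2) Units_inv_closed[OF that(3)]] .
    then show ?thesis using J.one_imp_carrier unfolding Units_r_inv[OF that(3)] by simp
  qed
  have sub: "J \<subseteq> PIdl p" if "ideal J R" "J \<noteq> carrier R" for J
  proof
    fix x assume x: "x \<in> J"
    then have "x \<notin> Units R" using unitI[OF that(1)] that(2) by metis
    then show "x \<in> PIdl p"
      using nonunit_dvd[OF ideal.Icarr[OF that(1) x]] by (simp add: mem_PIdl_iff_divides)
  qed
  have idl: "ideal (PIdl p) R" by (simp add: cgenideal_ideal)
  have ne: "PIdl p \<noteq> carrier R"
  proof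
    assume "PIdl p = carrier R"
    then have "\<one> \<in> PIdl p" by (simp only: one_closed)
    then have "p divides \<one>" by (simp only: mem_PIdl_iff_divides[OF p_closed])
    then show False using p_nonunit by (simp only: divides_one[OF p_closed])
  qed
  have "maximalideal (PIdl p) R"
  proof (rule maximalidealI[OF idl])
    show "carrier R \<noteq> PIdl p" using ne by (rule not_sym)
    fix J assume "ideal J R" "PIdl p \<subseteq> J" "J \<subseteq> carrier R"
    then show "J = PIdl p \<or> J = carrier R" using sub[of J] by auto
  qed
  moreover have "M = PIdl p" if "maximalideal M R"
  proof -
    interpret M: maximalideal M R by fact
    have "M \<subseteq> PIdl p" using sub M.is_ideal M.I_notcarr by blast
    then show ?thesis using M.I_maximal[OF idl] ne additive_subgroup.a_subset[OF ideal.axioms(1)[OF idl]] by simp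
  qed
  ultimately show ?thesis by blast
qed

lemma dvr: "dvr R" and uniformizer: "uniformizer R p"
proof -
  have "\<not> field R" using p_nonunit p_nonzero field.field_Units by fastforce
  moreover have "principal_domain R"
    by (intro principal_domain.intro principal_domain_axioms.intro domain_axioms ideal_principal)
  ultimately show "dvr R" unfolding dvr_def maximalideal_iff by auto
  show "uniformizer R p" unfolding uniformizer_def maximalideal_iff by simp
qed

end

text \<open>The passage from the ideal-theoretic definition to the elementwise one. A nonzero
  nonunit of a principal ideal domain has an irreducible divisor; this generates a maximal ideal,
  which is \<open>PIdl p\<close> by uniqueness.\<close>

lemma uniformizedI: fixes R (structure) assumes "dvr R" "uniformizer R p" shows "uniformized R p"
proof -
  interpret principal_domain R using assms unfolding dvr_def by simp
  have p: "p \<in> carrier R" "maximalideal (PIdl p) R" using assms unfolding uniformizer_def by auto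
  interpret M: maximalideal "PIdl p" R by (fact p(2))
  have nu: "p \<notin> Units R"
  proof
    assume "p \<in> Units R"
    then have "\<one> \<in> PIdl p" using p(1) mem_PIdl_iff_divides divides_one by simp
    then show False using M.I_notcarr M.one_imp_carrier by simp
  qed
  have nz: "p \<noteq> \<zero>"
  proof
    assume "p = \<zero>"
    then have "PIdl p = {\<zero>}" using p(1) mem_PIdl_iff_divides zero_divides by blast
    then have "field R" using p(2) zeromaximalideal_eq_field by metis
    then show False using assms(1) unfolding dvr_def by blast
  qed
  have nud: "p divides x" if x: "x \<in> carrier R" "x \<notin> Units R" for x
  proof (cases "x = \<zero>")
    case True then show ?thesis using p divides_zero by simp
  next
    case False
    obtain b where b: "b \<in> carrier R" "ring_irreducible b" "b divides x"
      using exists_irreducible_divisor[of x] x False by blast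
    have "maximalideal (PIdl b) R" using irreducible_imp_maximalideal b by blast
    then have "PIdl b = PIdl p" using p assms(1) unfolding dvr_def by blast
    then have "p divides b"
      using cgenideal_self[OF b(1)] mem_PIdl_iff_divides[OF p(1), of b] by simp
    then show ?thesis using b p divides_trans by blast
  qed
  have sep: "x = \<zero>" if x: "x \<in> carrier R" "\<And>n::nat. p [^] n divides x" for x
  proof -
    \<comment> \<open>The intersection of all ideals \<open>PIdl (p [^] n)\<close>. Its generator
      \<open>a\<close> is \<open>p \<otimes> b\<close> with \<open>b\<close> again in the
      intersection, so \<open>b = a \<otimes> c\<close> and
      \<open>a = a \<otimes> (p \<otimes> c)\<close>. As \<open>p\<close> is not a unit,
      \<open>a\<close> vanishes.\<close>
    define I where "I = {x \<in> carrier R. \<forall>n::nat. p [^] n divides x}"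
    have "ideal I R"
    proof (rule idealI[OF ring_axioms])
      show "subgroup I (add_monoid R)"
      proof (rule add.subgroupI)
        show "I \<noteq> {}" using x unfolding I_def by blast
        show "\<ominus> a \<in> I" if "a \<in> I" for a
        proof -
          have "p [^] n divides (\<zero> \<ominus> a)" for n :: nat
            using that p by (intro divides_minus divides_zero) (auto simp: I_def)
          then show ?thesis using that by (simp add: I_def minus_eq)
        qed
      qed (auto simp: I_def p divides_add)
    qed (auto simp: I_def p divides_mult_right)
    then obtain a where a: "a \<in> carrier R" "I = PIdl a" using exists_gen by blast
    then have aI: "a \<in> I" by (simp add: cgenideal_self)
    then have "p [^] (1::nat) divides a" unfolding I_def by blast
    then obtain b where b: "b \<in> carrier R" "a = p \<otimes> b" using p unfolding factor_def by auto
    have "b \<in> I"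
    proof -
      have "p [^] n divides b" for n :: nat
      proof -
        have "p \<otimes> p [^] n divides p \<otimes> b" using aI b p nat_pow_Suc2 unfolding I_def by (metis (lifting) mem_Collect_eq)
        then show ?thesis using mult_divides[of "p [^] n" b p] p b nz by simp
      qed
      then show ?thesis using b unfolding I_def by blast
    qed
    then obtain c where c: "c \<in> carrier R" "b = a \<otimes> c" using a mem_PIdl_iff_divides unfolding factor_def by auto
    have "a = \<zero>"
    proof (rule ccontr)
      assume "a \<noteq> \<zero>"
      have "a \<otimes> (p \<otimes> c) = a \<otimes> \<one>" using b c a p by (metis m_lcomm r_one)
      then have "p \<otimes> c = \<one>" using m_lcancel[OF \<open>a \<noteq> \<zero>\<close> a(1), of "p \<otimes> c" \<one>] p c by simp
      then show False using nu p c divides_one unfolding factor_def by metis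
    qed
    moreover have "x \<in> PIdl a" using x a unfolding I_def by blast
    ultimately show ?thesis by (simp only: mem_PIdl_iff_divides[OF zero_closed] zero_divides)
  qed
  show ?thesis
  proof (unfold_locales)
    show "x = \<zero>" if "x \<in> carrier R" "p \<otimes> x = \<zero>" for x
      using integral[OF that(2) p(1) that(1)] nz by blast
  qed (fact p(1) nu nud sep)+
qed

section \<open>Extensions of discrete valuation rings\<close>

text \<open>Transport of structure: because \<open>h\<close> is injective, divisibility, units and
  zero in the image correspond to those in \<open>S\<close>. This serves to move a ring into another
  type of elements.\<close>

lemma uniformized_image_ring:
  assumes "uniformized S q" and h: "inj_on h (carrier S)"
  shows "uniformized (image_ring h S) (h q)"
proof -
  interpret S: uniformized S q by fact
  let ?T = "image_ring h S"
  interpret T: domain ?T using S.inj_imp_image_ring_is_domain[OF h] .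
  have hom: "h \<in> ring_hom S ?T" using inj_imp_image_ring_iso[OF h] unfolding ring_iso_def by blast
  interpret H: ring_hom_cring S ?T h
    by unfold_locales (fact hom)
  have carr: "carrier ?T = h ` carrier S" by (rule image_ring_carrier)
  have dvd: "h a divides\<^bsub>?T\<^esub> h b \<longleftrightarrow> a divides\<^bsub>S\<^esub> b" if "a \<in> carrier S" "b \<in> carrier S" for a b
  proof
    assume "h a divides\<^bsub>?T\<^esub> h b"
    then obtain c where c: "c \<in> carrier S" "h b = h a \<otimes>\<^bsub>?T\<^esub> h c"
      unfolding factor_def carr by blast
    then have "h b = h (a \<otimes>\<^bsub>S\<^esub> c)" using that by simp
    then have "b = a \<otimes>\<^bsub>S\<^esub> c" using inj_onD[OF h] that c by simp
    then show "a divides\<^bsub>S\<^esub> b" using c by (auto intro: dividesI)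
  next
    assume "a divides\<^bsub>S\<^esub> b"
    then obtain c where "c \<in> carrier S" "b = a \<otimes>\<^bsub>S\<^esub> c" unfolding factor_def by blast
    then show "h a divides\<^bsub>?T\<^esub> h b" using that by (intro dividesI[of "h c"]) auto
  qed
  have unit: "h a \<in> Units ?T \<longleftrightarrow> a \<in> Units S" if "a \<in> carrier S" for a
    using dvd[OF that S.one_closed] that T.divides_one[of "h a"] S.divides_one[of a] by simp
  have zero: "h a = \<zero>\<^bsub>?T\<^esub> \<longleftrightarrow> a = \<zero>\<^bsub>S\<^esub>" if "a \<in> carrier S" for a
    using inj_on_eq_iff[OF h that S.zero_closed] by simp
  show ?thesis
  proof (unfold_locales)
    show "h q \<in> carrier ?T" by simp
    show "h q \<notin> Units ?T" using unit S.p_nonunit by simp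
    show "x = \<zero>\<^bsub>?T\<^esub>" if "x \<in> carrier ?T" "h q \<otimes>\<^bsub>?T\<^esub> x = \<zero>\<^bsub>?T\<^esub>" for x
      using that T.integral[OF that(2)] zero S.p_nonzero by simp
    show "h q divides\<^bsub>?T\<^esub> x" if x: "x \<in> carrier ?T" "x \<notin> Units ?T" for x
    proof -
      obtain a where a: "a \<in> carrier S" "x = h a" using x(1) unfolding carr by blast
      then show ?thesis using x(2) unit[of a] dvd[of q a] S.nonunit_dvd[of a] by simp
    qed
    show "x = \<zero>\<^bsub>?T\<^esub>" if x: "x \<in> carrier ?T" "\<And>n::nat. h q [^]\<^bsub>?T\<^esub> n divides\<^bsub>?T\<^esub> x" for x
    proof -
      obtain a where a: "a \<in> carrier S" "x = h a" using x(1) unfolding carr by blast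
      have "q [^]\<^bsub>S\<^esub> n divides\<^bsub>S\<^esub> a" for n :: nat
        using x(2)[of n] dvd[of "q [^]\<^bsub>S\<^esub> n" a] a by simp
      then show ?thesis using S.separated[OF a(1)] zero a by simp
    qed
  qed
qed

text \<open>Every nonzero element of \<open>R\<close> is a power of \<open>p\<close> times a unit,
  so \<open>p\<close> alone decides both properties: injectivity follows from \<open>i p\<close>
  being nonzero, locality from \<open>q\<close> dividing \<open>i p\<close>.\<close>

lemma dvr_extensionI:
  assumes "uniformized R p" "uniformized S q" "i \<in> ring_hom R S"
    and dvd: "q divides\<^bsub>S\<^esub> i p" and nz: "i p \<noteq> \<zero>\<^bsub>S\<^esub>"
  shows "dvr_extension R S i"
proof -
  interpret R: uniformized R p by fact
  interpret S: uniformized S q by fact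
  interpret H: ring_hom_cring R S i
    by unfold_locales (fact assms(3))
  have unit: "a \<in> Units R" if a: "a \<in> carrier R" "i a \<in> Units S" for a
  proof (rule ccontr)
    assume "a \<notin> Units R"
    then obtain b where b: "b \<in> carrier R" "a = p \<otimes>\<^bsub>R\<^esub> b"
      using R.nonunit_dvd[OF a(1)] unfolding factor_def by blast
    then have "q divides\<^bsub>S\<^esub> i a" using S.divides_mult_right(1)[OF _ dvd, of "i b"] by simp
    then show False using S.unit_iff a by simp
  qed
  have zero: "a = \<zero>\<^bsub>R\<^esub>" if a: "a \<in> carrier R" "i a = \<zero>\<^bsub>S\<^esub>" for a
  proof (rule ccontr)
    assume "a \<noteq> \<zero>\<^bsub>R\<^esub>"
    then obtain n :: nat and u where u: "u \<in> Units R" "a = p [^]\<^bsub>R\<^esub> n \<otimes>\<^bsub>R\<^esub> u"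
      using R.unit_power_decomp a by metis
    then have uc: "u \<in> carrier R" by auto
    have "i p [^]\<^bsub>S\<^esub> n \<otimes>\<^bsub>S\<^esub> i u = \<zero>\<^bsub>S\<^esub>" using a u uc by simp
    moreover have "i p [^]\<^bsub>S\<^esub> n \<noteq> \<zero>\<^bsub>S\<^esub>"
      using nz by (induction n) (auto simp: S.integral_iff)
    moreover have "i u \<otimes>\<^bsub>S\<^esub> i (inv\<^bsub>R\<^esub> u) = \<one>\<^bsub>S\<^esub>"
      using u uc by (metis H.hom_mult H.hom_one R.Units_inv_closed R.Units_r_inv)
    then have "i u \<noteq> \<zero>\<^bsub>S\<^esub>" using u S.one_nonzero by auto
    ultimately show False using S.integral_iff uc by auto
  qed
  have "inj_on i (carrier R)"
  proof (rule inj_onI)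
    fix x y assume xy: "x \<in> carrier R" "y \<in> carrier R" "i x = i y"
    then have "i (x \<ominus>\<^bsub>R\<^esub> y) = \<zero>\<^bsub>S\<^esub>" by (simp add: R.minus_eq S.r_neg)
    then have "x \<ominus>\<^bsub>R\<^esub> y = \<zero>\<^bsub>R\<^esub>" using zero xy by simp
    then show "x = y" using xy R.r_right_minus_eq by simp
  qed
  then show ?thesis unfolding dvr_extension_def
    using R.dvr S.dvr assms(3) unit by blast
qed

section \<open>Cardinality of a discrete valuation ring\<close>

lemma (in uniformized) infinite_carrier: "infinite (carrier R)"
proof -
  have "inj (\<lambda>n::nat. p [^] n)"
  proof (rule injI)
    have *: "m \<ge> n" if "p [^] m = p [^] n" for m n :: nat
    proof (rule ccontr)
      assume "\<not> m \<ge> n"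
      then have "Suc m \<le> n" by simp
      then have "p [^] Suc m divides p [^] m" unfolding that by (rule pow_divides_pow)
      then obtain c where c: "c \<in> carrier R" "p [^] m = p [^] Suc m \<otimes> c" unfolding factor_def by blast
      have "p [^] m \<otimes> (p \<otimes> c) = p [^] Suc m \<otimes> c" using c(1) by (simp add: m_assoc)
      then have "p [^] m \<otimes> \<one> = p [^] m \<otimes> (p \<otimes> c)"
        using c(2) by (metis nat_pow_closed p_closed r_one)
      then have "\<one> = p \<otimes> c"
        using m_lcancel[OF p_pow_nonzero nat_pow_closed[OF p_closed] one_closed m_closed[OF p_closed c(1)], of m]
        by blast
      then have "p divides \<one>" using c(1) by (auto intro: dividesI)
      then show False using divides_one p_nonunit by simp
    qed
    show "m = n" if "p [^] m = p [^] n" for m n :: nat using *[of m n] *[of n m] that by simp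
  qed
  then have "infinite (range (\<lambda>n::nat. p [^] n))" by (rule range_inj_infinite)
  moreover have "range (\<lambda>n::nat. p [^] n) \<subseteq> carrier R" by auto
  ultimately show ?thesis using infinite_super by blast
qed

text \<open>An infinite set is equipotent with its square, and this is used twice. Four components
  are what a fraction takes whose numerator and denominator both have the form x + y z.\<close>

lemma infinite_inj_quadruples:
  fixes A :: "'a set"
  assumes "infinite A"
  obtains f :: "('a \<times> 'a) \<times> ('a \<times> 'a) \<Rightarrow> 'a" where "inj_on f ((A \<times> A) \<times> (A \<times> A))"
proof -
  have 1: "|A \<times> A| \<le>o |A|" using card_of_Times_same_infinite[OF assms] ordIso_imp_ordLeq by blast
  have "infinite (A \<times> A)" using assms finite_cartesian_productD1 by fastforce
  then have "|(A \<times> A) \<times> (A \<times> A)| \<le>o |A \<times> A|"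
    using card_of_Times_same_infinite ordIso_imp_ordLeq by blast
  then have "|(A \<times> A) \<times> (A \<times> A)| \<le>o |A|" using 1 ordLeq_transitive by blast
  then show thesis using that unfolding card_of_ordLeq[symmetric] by blast
qed

text \<open>The hypothesis on \<open>j\<close> bounds the cardinality of \<open>S\<close>, so that \<open>S\<close> can be moved into the
  type of the elements of \<open>R\<close>.\<close>

lemma root_extension_transfer:
  fixes R :: "('a, 'm) ring_scheme" and S :: "('b, 'n) ring_scheme"
  assumes "uniformized R p" "uniformized S q" "i \<in> ring_hom R S"
    and dvd: "q divides\<^bsub>S\<^esub> i p" and nz: "i p \<noteq> \<zero>\<^bsub>S\<^esub>"
    and j: "inj_on j (carrier S)"
      "j ` carrier S \<subseteq> (carrier R \<times> carrier R) \<times> (carrier R \<times> carrier R)"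
    and b: "b \<in> carrier R" and c: "c \<in> carrier R"
    and z: "z \<in> carrier S" "q divides\<^bsub>S\<^esub> z"
      "z \<otimes>\<^bsub>S\<^esub> z \<oplus>\<^bsub>S\<^esub> i b \<otimes>\<^bsub>S\<^esub> z \<oplus>\<^bsub>S\<^esub> i c = \<zero>\<^bsub>S\<^esub>"
  shows "\<exists>(T :: 'a ring) k r w. dvr_extension R T k \<and> uniformizer T r \<and> w \<in> PIdl\<^bsub>T\<^esub> r \<and>
    w \<otimes>\<^bsub>T\<^esub> w \<oplus>\<^bsub>T\<^esub> k b \<otimes>\<^bsub>T\<^esub> w \<oplus>\<^bsub>T\<^esub> k c = \<zero>\<^bsub>T\<^esub>"
proof -
  interpret R: uniformized R p by fact
  interpret S: uniformized S q by fact
  obtain f :: "('a \<times> 'a) \<times> ('a \<times> 'a) \<Rightarrow> 'a"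
    where "inj_on f ((carrier R \<times> carrier R) \<times> (carrier R \<times> carrier R))"
    using infinite_inj_quadruples[OF R.infinite_carrier] .
  then have h: "inj_on (f \<circ> j) (carrier S)" using j comp_inj_on inj_on_subset by metis
  define h where "h = f \<circ> j"
  note h = h[folded h_def]
  let ?T = "image_ring h S"
  interpret T: uniformized ?T "h q" by (rule uniformized_image_ring[OF assms(2) h])
  have hom: "h \<in> ring_hom S ?T" using inj_imp_image_ring_iso[OF h] unfolding ring_iso_def by blast
  interpret H: ring_hom_cring S ?T h
    by unfold_locales (fact hom)
  interpret I: ring_hom_cring R S i
    by unfold_locales (fact assms(3))
  have dvdh: "h q divides\<^bsub>?T\<^esub> h x" if x: "q divides\<^bsub>S\<^esub> x" for x
  proof -
    obtain y where "y \<in> carrier S" "x = q \<otimes>\<^bsub>S\<^esub> y" using x unfolding factor_def by blast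
    then show ?thesis by (intro dividesI[of "h y"]) auto
  qed
  have "h (i p) \<noteq> \<zero>\<^bsub>?T\<^esub>" using inj_on_eq_iff[OF h, of "i p" "\<zero>\<^bsub>S\<^esub>"] nz by simp
  then have 1: "dvr_extension R ?T (h \<circ> i)"
    using dvr_extensionI[OF assms(1) T.uniformized_axioms ring_hom_trans[OF assms(3) hom]] dvdh[OF dvd] by simp
  have "h (z \<otimes>\<^bsub>S\<^esub> z \<oplus>\<^bsub>S\<^esub> i b \<otimes>\<^bsub>S\<^esub> z \<oplus>\<^bsub>S\<^esub> i c) = \<zero>\<^bsub>?T\<^esub>" using z(3) by simp
  then have 2: "h z \<otimes>\<^bsub>?T\<^esub> h z \<oplus>\<^bsub>?T\<^esub> (h \<circ> i) b \<otimes>\<^bsub>?T\<^esub> h z \<oplus>\<^bsub>?T\<^esub> (h \<circ> i) c = \<zero>\<^bsub>?T\<^esub>"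
    using z(1) b c by simp
  have 3: "h z \<in> PIdl\<^bsub>?T\<^esub> h q" using dvdh[OF z(2)] T.mem_PIdl_iff_divides by simp
  show ?thesis
    by (intro exI[of _ ?T] exI[of _ "h \<circ> i"] exI[of _ "h q"] exI[of _ "h z"] conjI 1 2 3 T.uniformizer)
qed

section \<open>Quadratic extensions\<close>

text \<open>The pair \<open>(x, y)\<close> stands for \<open>x + y Z\<close> in \<open>R[Z]/(Z\<^sup>2 + b Z + a)\<close>.\<close>

definition quad_ring :: "('a, 'm) ring_scheme \<Rightarrow> 'a \<Rightarrow> 'a \<Rightarrow> ('a \<times> 'a) ring" where
  "quad_ring R b a =
     \<lparr>carrier = carrier R \<times> carrier R,
      monoid.mult = (\<lambda>v w. (fst v \<otimes>\<^bsub>R\<^esub> fst w \<ominus>\<^bsub>R\<^esub> a \<otimes>\<^bsub>R\<^esub> (snd v \<otimes>\<^bsub>R\<^esub> snd w),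
         fst v \<otimes>\<^bsub>R\<^esub> snd w \<oplus>\<^bsub>R\<^esub> snd v \<otimes>\<^bsub>R\<^esub> fst w \<ominus>\<^bsub>R\<^esub> b \<otimes>\<^bsub>R\<^esub> (snd v \<otimes>\<^bsub>R\<^esub> snd w))),
      one = (\<one>\<^bsub>R\<^esub>, \<zero>\<^bsub>R\<^esub>), ring.zero = (\<zero>\<^bsub>R\<^esub>, \<zero>\<^bsub>R\<^esub>),
      ring.add = (\<lambda>v w. (fst v \<oplus>\<^bsub>R\<^esub> fst w, snd v \<oplus>\<^bsub>R\<^esub> snd w))\<rparr>"

lemma quad_ring_simps [simp]:
  "carrier (quad_ring R b a) = carrier R \<times> carrier R"
  "\<one>\<^bsub>quad_ring R b a\<^esub> = (\<one>\<^bsub>R\<^esub>, \<zero>\<^bsub>R\<^esub>)"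
  "\<zero>\<^bsub>quad_ring R b a\<^esub> = (\<zero>\<^bsub>R\<^esub>, \<zero>\<^bsub>R\<^esub>)"
  "(x, y) \<oplus>\<^bsub>quad_ring R b a\<^esub> (x', y') = (x \<oplus>\<^bsub>R\<^esub> x', y \<oplus>\<^bsub>R\<^esub> y')"
  "(x, y) \<otimes>\<^bsub>quad_ring R b a\<^esub> (x', y') = (x \<otimes>\<^bsub>R\<^esub> x' \<ominus>\<^bsub>R\<^esub> a \<otimes>\<^bsub>R\<^esub> (y \<otimes>\<^bsub>R\<^esub> y'),
     x \<otimes>\<^bsub>R\<^esub> y' \<oplus>\<^bsub>R\<^esub> y \<otimes>\<^bsub>R\<^esub> x' \<ominus>\<^bsub>R\<^esub> b \<otimes>\<^bsub>R\<^esub> (y \<otimes>\<^bsub>R\<^esub> y'))"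
  by (simp_all add: quad_ring_def)

lemma (in cring) quad_ring_cring:
  assumes a: "a \<in> carrier R" and b: "b \<in> carrier R"
  shows "cring (quad_ring R b a)"
proof (rule cringI)
  show "abelian_group (quad_ring R b a)"
  proof (rule abelian_groupI)
    fix x assume "x \<in> carrier (quad_ring R b a)"
    then show "\<exists>y\<in>carrier (quad_ring R b a). y \<oplus>\<^bsub>quad_ring R b a\<^esub> x = \<zero>\<^bsub>quad_ring R b a\<^esub>"
      by (intro bexI[of _ "(\<ominus> fst x, \<ominus> snd x)"]) (auto simp: l_neg)
  qed (auto simp: a_ac)
  show "comm_monoid (quad_ring R b a)"
  proof (rule comm_monoidI)
    show "x \<otimes>\<^bsub>quad_ring R b a\<^esub> y \<otimes>\<^bsub>quad_ring R b a\<^esub> z = x \<otimes>\<^bsub>quad_ring R b a\<^esub> (y \<otimes>\<^bsub>quad_ring R b a\<^esub> z)"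
      if "x \<in> carrier (quad_ring R b a)" "y \<in> carrier (quad_ring R b a)"
        "z \<in> carrier (quad_ring R b a)" for x y z
    proof -
      obtain x1 x2 y1 y2 z1 z2 where [simp]: "x = (x1, x2)" "y = (y1, y2)" "z = (z1, z2)"
        by (metis surj_pair)
      have cl: "x1 \<in> carrier R" "x2 \<in> carrier R" "y1 \<in> carrier R" "y2 \<in> carrier R"
        "z1 \<in> carrier R" "z2 \<in> carrier R" using that by auto
      show ?thesis
      proof (simp, intro conjI)
      qed (use cl a b in algebra)+
    qed
    show "x \<otimes>\<^bsub>quad_ring R b a\<^esub> y = y \<otimes>\<^bsub>quad_ring R b a\<^esub> x"
      if "x \<in> carrier (quad_ring R b a)" "y \<in> carrier (quad_ring R b a)" for x y
      using that by (cases x, cases y) (simp add: m_comm a_comm)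
  qed (auto simp: a b minus_eq)
  show "(x \<oplus>\<^bsub>quad_ring R b a\<^esub> y) \<otimes>\<^bsub>quad_ring R b a\<^esub> z = x \<otimes>\<^bsub>quad_ring R b a\<^esub> z \<oplus>\<^bsub>quad_ring R b a\<^esub> y \<otimes>\<^bsub>quad_ring R b a\<^esub> z"
    if "x \<in> carrier (quad_ring R b a)" "y \<in> carrier (quad_ring R b a)"
      "z \<in> carrier (quad_ring R b a)" for x y z
  proof -
    obtain x1 x2 y1 y2 z1 z2 where [simp]: "x = (x1, x2)" "y = (y1, y2)" "z = (z1, z2)"
      by (metis surj_pair)
    have cl: "x1 \<in> carrier R" "x2 \<in> carrier R" "y1 \<in> carrier R" "y2 \<in> carrier R"
      "z1 \<in> carrier R" "z2 \<in> carrier R" using that by auto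
    show ?thesis
    proof (simp, intro conjI)
    qed (use cl a b in algebra)+
  qed
qed

lemma (in cring) quad_ring_hom: "b \<in> carrier R \<Longrightarrow> a \<in> carrier R \<Longrightarrow> (\<lambda>x. (x, \<zero>)) \<in> ring_hom R (quad_ring R b a)"
  by (rule ring_hom_memI) (auto simp: minus_eq)

text \<open>The expression in \<open>N\<close> is the norm of x + y Z: the conjugate of Z is -b - Z,
  so that of x + y Z is (x - b y) - y Z, and dividing the conjugate by the norm gives the
  inverse.\<close>

lemma (in cring) quad_ring_norm_unit:
  assumes a: "a \<in> carrier R" and b: "b \<in> carrier R" and x: "x \<in> carrier R" and y: "y \<in> carrier R"
    and N: "x \<otimes> x \<ominus> b \<otimes> (x \<otimes> y) \<oplus> a \<otimes> (y \<otimes> y) \<in> Units R" (is "?N \<in> _")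
  shows "(x, y) \<in> Units (quad_ring R b a)"
proof -
  interpret Q: cring "quad_ring R b a" using quad_ring_cring a b .
  define n where "n = inv ?N"
  have n: "n \<in> carrier R" "?N \<otimes> n = \<one>" using N unfolding n_def by auto
  have "(x \<otimes> ((x \<ominus> b \<otimes> y) \<otimes> n) \<ominus> a \<otimes> (y \<otimes> (\<ominus> (y \<otimes> n)))) = ?N \<otimes> n"
    using a b x y n(1) by algebra
  moreover have "x \<otimes> \<ominus> (y \<otimes> n) \<oplus> y \<otimes> ((x \<ominus> b \<otimes> y) \<otimes> n) \<ominus> b \<otimes> (y \<otimes> \<ominus> (y \<otimes> n)) = \<zero>"
    using a b x y n(1) by algebra
  ultimately have "(x, y) \<otimes>\<^bsub>quad_ring R b a\<^esub> ((x \<ominus> b \<otimes> y) \<otimes> n, \<ominus> (y \<otimes> n)) = \<one>\<^bsub>quad_ring R b a\<^esub>"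
    using n(2) by simp
  moreover have "((x \<ominus> b \<otimes> y) \<otimes> n, \<ominus> (y \<otimes> n)) \<in> carrier (quad_ring R b a)"
    using a b x y n by simp
  ultimately have "(x, y) divides\<^bsub>quad_ring R b a\<^esub> \<one>\<^bsub>quad_ring R b a\<^esub>" by (metis dividesI)
  then show ?thesis using Q.divides_one[of "(x, y)"] x y by simp
qed

text \<open>Scalars act coordinatewise. This is how \<open>p\<close>-adic separatedness passes from
  \<open>R\<close> to the quadratic extension.\<close>

lemma (in cring) quad_ring_scalar_divides:
  assumes a: "a \<in> carrier R" and b: "b \<in> carrier R" and c: "c \<in> carrier R"
    and "x \<in> carrier R" "y \<in> carrier R"
  shows "(c, \<zero>) divides\<^bsub>quad_ring R b a\<^esub> (x, y) \<longleftrightarrow> c divides x \<and> c divides y"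
proof -
  have mult: "(c, \<zero>) \<otimes>\<^bsub>quad_ring R b a\<^esub> (v, w) = (c \<otimes> v, c \<otimes> w)" if "v \<in> carrier R" "w \<in> carrier R" for v w
    using that a b c by (simp add: minus_eq)
  show ?thesis
  proof
    assume "(c, \<zero>) divides\<^bsub>quad_ring R b a\<^esub> (x, y)"
    then obtain v w where vw: "v \<in> carrier R" "w \<in> carrier R" "(x, y) = (c, \<zero>) \<otimes>\<^bsub>quad_ring R b a\<^esub> (v, w)"
      unfolding factor_def by auto
    have "x = c \<otimes> v" "y = c \<otimes> w" using vw(3) unfolding mult[OF vw(1,2)] by auto
    then show "c divides x \<and> c divides y" using vw(1,2) by (auto intro: dividesI)
  next
    assume "c divides x \<and> c divides y"
    then obtain v w where "v \<in> carrier R" "w \<in> carrier R" "x = c \<otimes> v" "y = c \<otimes> w"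
      unfolding factor_def by auto
    then show "(c, \<zero>) divides\<^bsub>quad_ring R b a\<^esub> (x, y)"
      using mult[of v w] by (intro dividesI[of "(v, w)"]) auto
  qed
qed

section \<open>Inert and ramified quadratic extensions\<close>

context uniformized
begin

lemma p_divides_square: "x \<in> carrier R \<Longrightarrow> p divides x \<otimes> x \<Longrightarrow> p divides x"
  using unit_iff[of x] unit_iff[of "x \<otimes> x"] by auto

lemma quad_ring_scalar_pow:
  assumes "a \<in> carrier R" "b \<in> carrier R"
  shows "(p, \<zero>) [^]\<^bsub>quad_ring R b a\<^esub> (n::nat) = (p [^] n, \<zero>)"
proof -
  interpret Q: cring "quad_ring R b a" using quad_ring_cring assms .
  interpret H: ring_hom_cring R "quad_ring R b a" "\<lambda>x. (x, \<zero>)"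
    by unfold_locales (use quad_ring_hom assms in blast)
  show ?thesis using H.hom_pow[of p n] by simp
qed

text \<open>By \<open>irr\<close> the polynomial Z^2 + b Z + a has no root modulo \<open>p\<close>,
  so it stays irreducible there and \<open>p\<close> remains a uniformizer. Concretely, the norm of
  a nonunit is divisible by \<open>p\<close>, and the norm form modulo \<open>p\<close> vanishes
  only at (0, 0), so both coordinates are multiples of \<open>p\<close>.\<close>

lemma uniformized_quad_ring_inert:
  assumes a: "a \<in> carrier R" and b: "b \<in> carrier R"
    and irr: "\<And>e. e \<in> carrier R \<Longrightarrow> \<not> p divides (e \<otimes> e \<oplus> b \<otimes> e \<oplus> a)"
  shows "uniformized (quad_ring R b a) (p, \<zero>)"
proof -
  interpret Q: cring "quad_ring R b a" using quad_ring_cring a b .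
  show ?thesis
  proof (unfold_locales)
    show "(p, \<zero>) \<in> carrier (quad_ring R b a)" by simp
    have "\<not> p divides \<one>" using divides_one p_nonunit by simp
    then show "(p, \<zero>) \<notin> Units (quad_ring R b a)"
      using Q.divides_one[of "(p, \<zero>)"] quad_ring_scalar_divides[OF a b p_closed one_closed zero_closed] by simp
  next
    fix v assume "v \<in> carrier (quad_ring R b a)" "(p, \<zero>) \<otimes>\<^bsub>quad_ring R b a\<^esub> v = \<zero>\<^bsub>quad_ring R b a\<^esub>"
    then show "v = \<zero>\<^bsub>quad_ring R b a\<^esub>"
      using a b p_regular by (cases v) (auto simp: minus_eq)
  next
    fix v assume v: "v \<in> carrier (quad_ring R b a)" "v \<notin> Units (quad_ring R b a)"
    obtain x y where xy: "v = (x, y)" "x \<in> carrier R" "y \<in> carrier R" using v(1) by auto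
    let ?N = "x \<otimes> x \<ominus> b \<otimes> (x \<otimes> y) \<oplus> a \<otimes> (y \<otimes> y)"
    have Nc: "?N \<in> carrier R" using a b xy by simp
    have pN: "p divides ?N"
      using quad_ring_norm_unit[OF a b xy(2,3)] v(2) unit_iff[OF Nc] unfolding xy(1) by blast
    have py: "p divides y"
    proof (rule ccontr)
      assume "\<not> p divides y"
      then have "y \<in> Units R" using unit_iff xy by simp
      define w where "w = inv y"
      have w: "w \<in> carrier R" "y \<otimes> w = \<one>" using \<open>y \<in> Units R\<close> unfolding w_def by auto
      \<comment> \<open>If \<open>y\<close> is a unit, the norm of x + y Z is y^2 times the value of
        the polynomial at -x/y, which is a unit by \<open>irr\<close>.\<close>
      define e where "e = \<ominus> (x \<otimes> w)"
      have e: "e \<in> carrier R" "x = \<ominus> (e \<otimes> y)"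
      proof -
        show "e \<in> carrier R" using xy w unfolding e_def by simp
        have "\<ominus> (e \<otimes> y) = x \<otimes> (y \<otimes> w)" using xy w(1) unfolding e_def by algebra
        then show "x = \<ominus> (e \<otimes> y)" using w xy by simp
      qed
      have "?N = (e \<otimes> e \<oplus> b \<otimes> e \<oplus> a) \<otimes> (y \<otimes> y)"
        using a b xy(3) e(1) unfolding e(2) by algebra
      moreover have "e \<otimes> e \<oplus> b \<otimes> e \<oplus> a \<in> Units R" using irr[OF e(1)] unit_iff a b e(1) by simp
      ultimately have "?N \<in> Units R" using \<open>y \<in> Units R\<close> by simp
      then show False using pN unit_iff[OF Nc] by simp
    qed
    have "x \<otimes> x = ?N \<ominus> (a \<otimes> y \<ominus> b \<otimes> x) \<otimes> y" using a b xy(2,3) by algebra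
    moreover have "p divides (?N \<ominus> (a \<otimes> y \<ominus> b \<otimes> x) \<otimes> y)"
      by (intro divides_minus[OF p_closed pN] divides_mult_right(2)[OF p_closed py]) (use a b xy in simp)
    ultimately have "p divides (x \<otimes> x)" by simp
    then have "p divides x" by (rule p_divides_square[OF xy(2)])
    then show "(p, \<zero>) divides\<^bsub>quad_ring R b a\<^esub> v"
      using py quad_ring_scalar_divides[OF a b p_closed xy(2,3)] xy(1) by simp
  next
    fix v assume v: "v \<in> carrier (quad_ring R b a)"
      "\<And>n::nat. (p, \<zero>) [^]\<^bsub>quad_ring R b a\<^esub> n divides\<^bsub>quad_ring R b a\<^esub> v"
    obtain x y where xy: "v = (x, y)" "x \<in> carrier R" "y \<in> carrier R" using v(1) by auto
    have "p [^] n divides x" "p [^] n divides y" for n :: nat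
      using v(2)[of n] quad_ring_scalar_divides[OF a b nat_pow_closed[OF p_closed] xy(2,3), of n]
      unfolding xy(1) quad_ring_scalar_pow[OF a b] by auto
    then have "x = \<zero>" "y = \<zero>" using separated xy(2,3) by blast+
    then show "v = \<zero>\<^bsub>quad_ring R b a\<^esub>" using xy(1) by simp
  qed
qed

text \<open>From Z (Z + b) = -p u one gets p = -Z (Z + b) / u, so Z divides \<open>p\<close> and
  therefore every x + y Z whose \<open>x\<close> is a multiple of \<open>p\<close>. The witness in
  the proof is the resulting quotient.\<close>

lemma quad_ring_eisenstein_divides:
  assumes a: "a \<in> carrier R" and b: "b \<in> carrier R"
    and u: "u \<in> Units R" "a = p \<otimes> u"
    and x: "x \<in> carrier R" "p divides x" and y: "y \<in> carrier R"
  shows "(\<zero>, \<one>) divides\<^bsub>quad_ring R b a\<^esub> (x, y)"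
proof -
  obtain x1 where x1: "x1 \<in> carrier R" "x = p \<otimes> x1" using x unfolding factor_def by auto
  define w where "w = inv u"
  have w: "w \<in> carrier R" "u \<otimes> w = \<one>" using u unfolding w_def by auto
  have uc: "u \<in> carrier R" using u by auto
  have "\<zero> \<otimes> (y \<ominus> b \<otimes> (x1 \<otimes> w)) \<ominus> p \<otimes> u \<otimes> (\<one> \<otimes> \<ominus> (x1 \<otimes> w)) = p \<otimes> x1 \<otimes> (u \<otimes> w)"
    using b y x1(1) w(1) uc p_closed by algebra
  also have "\<dots> = x" using w x1 by simp
  finally have 1: "\<zero> \<otimes> (y \<ominus> b \<otimes> (x1 \<otimes> w)) \<ominus> a \<otimes> (\<one> \<otimes> \<ominus> (x1 \<otimes> w)) = x" using u(2) by simp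
  have 2: "\<zero> \<otimes> \<ominus> (x1 \<otimes> w) \<oplus> \<one> \<otimes> (y \<ominus> b \<otimes> (x1 \<otimes> w)) \<ominus> b \<otimes> (\<one> \<otimes> \<ominus> (x1 \<otimes> w)) = y"
    using b y x1(1) w(1) by algebra
  show ?thesis
  proof (rule dividesI)
    show "(y \<ominus> b \<otimes> (x1 \<otimes> w), \<ominus> (x1 \<otimes> w)) \<in> carrier (quad_ring R b a)" using b y x1 w by simp
    show "(x, y) = (\<zero>, \<one>) \<otimes>\<^bsub>quad_ring R b a\<^esub> (y \<ominus> b \<otimes> (x1 \<otimes> w), \<ominus> (x1 \<otimes> w))"
      unfolding quad_ring_simps 1 2 ..
  qed
qed

text \<open>The Eisenstein case, totally ramified, with Z as uniformizer. As \<open>p\<close>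
  divides \<open>a\<close> and \<open>b\<close>, the norm is congruent to x^2 modulo
  \<open>p\<close>, so a nonunit has \<open>x\<close> divisible by \<open>p\<close> and is a
  multiple of Z.\<close>

lemma uniformized_quad_ring_eisenstein:
  assumes b: "b \<in> carrier R" "p divides b"
    and u: "u \<in> Units R" "a = p \<otimes> u"
  shows "uniformized (quad_ring R b a) (\<zero>, \<one>)"
proof -
  have uc: "u \<in> carrier R" using u by auto
  then have a: "a \<in> carrier R" using u by simp
  have pa: "p divides a" using u uc by (auto intro: dividesI)
  have a0: "a \<noteq> \<zero>" using u uc p_regular p_nonzero
    by (metis Units_r_inv Units_inv_closed l_null one_nonzero)
  interpret Q: cring "quad_ring R b a" using quad_ring_cring a b(1) .
  have Zmult: "(\<zero>, \<one>) \<otimes>\<^bsub>quad_ring R b a\<^esub> (x, y) = (\<ominus> (a \<otimes> y), x \<ominus> b \<otimes> y)"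
    if "x \<in> carrier R" "y \<in> carrier R" for x y using that a b by (simp add: minus_eq)
  have Zc: "(\<zero>, \<one>) \<in> carrier (quad_ring R b a)" by simp
  have pc: "(p, \<zero>) \<in> carrier (quad_ring R b a)" by simp
  show ?thesis
  proof (unfold_locales)
    show "(\<zero>, \<one>) \<in> carrier (quad_ring R b a)" by simp
    show "(\<zero>, \<one>) \<notin> Units (quad_ring R b a)"
    proof
      assume "(\<zero>, \<one>) \<in> Units (quad_ring R b a)"
      then have "(\<zero>, \<one>) divides\<^bsub>quad_ring R b a\<^esub> \<one>\<^bsub>quad_ring R b a\<^esub>" using Q.divides_one[OF Zc] by blast
      then obtain v w where vw: "v \<in> carrier R" "w \<in> carrier R"
        "(\<one>, \<zero>) = (\<zero>, \<one>) \<otimes>\<^bsub>quad_ring R b a\<^esub> (v, w)" unfolding factor_def by auto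
      then have "\<one> = \<ominus> (a \<otimes> w)" unfolding Zmult[OF vw(1,2)] by simp
      then have "\<one> = a \<otimes> \<ominus> w" using vw a by (simp add: r_minus)
      then have "p divides \<one>" using divides_mult_right(1)[OF p_closed pa, of "\<ominus> w"] vw by simp
      then show False using divides_one p_nonunit by simp
    qed
  next
    fix v assume v: "v \<in> carrier (quad_ring R b a)" "(\<zero>, \<one>) \<otimes>\<^bsub>quad_ring R b a\<^esub> v = \<zero>\<^bsub>quad_ring R b a\<^esub>"
    obtain x y where xy: "v = (x, y)" "x \<in> carrier R" "y \<in> carrier R" using v(1) by auto
    have 1: "\<ominus> (a \<otimes> y) = \<zero>" "x \<ominus> b \<otimes> y = \<zero>" using v(2) unfolding xy(1) Zmult[OF xy(2,3)] by auto
    have "a \<otimes> y = \<zero>" using 1(1) a xy by (metis add.inv_eq_1_iff m_closed)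
    then have "y = \<zero>" using a0 a xy integral by blast
    then have "x = \<zero>" using 1(2) b xy by (simp add: minus_eq)
    then show "v = \<zero>\<^bsub>quad_ring R b a\<^esub>" using \<open>y = \<zero>\<close> xy by simp
  next
    fix v assume v: "v \<in> carrier (quad_ring R b a)" "v \<notin> Units (quad_ring R b a)"
    obtain x y where xy: "v = (x, y)" "x \<in> carrier R" "y \<in> carrier R" using v(1) by auto
    let ?N = "x \<otimes> x \<ominus> b \<otimes> (x \<otimes> y) \<oplus> a \<otimes> (y \<otimes> y)"
    have Nc: "?N \<in> carrier R" using a b xy by simp
    have pN: "p divides ?N"
      using quad_ring_norm_unit[OF a b(1) xy(2,3)] v(2) unit_iff[OF Nc] unfolding xy(1) by blast
    have "x \<otimes> x = ?N \<ominus> a \<otimes> (y \<otimes> y) \<oplus> b \<otimes> (x \<otimes> y)" using a b(1) xy(2,3) by algebra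
    moreover have "p divides (?N \<ominus> a \<otimes> (y \<otimes> y) \<oplus> b \<otimes> (x \<otimes> y))"
      by (intro divides_minus divides_add divides_mult_right(1) p_closed pN pa b(2)) (use xy in auto)
    ultimately have "p divides (x \<otimes> x)" by simp
    then have "p divides x" by (rule p_divides_square[OF xy(2)])
    then show "(\<zero>, \<one>) divides\<^bsub>quad_ring R b a\<^esub> v"
      using quad_ring_eisenstein_divides[OF a b(1) u xy(2) _ xy(3)] xy(1) by simp
  next
    fix v assume v: "v \<in> carrier (quad_ring R b a)"
      "\<And>n::nat. (\<zero>, \<one>) [^]\<^bsub>quad_ring R b a\<^esub> n divides\<^bsub>quad_ring R b a\<^esub> v"
    obtain x y where xy: "v = (x, y)" "x \<in> carrier R" "y \<in> carrier R" using v(1) by auto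
    have "p divides \<ominus> a" "p divides \<ominus> b"
      using divides_minus[OF p_closed divides_zero[OF p_closed] pa]
        divides_minus[OF p_closed divides_zero[OF p_closed] b(2)] a b by (simp_all add: minus_eq)
    then have Z2: "(p, \<zero>) divides\<^bsub>quad_ring R b a\<^esub> ((\<zero>, \<one>) \<otimes>\<^bsub>quad_ring R b a\<^esub> (\<zero>, \<one>))"
      using quad_ring_scalar_divides[OF a b(1) p_closed, of "\<ominus> a" "\<ominus> b"] a b Zmult[of \<zero> \<one>]
      by (simp add: minus_eq)
    \<comment> \<open>Since Z^2 = -a - b Z is a multiple of \<open>p\<close>, divisibility by Z^(2n)
      implies divisibility by p^n. This reduces separatedness for Z to that for \<open>p\<close>,
      coordinate by coordinate.\<close>
    have Zpow: "(p, \<zero>) [^]\<^bsub>quad_ring R b a\<^esub> n divides\<^bsub>quad_ring R b a\<^esub> (\<zero>, \<one>) [^]\<^bsub>quad_ring R b a\<^esub> (2 * n)" for n :: nat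
    proof (induction n)
      case (Suc n)
      have "(\<zero>, \<one>) [^]\<^bsub>quad_ring R b a\<^esub> (2 * Suc n) = (\<zero>, \<one>) [^]\<^bsub>quad_ring R b a\<^esub> (2 * n) \<otimes>\<^bsub>quad_ring R b a\<^esub> ((\<zero>, \<one>) \<otimes>\<^bsub>quad_ring R b a\<^esub> (\<zero>, \<one>))"
        using Q.m_assoc[OF Q.nat_pow_closed[OF Zc] Zc Zc, of "2 * n"] Q.nat_pow_Suc by simp
      then show ?case
        using Q.divides_mult_both[OF Q.nat_pow_closed[OF pc] pc Suc Z2] by (simp only: Q.nat_pow_Suc)
    qed (simp add: Q.one_divides del: quad_ring_simps)
    have "p [^] n divides x \<and> p [^] n divides y" for n :: nat
    proof -
      have "(p, \<zero>) [^]\<^bsub>quad_ring R b a\<^esub> n divides\<^bsub>quad_ring R b a\<^esub> v"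
        using Q.divides_trans[OF Zpow v(2)] Q.nat_pow_closed[OF pc] by blast
      then show ?thesis
        using quad_ring_scalar_divides[OF a b(1) nat_pow_closed[OF p_closed] xy(2,3), of n]
        unfolding xy(1) quad_ring_scalar_pow[OF a b(1)] by simp
    qed
    then have "x = \<zero>" "y = \<zero>" using separated xy(2,3) by blast+
    then show "v = \<zero>\<^bsub>quad_ring R b a\<^esub>" using xy(1) by simp
  qed
qed

end

text \<open>Taylor expansion at \<open>c\<close>: for g(w) = w^2 + \<beta> w + \<gamma>, the value
  g(c + t Z) is g(c) + (\<beta> + 2c) t Z + t^2 Z^2, which by \<open>const\<close> and
  \<open>lin\<close> equals t^2 (a + b Z + Z^2) = 0.\<close>

lemma (in cring) quad_ring_root:
  assumes cl: "a \<in> carrier R" "b \<in> carrier R" "c \<in> carrier R" "t \<in> carrier R"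
      "\<beta> \<in> carrier R" "\<gamma> \<in> carrier R"
    and const: "c \<otimes> c \<oplus> \<beta> \<otimes> c \<oplus> \<gamma> = a \<otimes> (t \<otimes> t)"
    and lin: "\<beta> \<oplus> (c \<oplus> c) = t \<otimes> b"
  defines "Q \<equiv> quad_ring R b a"
  shows "(c, t) \<otimes>\<^bsub>Q\<^esub> (c, t) \<oplus>\<^bsub>Q\<^esub> (\<beta>, \<zero>) \<otimes>\<^bsub>Q\<^esub> (c, t) \<oplus>\<^bsub>Q\<^esub> (\<gamma>, \<zero>) = \<zero>\<^bsub>Q\<^esub>"
proof -
  have "c \<otimes> c \<ominus> a \<otimes> (t \<otimes> t) \<oplus> (\<beta> \<otimes> c \<ominus> a \<otimes> (\<zero> \<otimes> t)) \<oplus> \<gamma>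
      = (c \<otimes> c \<oplus> \<beta> \<otimes> c \<oplus> \<gamma>) \<ominus> a \<otimes> (t \<otimes> t)" using cl by algebra
  also have "\<dots> = \<zero>" unfolding const using cl by algebra
  finally have 1: "c \<otimes> c \<ominus> a \<otimes> (t \<otimes> t) \<oplus> (\<beta> \<otimes> c \<ominus> a \<otimes> (\<zero> \<otimes> t)) \<oplus> \<gamma> = \<zero>" .
  have "c \<otimes> t \<oplus> t \<otimes> c \<ominus> b \<otimes> (t \<otimes> t) \<oplus> (\<beta> \<otimes> t \<oplus> \<zero> \<otimes> c \<ominus> b \<otimes> (\<zero> \<otimes> t)) \<oplus> \<zero>
      = t \<otimes> (\<beta> \<oplus> (c \<oplus> c)) \<ominus> t \<otimes> (t \<otimes> b)" using cl by algebra
  also have "\<dots> = \<zero>" unfolding lin using cl by algebra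
  finally have 2: "c \<otimes> t \<oplus> t \<otimes> c \<ominus> b \<otimes> (t \<otimes> t) \<oplus> (\<beta> \<otimes> t \<oplus> \<zero> \<otimes> c \<ominus> b \<otimes> (\<zero> \<otimes> t)) \<oplus> \<zero> = \<zero>" .
  show ?thesis unfolding Q_def quad_ring_simps 1 2 ..
qed

section \<open>Roots when the values of the polynomial have bounded valuation\<close>

context uniformized
begin

text \<open>Translation by \<open>c\<close> turns the polynomial into h^2 + \<beta>' h + G with G =
  p^m u and \<open>u\<close> a unit. Substituting h = p^k Z with k = m div 2 and dividing by p^(2k)
  leaves the constant term u or p u, provided p^k divides \<beta>'. The maximality of m yields this
  divisibility and the irreducibility.\<close>

lemma root_extension_bounded:
  assumes \<beta>: "\<beta> \<in> carrier R" and \<gamma>: "\<gamma> \<in> carrier R" "p divides \<gamma>"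
    and c: "c \<in> carrier R" "p divides c" "p [^] (m::nat) divides (c \<otimes> c \<oplus> \<beta> \<otimes> c \<oplus> \<gamma>)"
    and max: "\<And>e. e \<in> carrier R \<Longrightarrow> p divides e \<Longrightarrow> \<not> p [^] Suc m divides (e \<otimes> e \<oplus> \<beta> \<otimes> e \<oplus> \<gamma>)"
  shows "\<exists>(T :: 'a ring) k r w. dvr_extension R T k \<and> uniformizer T r \<and> w \<in> PIdl\<^bsub>T\<^esub> r \<and>
    w \<otimes>\<^bsub>T\<^esub> w \<oplus>\<^bsub>T\<^esub> k \<beta> \<otimes>\<^bsub>T\<^esub> w \<oplus>\<^bsub>T\<^esub> k \<gamma> = \<zero>\<^bsub>T\<^esub>"
proof -
  define \<beta>' where "\<beta>' = \<beta> \<oplus> (c \<oplus> c)"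
  define G where "G = c \<otimes> c \<oplus> \<beta> \<otimes> c \<oplus> \<gamma>"
  have cl: "\<beta>' \<in> carrier R" "G \<in> carrier R" unfolding \<beta>'_def G_def using \<beta> \<gamma> c by auto
  have shift: "(c \<oplus> h) \<otimes> (c \<oplus> h) \<oplus> \<beta> \<otimes> (c \<oplus> h) \<oplus> \<gamma> = h \<otimes> h \<oplus> \<beta>' \<otimes> h \<oplus> G" if "h \<in> carrier R" for h
    unfolding \<beta>'_def G_def using \<beta> \<gamma>(1) c(1) that by algebra
  have max': "\<not> p [^] Suc m divides (h \<otimes> h \<oplus> \<beta>' \<otimes> h \<oplus> G)" if "h \<in> carrier R" "p divides h" for h
    using max[of "c \<oplus> h"] shift[OF that(1)] that c divides_add[OF p_closed c(2) that(2)] by simp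
  obtain u where uc: "u \<in> carrier R" and u: "G = p [^] m \<otimes> u"
    using c(3) unfolding G_def factor_def by auto
  have "\<not> p divides u"
  proof
    assume "p divides u"
    then have "p [^] m \<otimes> p divides p [^] m \<otimes> u" by (simp add: divides_mult)
    then show False using max[OF c(1,2)] u unfolding G_def by simp
  qed
  then have uu: "u \<in> Units R" using unit_iff uc by simp
  \<comment> \<open>The value at 0 is \<gamma>, a multiple of \<open>p\<close>, so the maximum is at
    least 1. For even m this makes k positive, which puts c + t Z into the maximal ideal.\<close>
  have "m \<noteq> 0"
  proof
    assume "m = 0"
    then show False using max[OF zero_closed divides_zero[OF p_closed]] \<beta> \<gamma> by simp
  qed
  \<comment> \<open>The range \<open>2 * k \<le> Suc m\<close> covers m div 2 and, for odd m, also
    the next exponent, which supplies the extra factor \<open>p\<close> of the Eisenstein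
    condition.\<close>
  have \<beta>'_dvd: "2 * k \<le> Suc m \<Longrightarrow> p [^] k divides \<beta>'" for k
  proof (induction k)
    case 0 then show ?case using cl by (simp add: one_divides)
  next
    case (Suc k)
    then obtain w where w: "w \<in> carrier R" "\<beta>' = p [^] k \<otimes> w" unfolding factor_def by auto
    have "p divides w"
    proof (rule ccontr)
      assume "\<not> p divides w"
      then have wu: "w \<in> Units R" using unit_iff w by simp
      define w' where "w' = inv w"
      have w': "w' \<in> carrier R" "w \<otimes> w' = \<one>" using wu unfolding w'_def by auto
      define P where "P = p [^] (m - k)"
      define P' where "P' = p [^] k"
      have P: "P \<in> carrier R" "P' \<in> carrier R" unfolding P_def P'_def by auto
      \<comment> \<open>The Newton correction -G/\<beta>'. If \<beta>' were exactly divisible by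
        p^k, it would have valuation m - k > 0 and cancel the linear term against the constant one.
        What remains is h^2, of valuation 2(m - k) \<ge> m + 1, against the maximality of m.\<close>
      define h where "h = \<ominus> (P \<otimes> (u \<otimes> w'))"
      have hc: "h \<in> carrier R" unfolding h_def using P uc w' by simp
      have "\<beta>' \<otimes> h = \<ominus> (P' \<otimes> P \<otimes> u \<otimes> (w \<otimes> w'))"
        unfolding w(2) h_def P'_def[symmetric] using P uc w(1) w'(1) by algebra
      also have "\<dots> = \<ominus> (P' \<otimes> P \<otimes> u)" using w' P uc by simp
      also have "P' \<otimes> P = p [^] m" using Suc.prems unfolding P_def P'_def by (simp add: nat_pow_mult)
      finally have "\<beta>' \<otimes> h = \<ominus> G" unfolding u .
      then have eq: "h \<otimes> h \<oplus> \<beta>' \<otimes> h \<oplus> G = h \<otimes> h"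
        using hc cl by (simp add: a_assoc l_neg)
      have Ph: "P divides h"
        unfolding h_def using P uc w' by (intro dividesI[of "\<ominus> (u \<otimes> w')"]) (simp_all add: r_minus)
      have "p [^] Suc m divides p [^] ((m - k) + (m - k))"
        using Suc.prems by (intro pow_divides_pow) simp
      moreover have "p [^] ((m - k) + (m - k)) = P \<otimes> P" unfolding P_def by (rule nat_pow_mult[OF p_closed, symmetric])
      ultimately have "p [^] Suc m divides h \<otimes> h"
        using divides_mult_both[OF P(1) P(1) Ph Ph] divides_trans
        by (metis nat_pow_closed p_closed)
      moreover have "p divides h"
        using pow_divides_le[of 1 "m - k" h] Ph Suc.prems unfolding P_def by simp
      ultimately show False using max'[OF hc] unfolding eq by blast
    qed
    then have "p [^] k \<otimes> p divides p [^] k \<otimes> w" using w by (simp add: divides_mult)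
    then show ?case using w by simp
  qed
  define k where "k = m div 2"
  define t where "t = p [^] k"
  have t: "t \<in> carrier R" "t \<otimes> t = p [^] (k + k)" unfolding t_def by (auto simp: nat_pow_mult)
  have unif: "uniformized R p" by (rule uniformized_axioms)
  \<comment> \<open>A pair is entered twice, to fit the quadruples expected by
    \<open>root_extension_transfer\<close>.\<close>
  have inj: "inj_on (\<lambda>v::'a \<times> 'a. (v, v)) A" for A by (rule inj_onI) simp
  show ?thesis
  proof (cases "even m")
    case True
    then have m: "m = k + k" unfolding k_def by auto
    then have "k \<noteq> 0" using \<open>m \<noteq> 0\<close> by simp
    then have pt: "p divides t" using pow_divides_pow[of 1 k] unfolding t_def by simp
    obtain b where b: "b \<in> carrier R" "\<beta>' = t \<otimes> b"
      using \<beta>'_dvd[of k] m unfolding t_def factor_def by auto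
    \<comment> \<open>A root \<open>e\<close> modulo \<open>p\<close> of the rescaled polynomial
      would make the value at c + t e divisible by p^(m+1). The point is admissible because
      \<open>p\<close> divides \<open>t\<close>.\<close>
    have irr: "\<not> p divides (e \<otimes> e \<oplus> b \<otimes> e \<oplus> u)" if e: "e \<in> carrier R" for e
    proof
      assume "p divides (e \<otimes> e \<oplus> b \<otimes> e \<oplus> u)"
      then have 1: "t \<otimes> t \<otimes> p divides t \<otimes> t \<otimes> (e \<otimes> e \<oplus> b \<otimes> e \<oplus> u)" using t(1) by (intro divides_mult) auto
      have 2: "t \<otimes> t \<otimes> (e \<otimes> e \<oplus> b \<otimes> e \<oplus> u) = (t \<otimes> e) \<otimes> (t \<otimes> e) \<oplus> \<beta>' \<otimes> (t \<otimes> e) \<oplus> t \<otimes> t \<otimes> u"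
        unfolding b(2) using t(1) e b(1) uc by algebra
      have "t \<otimes> t \<otimes> u = G" "t \<otimes> t \<otimes> p = p [^] Suc m" using u m t(2) by auto
      then show False
        using max'[OF m_closed[OF t(1) e] divides_mult_right(1)[OF p_closed pt e]] 1 2 by simp
    qed
    interpret S: uniformized "quad_ring R b u" "(p, \<zero>)" by (rule uniformized_quad_ring_inert[OF uc b(1) irr])
    have "c \<otimes> c \<oplus> \<beta> \<otimes> c \<oplus> \<gamma> = u \<otimes> (t \<otimes> t)" using u uc m t unfolding G_def by (simp add: m_comm)
    note root = quad_ring_root[OF uc b(1) c(1) t(1) \<beta> \<gamma>(1) this b(2)[unfolded \<beta>'_def]]
    show ?thesis
    proof (rule root_extension_transfer[OF unif S.uniformized_axioms quad_ring_hom[OF b(1) uc] _ _ inj _ \<beta> \<gamma>(1) _ _ root])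
      show "(p, \<zero>) divides\<^bsub>quad_ring R b u\<^esub> (p, \<zero>)" by (rule S.divides_refl) simp
      show "(p, \<zero>) \<noteq> \<zero>\<^bsub>quad_ring R b u\<^esub>" using p_nonzero by simp
      show "(p, \<zero>) divides\<^bsub>quad_ring R b u\<^esub> (c, t)"
        using quad_ring_scalar_divides[OF uc b(1) p_closed c(1) t(1)] c pt by simp
    qed (use c t in auto)
  next
    case False
    then have m: "m = Suc (k + k)" unfolding k_def by presburger
    obtain b1 where b1: "b1 \<in> carrier R" "\<beta>' = p [^] Suc k \<otimes> b1"
      using \<beta>'_dvd[of "Suc k"] m unfolding factor_def by auto
    define b where "b = p \<otimes> b1"
    have b: "b \<in> carrier R" "p divides b" "\<beta>' = t \<otimes> b"
      unfolding b_def t_def using b1 by (auto intro: dividesI simp: m_assoc)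
    define a where "a = p \<otimes> u"
    have a: "a \<in> carrier R" unfolding a_def using uc by simp
    interpret S: uniformized "quad_ring R b a" "(\<zero>, \<one>)"
      by (rule uniformized_quad_ring_eisenstein[OF b(1,2) uu a_def])
    have "c \<otimes> c \<oplus> \<beta> \<otimes> c \<oplus> \<gamma> = a \<otimes> (t \<otimes> t)"
      using u uc m t unfolding G_def a_def by (simp add: m_ac)
    note root = quad_ring_root[OF a b(1) c(1) t(1) \<beta> \<gamma>(1) this b(3)[unfolded \<beta>'_def]]
    show ?thesis
    proof (rule root_extension_transfer[OF unif S.uniformized_axioms quad_ring_hom[OF b(1) a] _ _ inj _ \<beta> \<gamma>(1) _ _ root])
      show "(\<zero>, \<one>) divides\<^bsub>quad_ring R b a\<^esub> (p, \<zero>)"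
        by (rule quad_ring_eisenstein_divides[OF a b(1) uu a_def]) auto
      show "(p, \<zero>) \<noteq> \<zero>\<^bsub>quad_ring R b a\<^esub>" using p_nonzero by simp
      show "(\<zero>, \<one>) divides\<^bsub>quad_ring R b a\<^esub> (c, t)"
        by (rule quad_ring_eisenstein_divides[OF a b(1) uu a_def c(1,2) t(1)])
    qed (use c t in auto)
  qed
qed

end

section \<open>Completion\<close>

text \<open>The entry \<open>x n\<close> represents a class modulo p^n. Sequences of
  representatives, rather than of residue classes, keep the operations pointwise in
  \<open>R\<close>. The entry at 0 carries no information, so the residue modulo \<open>p\<close> is
  read off from \<open>x 1\<close>.\<close>

definition coherent_seqs :: "('a, 'm) ring_scheme \<Rightarrow> 'a \<Rightarrow> (nat \<Rightarrow> 'a) ring" where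
  "coherent_seqs R p =
     \<lparr>carrier = {x. \<forall>n. x n \<in> carrier R \<and> p [^]\<^bsub>R\<^esub> n divides\<^bsub>R\<^esub> (x (Suc n) \<ominus>\<^bsub>R\<^esub> x n)},
      monoid.mult = (\<lambda>x y n. x n \<otimes>\<^bsub>R\<^esub> y n), one = (\<lambda>n. \<one>\<^bsub>R\<^esub>),
      ring.zero = (\<lambda>n. \<zero>\<^bsub>R\<^esub>), ring.add = (\<lambda>x y n. x n \<oplus>\<^bsub>R\<^esub> y n)\<rparr>"

definition null_seqs :: "('a, 'm) ring_scheme \<Rightarrow> 'a \<Rightarrow> (nat \<Rightarrow> 'a) set" where
  "null_seqs R p = {x \<in> carrier (coherent_seqs R p). \<forall>n. p [^]\<^bsub>R\<^esub> n divides\<^bsub>R\<^esub> x n}"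

text \<open>Coherent sequences modulo null sequences are the inverse limit of the rings \<open>R/p\<^sup>n\<close>.\<close>

definition completion :: "('a, 'm) ring_scheme \<Rightarrow> 'a \<Rightarrow> (nat \<Rightarrow> 'a) set ring" where
  "completion R p = coherent_seqs R p Quot null_seqs R p"

definition to_completion :: "('a, 'm) ring_scheme \<Rightarrow> 'a \<Rightarrow> 'a \<Rightarrow> (nat \<Rightarrow> 'a) set" where
  "to_completion R p x = null_seqs R p +>\<^bsub>coherent_seqs R p\<^esub> (\<lambda>n. x)"

context uniformized
begin

abbreviation "CS \<equiv> coherent_seqs R p"

lemma CS_simps [simp]:
  "\<one>\<^bsub>CS\<^esub> = (\<lambda>n. \<one>)" "\<zero>\<^bsub>CS\<^esub> = (\<lambda>n. \<zero>)"
  "x \<oplus>\<^bsub>CS\<^esub> y = (\<lambda>n. x n \<oplus> y n)" "x \<otimes>\<^bsub>CS\<^esub> y = (\<lambda>n. x n \<otimes> y n)"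
  by (simp_all add: coherent_seqs_def)

lemma coherent_iff: "x \<in> carrier CS \<longleftrightarrow> (\<forall>n. x n \<in> carrier R \<and> p [^] n divides (x (Suc n) \<ominus> x n))"
  by (simp add: coherent_seqs_def)

lemma coherentD:
  assumes "x \<in> carrier CS" shows "x n \<in> carrier R" "p [^] n divides (x (Suc n) \<ominus> x n)"
  using assms by (simp_all add: coherent_iff)

lemma coherent_const [simp]: "c \<in> carrier R \<Longrightarrow> (\<lambda>n. c) \<in> carrier CS"
  by (simp add: coherent_iff minus_eq r_neg divides_zero)

lemma coherent_add: assumes x: "x \<in> carrier CS" and y: "y \<in> carrier CS" shows "(\<lambda>n. x n \<oplus> y n) \<in> carrier CS"
proof -
  have "p [^] n divides (x (Suc n) \<oplus> y (Suc n) \<ominus> (x n \<oplus> y n))" for n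
  proof -
    have "x (Suc n) \<oplus> y (Suc n) \<ominus> (x n \<oplus> y n) = (x (Suc n) \<ominus> x n) \<oplus> (y (Suc n) \<ominus> y n)"
      using coherentD(1)[OF x] coherentD(1)[OF y] by algebra
    then show ?thesis using divides_add[OF _ coherentD(2)[OF x] coherentD(2)[OF y]] by simp
  qed
  then show ?thesis using coherentD(1)[OF x] coherentD(1)[OF y] by (simp add: coherent_iff)
qed

lemma coherent_mult: assumes x: "x \<in> carrier CS" and y: "y \<in> carrier CS" shows "(\<lambda>n. x n \<otimes> y n) \<in> carrier CS"
proof -
  have "p [^] n divides (x (Suc n) \<otimes> y (Suc n) \<ominus> (x n \<otimes> y n))" for n
  proof -
    have "x (Suc n) \<otimes> y (Suc n) \<ominus> (x n \<otimes> y n) = (x (Suc n) \<ominus> x n) \<otimes> y (Suc n) \<oplus> x n \<otimes> (y (Suc n) \<ominus> y n)"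
      using coherentD(1)[OF x] coherentD(1)[OF y] by algebra
    moreover have "p [^] n divides ((x (Suc n) \<ominus> x n) \<otimes> y (Suc n) \<oplus> x n \<otimes> (y (Suc n) \<ominus> y n))"
      using coherentD[OF x] coherentD[OF y] by (intro divides_add divides_mult_right) auto
    ultimately show ?thesis by simp
  qed
  then show ?thesis using coherentD(1)[OF x] coherentD(1)[OF y] by (simp add: coherent_iff)
qed

lemma cring_CS: "cring CS"
proof (rule cringI)
  show "abelian_group CS"
  proof (rule abelian_groupI)
    fix x assume x: "x \<in> carrier CS"
    have "(\<lambda>n. \<ominus> \<one> \<otimes> x n) \<in> carrier CS" by (rule coherent_mult[OF coherent_const x]) simp
    moreover have "(\<lambda>n. \<ominus> \<one> \<otimes> x n \<oplus> x n) = (\<lambda>n. \<zero>)"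
      using coherentD(1)[OF x] by (simp add: l_minus l_neg)
    ultimately show "\<exists>y\<in>carrier CS. y \<oplus>\<^bsub>CS\<^esub> x = \<zero>\<^bsub>CS\<^esub>" by auto
  qed (auto simp: coherent_add coherentD(1) a_ac)
  show "comm_monoid CS"
    by (rule comm_monoidI) (auto simp: coherent_mult coherentD(1) m_ac)
qed (auto simp: coherentD(1) l_distr)

sublocale CS: cring CS by (rule cring_CS)

lemma CS_minus:
  assumes "x \<in> carrier CS" "y \<in> carrier CS" shows "x \<ominus>\<^bsub>CS\<^esub> y = (\<lambda>n. x n \<ominus> y n)"
proof -
  have "(\<lambda>n. \<ominus> \<one> \<otimes> y n) \<in> carrier CS" by (rule coherent_mult[OF coherent_const assms(2)]) simp
  moreover have "(\<lambda>n. \<ominus> \<one> \<otimes> y n) \<oplus>\<^bsub>CS\<^esub> y = \<zero>\<^bsub>CS\<^esub>"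
    using coherentD(1)[OF assms(2)] by (simp add: l_minus l_neg)
  ultimately have "\<ominus>\<^bsub>CS\<^esub> y = (\<lambda>n. \<ominus> \<one> \<otimes> y n)" using assms(2) CS.minus_equality by blast
  then show ?thesis using coherentD(1)[OF assms(2)] unfolding CS.minus_eq
    by (simp add: minus_eq l_minus)
qed

lemma null_iff: "x \<in> null_seqs R p \<longleftrightarrow> x \<in> carrier CS \<and> (\<forall>n. p [^] n divides x n)"
  by (simp add: null_seqs_def)

lemma ideal_null: "ideal (null_seqs R p) CS"
proof (rule idealI[OF CS.ring_axioms])
  show "subgroup (null_seqs R p) (add_monoid CS)"
  proof (rule CS.add.subgroupI)
    show "null_seqs R p \<noteq> {}" using null_iff[of "\<lambda>n. \<zero>"] by (auto simp: divides_zero)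
    show "\<ominus>\<^bsub>CS\<^esub> x \<in> null_seqs R p" if "x \<in> null_seqs R p" for x
    proof -
      have x: "x \<in> carrier CS" "\<And>n. p [^] n divides x n" using that by (auto simp: null_iff)
      have "p [^] n divides (\<zero> \<ominus> x n)" for n using x(2) by (intro divides_minus divides_zero) auto
      moreover have "\<ominus>\<^bsub>CS\<^esub> x = (\<lambda>n. \<zero> \<ominus> x n)"
        using CS_minus[of "\<lambda>n. \<zero>" x] x(1) CS.minus_eq[of "\<zero>\<^bsub>CS\<^esub>" x] CS.l_zero[of "\<ominus>\<^bsub>CS\<^esub> x"] by auto
      ultimately show ?thesis using CS.a_inv_closed[OF x(1)] by (simp add: null_iff)
    qed
  qed (auto simp: null_iff coherent_add divides_add)
qed (auto simp: null_iff coherent_mult coherentD(1) intro: divides_mult_right)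

abbreviation "Comp \<equiv> completion R p"
abbreviation "cls \<equiv> (\<lambda>x. null_seqs R p +>\<^bsub>CS\<^esub> x)"

sublocale Comp: cring Comp
  unfolding completion_def using ideal.quotient_is_cring[OF ideal_null cring_CS] .

sublocale cls: ring_hom_cring CS Comp cls
  by unfold_locales (use ideal.rcos_ring_hom[OF ideal_null] in \<open>simp add: completion_def\<close>)

lemma cls_eq_iff: "x \<in> carrier CS \<Longrightarrow> y \<in> carrier CS \<Longrightarrow> cls x = cls y \<longleftrightarrow> (\<forall>n. p [^] n divides (x n \<ominus> y n))"
  using CS.quotient_eq_iff_same_a_r_cos[OF ideal_null, of x y] CS_minus[of x y] CS.minus_closed[of x y]
  by (simp add: null_iff)

lemma Comp_cases:
  assumes "v \<in> carrier Comp" obtains x where "x \<in> carrier CS" "v = cls x"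
  using assms unfolding completion_def FactRing_def A_RCOSETS_def' by auto

text \<open>Consecutive entries agree modulo \<open>p\<close> from index 1 on; the entry at 0 is
  unconstrained, hence the successor.\<close>

lemma coherent_dvd_Suc:
  assumes x: "x \<in> carrier CS" and "p divides x 1"
  shows "p divides x (Suc n)"
proof (induction n)
  case (Suc n)
  have "p divides (x (Suc (Suc n)) \<ominus> x (Suc n))"
    using pow_divides_le[OF _ coherentD(2)[OF x], of 1 "Suc n"] by simp
  then have "p divides (x (Suc (Suc n)) \<ominus> x (Suc n) \<oplus> x (Suc n))" using Suc by (intro divides_add) auto
  moreover have "x (Suc (Suc n)) \<ominus> x (Suc n) \<oplus> x (Suc n) = x (Suc (Suc n))"
    using coherentD(1)[OF x] by algebra
  ultimately show ?case by simp
qed (use assms in simp)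

lemma pow_Suc_cancel:
  assumes "x \<in> carrier R" "p [^] Suc n divides p \<otimes> x" shows "p [^] n divides x"
proof -
  have "p \<otimes> p [^] n divides p \<otimes> x" using assms nat_pow_Suc2[of p n] by simp
  then show ?thesis using mult_divides[of "p [^] n" x p] assms(1) p_nonzero by simp
qed

text \<open>Dividing by \<open>p\<close> costs one digit of precision, so the quotient is formed
  from the shifted sequence: \<open>x (Suc n)\<close> is known modulo p^(n+1), hence its quotient by
  \<open>p\<close> modulo p^n.\<close>

lemma cls_divisible:
  assumes x: "x \<in> carrier CS" and "p divides x 1"
  shows "cls (\<lambda>n. p) divides\<^bsub>Comp\<^esub> cls x"
proof -
  have "\<forall>n. \<exists>y. y \<in> carrier R \<and> x (Suc n) = p \<otimes> y"
    using coherent_dvd_Suc[OF assms] unfolding factor_def by blast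
  then obtain y where y: "\<And>n. y n \<in> carrier R" "\<And>n. x (Suc n) = p \<otimes> y n" by metis
  have "p [^] n divides (y (Suc n) \<ominus> y n)" for n
  proof (rule pow_Suc_cancel)
    have "p \<otimes> (y (Suc n) \<ominus> y n) = x (Suc (Suc n)) \<ominus> x (Suc n)" unfolding y(2) using y(1) p_closed by algebra
    then show "p [^] Suc n divides p \<otimes> (y (Suc n) \<ominus> y n)" using coherentD(2)[OF x, of "Suc n"] by simp
  qed (use y in simp)
  then have yc: "y \<in> carrier CS" using y(1) by (simp add: coherent_iff)
  have py: "(\<lambda>n. p \<otimes> y n) \<in> carrier CS" using coherent_mult[OF coherent_const[OF p_closed] yc] .
  have "cls (\<lambda>n. p \<otimes> y n) = cls x"
    using cls_eq_iff[OF py x] coherentD(2)[OF x] unfolding y(2)[symmetric] by simp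
  moreover have "cls (\<lambda>n. p \<otimes> y n) = cls (\<lambda>n. p) \<otimes>\<^bsub>Comp\<^esub> cls y"
    using cls.hom_mult[OF coherent_const[OF p_closed] yc] by simp
  ultimately show ?thesis using yc by (intro dividesI[of "cls y"]) auto
qed

text \<open>The entries from index 1 on are units, and their inverses form a coherent sequence. The
  shift in \<open>y\<close> avoids the entry at 0, which may be a nonunit.\<close>

lemma cls_unit:
  assumes x: "x \<in> carrier CS" and "\<not> p divides x 1"
  shows "cls x \<in> Units Comp"
proof -
  have un: "x (Suc n) \<in> Units R" for n
  proof (induction n)
    case 0 then show ?case using assms unit_iff coherentD(1)[OF x] by simp
  next
    case (Suc n)
    have "\<not> p divides x (Suc (Suc n))"
    proof
      assume *: "p divides x (Suc (Suc n))"
      have "p divides (x (Suc (Suc n)) \<ominus> x (Suc n))"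
        using pow_divides_le[OF _ coherentD(2)[OF x], of 1 "Suc n"] by simp
      note divides_minus[OF p_closed * this]
      moreover have "x (Suc (Suc n)) \<ominus> (x (Suc (Suc n)) \<ominus> x (Suc n)) = x (Suc n)"
        using coherentD(1)[OF x] by algebra
      ultimately show False using Suc unit_iff coherentD(1)[OF x] by simp
    qed
    then show ?case using unit_iff coherentD(1)[OF x] by simp
  qed
  define y where "y n = inv (x (Suc n))" for n
  have y: "y n \<in> carrier R" "x (Suc n) \<otimes> y n = \<one>" for n using un unfolding y_def by auto
  have "p [^] n divides (y (Suc n) \<ominus> y n)" for n
  proof -
    have "(x (Suc n) \<ominus> x (Suc (Suc n))) \<otimes> (y n \<otimes> y (Suc n)) =
       (x (Suc n) \<otimes> y n) \<otimes> y (Suc n) \<ominus> (x (Suc (Suc n)) \<otimes> y (Suc n)) \<otimes> y n"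
      using y(1) coherentD(1)[OF x] by algebra
    also have "\<dots> = y (Suc n) \<ominus> y n" unfolding y(2) using y(1) by simp
    also have "(x (Suc n) \<ominus> x (Suc (Suc n))) \<otimes> (y n \<otimes> y (Suc n)) = (x (Suc (Suc n)) \<ominus> x (Suc n)) \<otimes> \<ominus> (y n \<otimes> y (Suc n))"
      using y(1) coherentD(1)[OF x] by algebra
    finally have eq: "y (Suc n) \<ominus> y n = (x (Suc (Suc n)) \<ominus> x (Suc n)) \<otimes> \<ominus> (y n \<otimes> y (Suc n))" ..
    have "p [^] n divides (x (Suc (Suc n)) \<ominus> x (Suc n))"
      using pow_divides_le[OF _ coherentD(2)[OF x], of n "Suc n"] by simp
    then show ?thesis unfolding eq using y(1) by (intro divides_mult_right) auto
  qed
  then have yc: "y \<in> carrier CS" using y(1) by (simp add: coherent_iff)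
  have "p [^] n divides (x n \<otimes> y n \<ominus> \<one>)" for n
  proof -
    have "x n \<otimes> y n \<ominus> x (Suc n) \<otimes> y n = (x (Suc n) \<ominus> x n) \<otimes> \<ominus> y n"
      using y(1) coherentD(1)[OF x] by algebra
    then have eq: "x n \<otimes> y n \<ominus> \<one> = (x (Suc n) \<ominus> x n) \<otimes> \<ominus> y n" unfolding y(2) .
    show ?thesis unfolding eq using y(1) coherentD(2)[OF x] by (intro divides_mult_right) auto
  qed
  then have "cls (\<lambda>n. x n \<otimes> y n) = cls (\<lambda>n. \<one>)"
    using cls_eq_iff[OF coherent_mult[OF x yc] coherent_const[OF one_closed]] by simp
  then have "cls x \<otimes>\<^bsub>Comp\<^esub> cls y = \<one>\<^bsub>Comp\<^esub>" using cls.hom_mult[OF x yc] cls.hom_one by simp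
  then have "cls x divides\<^bsub>Comp\<^esub> \<one>\<^bsub>Comp\<^esub>" using yc by (intro dividesI[of "cls y"]) auto
  then show ?thesis using Comp.divides_one x by simp
qed

lemma cls_zero_iff: "x \<in> carrier CS \<Longrightarrow> cls x = \<zero>\<^bsub>Comp\<^esub> \<longleftrightarrow> (\<forall>n. p [^] n divides x n)"
  using cls_eq_iff[of x "\<lambda>n. \<zero>"] coherentD(1)[of x] cls.hom_zero by (simp add: minus_eq)

text \<open>A class is a unit or a multiple of \<open>p\<close> according to its entry at 1. For
  regularity, \<open>p \<otimes> y (Suc n)\<close> being divisible by p^(n+1) gives that p^n divides
  \<open>y (Suc n)\<close> and so \<open>y n\<close>. For separatedness, divisibility by the n-th
  power already forces p^n to divide the n-th entry.\<close>

lemma uniformized_completion: "uniformized Comp (to_completion R p p)"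
  unfolding to_completion_def
proof (unfold_locales)
  let ?P = "cls (\<lambda>n. p)"
  have pc: "(\<lambda>n. p) \<in> carrier CS" by simp
  show Pc: "?P \<in> carrier Comp" using pc by simp
  have mult: "?P \<otimes>\<^bsub>Comp\<^esub> cls y = cls (\<lambda>n. p \<otimes> y n)" if "y \<in> carrier CS" for y
    using cls.hom_mult[OF pc that] by simp
  have mc: "(\<lambda>n. p \<otimes> y n) \<in> carrier CS" if "y \<in> carrier CS" for y by (rule coherent_mult[OF pc that])
  show "?P \<notin> Units Comp"
  proof
    assume "?P \<in> Units Comp"
    then have "?P divides\<^bsub>Comp\<^esub> \<one>\<^bsub>Comp\<^esub>" using Comp.divides_one[OF Pc] by simp
    then obtain v where v: "v \<in> carrier Comp" "\<one>\<^bsub>Comp\<^esub> = ?P \<otimes>\<^bsub>Comp\<^esub> v" unfolding factor_def by auto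
    obtain y where y: "y \<in> carrier CS" "v = cls y" using Comp_cases v(1) .
    have "cls (\<lambda>n. p \<otimes> y n) = cls (\<lambda>n. \<one>)" using v(2) mult[OF y(1)] y(2) cls.hom_one by simp
    then have "p [^] (1::nat) divides (p \<otimes> y 1 \<ominus> \<one>)"
      using cls_eq_iff[OF mc[OF y(1)] coherent_const[OF one_closed]] by blast
    then have "p divides (p \<otimes> y 1 \<ominus> \<one>)" by (simp only: nat_pow_eone[OF p_closed])
    note divides_minus[OF p_closed dividesI[OF coherentD(1)[OF y(1), of 1] refl] this]
    moreover have "p \<otimes> y 1 \<ominus> (p \<otimes> y 1 \<ominus> \<one>) = \<one>" using coherentD(1)[OF y(1)] p_closed by algebra
    ultimately show False using divides_one p_nonunit by simp
  qed
  show "v = \<zero>\<^bsub>Comp\<^esub>" if v: "v \<in> carrier Comp" "?P \<otimes>\<^bsub>Comp\<^esub> v = \<zero>\<^bsub>Comp\<^esub>" for v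
  proof -
    obtain y where y: "y \<in> carrier CS" "v = cls y" using Comp_cases v(1) .
    have *: "p [^] n divides p \<otimes> y n" for n using v(2) mult[OF y(1)] y(2) cls_zero_iff[OF mc[OF y(1)]] by simp
    have "p [^] n divides y n" for n
    proof -
      have "p [^] n divides y (Suc n)" using pow_Suc_cancel[OF coherentD(1)[OF y(1)] *] .
      note divides_minus[OF nat_pow_closed[OF p_closed] this coherentD(2)[OF y(1)]]
      moreover have "y (Suc n) \<ominus> (y (Suc n) \<ominus> y n) = y n" using coherentD(1)[OF y(1)] by algebra
      ultimately show ?thesis by simp
    qed
    then show ?thesis using cls_zero_iff y by simp
  qed
  show "?P divides\<^bsub>Comp\<^esub> v" if v: "v \<in> carrier Comp" "v \<notin> Units Comp" for v
  proof -
    obtain y where y: "y \<in> carrier CS" "v = cls y" using Comp_cases v(1) .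
    then show ?thesis using cls_unit[OF y(1)] cls_divisible[OF y(1)] v(2) by blast
  qed
  show "v = \<zero>\<^bsub>Comp\<^esub>" if v: "v \<in> carrier Comp" "\<And>n::nat. ?P [^]\<^bsub>Comp\<^esub> n divides\<^bsub>Comp\<^esub> v" for v
  proof -
    obtain x where x: "x \<in> carrier CS" "v = cls x" using Comp_cases v(1) .
    have cpow: "(\<lambda>n. p) [^]\<^bsub>CS\<^esub> k = (\<lambda>n. p [^] k)" for k :: nat
      by (induction k) (simp_all add: CS.nat_pow_Suc)
    have "p [^] n divides x n" for n
    proof -
      have "?P [^]\<^bsub>Comp\<^esub> n = cls (\<lambda>k. p [^] n)" using cls.hom_pow[OF pc, of n] cpow by simp
      then obtain w where w: "w \<in> carrier Comp" "v = cls (\<lambda>k. p [^] n) \<otimes>\<^bsub>Comp\<^esub> w"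
        using v(2)[of n] unfolding factor_def by auto
      obtain y where y: "y \<in> carrier CS" "w = cls y" using Comp_cases w(1) .
      have m: "(\<lambda>k. p [^] n \<otimes> y k) \<in> carrier CS" by (rule coherent_mult[OF coherent_const y(1)]) simp
      have "cls x = cls (\<lambda>k. p [^] n \<otimes> y k)"
        using w(2) x(2) y(2) cls.hom_mult[OF coherent_const y(1), of "p [^] n"] by simp
      then have "p [^] n divides (x n \<ominus> p [^] n \<otimes> y n)" using cls_eq_iff[OF x(1) m] by blast
      note divides_add[OF nat_pow_closed[OF p_closed] this dividesI[OF coherentD(1)[OF y(1), of n] refl]]
      moreover have "x n \<ominus> p [^] n \<otimes> y n \<oplus> p [^] n \<otimes> y n = x n"
        using coherentD(1)[OF x(1)] coherentD(1)[OF y(1)] nat_pow_closed[OF p_closed] by algebra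
      ultimately show ?thesis by simp
    qed
    then show ?thesis using cls_zero_iff x by simp
  qed
qed

lemma to_completion_hom: "to_completion R p \<in> ring_hom R Comp"
proof (rule ring_hom_memI)
  fix x y assume "x \<in> carrier R" "y \<in> carrier R"
  then show "to_completion R p (x \<otimes> y) = to_completion R p x \<otimes>\<^bsub>Comp\<^esub> to_completion R p y"
    "to_completion R p (x \<oplus> y) = to_completion R p x \<oplus>\<^bsub>Comp\<^esub> to_completion R p y"
    using cls.hom_mult[of "\<lambda>n. x" "\<lambda>n. y"] cls.hom_add[of "\<lambda>n. x" "\<lambda>n. y"]
    unfolding to_completion_def by simp_all
qed (use cls.hom_one in \<open>auto simp: to_completion_def\<close>)

end

section \<open>Adjoining a root of a quadratic polynomial\<close>

text \<open>For a subring \<open>A\<close> of a domain \<open>C\<close>, this is the intersection of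
  Frac(A) with \<open>C\<close> inside Frac(C), expressed by b x = a so that no field of fractions
  has to be built.\<close>

definition frac_closure :: "('a, 'm) ring_scheme \<Rightarrow> 'a set \<Rightarrow> 'a set" where
  "frac_closure C A = {x \<in> carrier C. \<exists>a\<in>A. \<exists>b\<in>A. b \<noteq> \<zero>\<^bsub>C\<^esub> \<and> b \<otimes>\<^bsub>C\<^esub> x = a}"

lemma (in domain) subring_frac_closure:
  assumes "subring A R"
  shows "subring (frac_closure R A) R"
proof -
  interpret A: subring A R by fact
  have Ac: "a \<in> A \<Longrightarrow> a \<in> carrier R" for a using A.subset by auto
  show ?thesis
  proof (rule subringI)
    show "frac_closure R A \<subseteq> carrier R" unfolding frac_closure_def by auto
    show "\<one> \<in> frac_closure R A"
    proof -
      have "\<one> \<otimes> \<one> = \<one>" by simp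
      then show ?thesis unfolding frac_closure_def using A.one_closed one_not_zero one_closed by blast
    qed
    show "\<ominus> h \<in> frac_closure R A" if "h \<in> frac_closure R A" for h
    proof -
      obtain a b where ab: "a \<in> A" "b \<in> A" "b \<noteq> \<zero>" "b \<otimes> h = a" and h: "h \<in> carrier R"
        using \<open>h \<in> _\<close> unfolding frac_closure_def by auto
      have "b \<otimes> \<ominus> h = \<ominus> a" using ab h Ac by (simp add: r_minus)
      then show ?thesis unfolding frac_closure_def using ab h subringE(5)[OF assms] by auto
    qed
    fix g h assume "g \<in> frac_closure R A" "h \<in> frac_closure R A"
    then obtain a b a' b' where ab: "a \<in> A" "b \<in> A" "b \<noteq> \<zero>" "b \<otimes> g = a" and g: "g \<in> carrier R"
      and ab': "a' \<in> A" "b' \<in> A" "b' \<noteq> \<zero>" "b' \<otimes> h = a'" and h: "h \<in> carrier R"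
      unfolding frac_closure_def by auto
    note cl = g h ab(1,2)[THEN Ac] ab'(1,2)[THEN Ac]
    have nz: "b \<otimes> b' \<noteq> \<zero>" "b \<otimes> b' \<in> A" using ab(2,3) ab'(2,3) integral_iff[OF Ac Ac] by auto
    have "(b \<otimes> b') \<otimes> (g \<otimes> h) = (b \<otimes> g) \<otimes> (b' \<otimes> h)" using cl by algebra
    then have "(b \<otimes> b') \<otimes> (g \<otimes> h) \<in> A" using ab ab' by simp
    then show "g \<otimes> h \<in> frac_closure R A" unfolding frac_closure_def using nz g h by blast
    have "(b \<otimes> b') \<otimes> (g \<oplus> h) = (b \<otimes> g) \<otimes> b' \<oplus> (b' \<otimes> h) \<otimes> b" using cl by algebra
    then have "(b \<otimes> b') \<otimes> (g \<oplus> h) \<in> A" using ab ab' subringE(7)[OF assms] by simp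
    then show "g \<oplus> h \<in> frac_closure R A" unfolding frac_closure_def using nz g h by blast
  qed
qed

lemma (in domain) subset_frac_closure:
  assumes "subring A R" shows "A \<subseteq> frac_closure R A"
proof
  fix a assume a: "a \<in> A"
  then have "a \<in> carrier R" "\<one> \<otimes> a = a" using subringE(1)[OF assms] by auto
  then show "a \<in> frac_closure R A"
    unfolding frac_closure_def using a subringE(3)[OF assms] one_not_zero by blast
qed

text \<open>If a quotient by \<open>p\<close>, or the inverse of a unit of \<open>R\<close>, is
  formed from elements of the closure and lies in \<open>R\<close>, it is again a fraction over
  \<open>A\<close>. So units and divisibility by \<open>p\<close> are the same in the closure as in
  \<open>R\<close>.\<close>

lemma (in uniformized) uniformized_frac_closure:
  assumes A: "subring A R" and pA: "p \<in> A"
  shows "uniformized (R\<lparr>carrier := frac_closure R A\<rparr>) p"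
proof -
  let ?T = "R\<lparr>carrier := frac_closure R A\<rparr>"
  interpret A: subring A R by fact
  have Ac: "a \<in> A \<Longrightarrow> a \<in> carrier R" for a using A.subset by auto
  have sub: "frac_closure R A \<subseteq> carrier R" unfolding frac_closure_def by auto
  interpret T: cring ?T
    using subcring_iff[OF sub] subcringI'[OF subring_frac_closure[OF A]] by blast
  have pT: "p \<in> frac_closure R A" using subset_frac_closure[OF A] pA by blast
  have div: "y \<in> frac_closure R A" if y: "y \<in> carrier R" "p \<otimes> y \<in> frac_closure R A" for y
  proof -
    obtain a b where ab: "a \<in> A" "b \<in> A" "b \<noteq> \<zero>" "b \<otimes> (p \<otimes> y) = a"
      using y(2) unfolding frac_closure_def by auto
    have "(b \<otimes> p) \<otimes> y = a" using ab Ac y by (simp add: m_assoc)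
    moreover have "b \<otimes> p \<in> A" "b \<otimes> p \<noteq> \<zero>" using ab pA integral[of b p] p_nonzero Ac by auto
    ultimately show ?thesis unfolding frac_closure_def using ab y by blast
  qed
  have unit: "x \<in> Units ?T" if x: "x \<in> frac_closure R A" "x \<in> Units R" for x
  proof -
    obtain a b where ab: "a \<in> A" "b \<in> A" "b \<noteq> \<zero>" "b \<otimes> x = a"
      using x(1) unfolding frac_closure_def by auto
    define y where "y = inv x"
    have y: "y \<in> carrier R" "x \<otimes> y = \<one>" and xc: "x \<in> carrier R" using x(2) unfolding y_def by auto
    have "a \<otimes> y = b \<otimes> (x \<otimes> y)" unfolding ab(4)[symmetric] using Ac ab(2) xc y(1) by (simp add: m_assoc)
    then have "a \<otimes> y = b" using y Ac ab by simp
    moreover have "a \<noteq> \<zero>" using ab(3) y(1) \<open>a \<otimes> y = b\<close> by auto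
    ultimately have "y \<in> frac_closure R A" unfolding frac_closure_def using ab y(1) by blast
    then have "x divides\<^bsub>?T\<^esub> \<one>\<^bsub>?T\<^esub>" using y(2) by (intro dividesI[of y]) auto
    then show ?thesis using T.divides_one[of x] x(1) by simp
  qed
  have dvd: "x divides y" if "x divides\<^bsub>?T\<^esub> y" for x y
    using that sub unfolding factor_def by auto
  show ?thesis
  proof (unfold_locales)
    show "p \<in> carrier ?T" using pT by simp
    show "p \<notin> Units ?T"
    proof
      assume "p \<in> Units ?T"
      then have "p divides \<one>" using T.divides_one[of p] pT dvd[of p \<one>] by simp
      then show False using divides_one p_nonunit by simp
    qed
    show "x = \<zero>\<^bsub>?T\<^esub>" if "x \<in> carrier ?T" "p \<otimes>\<^bsub>?T\<^esub> x = \<zero>\<^bsub>?T\<^esub>" for x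
      using that sub p_regular[of x] by auto
    show "p divides\<^bsub>?T\<^esub> x" if x: "x \<in> carrier ?T" "x \<notin> Units ?T" for x
    proof -
      have xc: "x \<in> frac_closure R A" "x \<in> carrier R" using x(1) sub by auto
      then have "p divides x" using nonunit_dvd unit x(2) by blast
      then obtain y where y: "y \<in> carrier R" "x = p \<otimes> y" unfolding factor_def by auto
      have "y \<in> frac_closure R A" using div[OF y(1)] xc(1) unfolding y(2) by blast
      then show ?thesis unfolding y(2) by (intro dividesI[of y]) simp_all
    qed
    show "x = \<zero>\<^bsub>?T\<^esub>" if x: "x \<in> carrier ?T" "\<And>n::nat. p [^]\<^bsub>?T\<^esub> n divides\<^bsub>?T\<^esub> x" for x
    proof -
      have "p [^] n divides x" for n :: nat
        using dvd[OF x(2)[of n]] nat_pow_consistent[of p n "frac_closure R A"] by simp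
      moreover have "x \<in> carrier R" using x(1) sub by auto
      ultimately show ?thesis using separated[of x] by simp
    qed
  qed
qed

section \<open>Roots when the values of the polynomial have unbounded valuation\<close>

context uniformized
begin

text \<open>Valuations add: two nonzero factors of valuation below n have a product of valuation at
  most 2n - 2.\<close>

lemma pow_double_divides_mult:
  assumes a: "a \<in> carrier R" and b: "b \<in> carrier R" and ab: "p [^] (n + n :: nat) divides a \<otimes> b"
  shows "p [^] n divides a \<or> p [^] n divides b"
proof (rule ccontr)
  assume neg: "\<not> ?thesis"
  then have "a \<noteq> \<zero>" "b \<noteq> \<zero>" using divides_zero[OF nat_pow_closed[OF p_closed]] by auto
  then obtain i j :: nat and u v where u: "u \<in> Units R" "a = p [^] i \<otimes> u" and v: "v \<in> Units R" "b = p [^] j \<otimes> v"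
    using unit_power_decomp a b by metis
  have cl: "u \<in> carrier R" "v \<in> carrier R" using u v by auto
  have "i < n"
    using neg u cl divides_mult_right(1)[OF _ pow_divides_pow[of n i], of u] by force
  moreover have "j < n"
    using neg v cl divides_mult_right(1)[OF _ pow_divides_pow[of n j], of v] by force
  ultimately have "p [^] Suc (i + j) divides a \<otimes> b" using pow_divides_le[OF _ ab, of "Suc (i + j)"] by simp
  moreover have "a \<otimes> b = p [^] (i + j) \<otimes> (u \<otimes> v)"
    unfolding u(2) v(2) nat_pow_mult[OF p_closed, symmetric] using cl by (simp add: m_ac)
  ultimately have "p [^] (i + j) \<otimes> p divides p [^] (i + j) \<otimes> (u \<otimes> v)" by simp
  then have "p divides u \<otimes> v"
    using mult_divides[of p "u \<otimes> v" "p [^] (i + j)"] p_pow_nonzero cl by simp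
  moreover have "u \<otimes> v \<in> Units R" using u v by simp
  ultimately show False using unit_iff cl by simp
qed

text \<open>The difference g(c) - g(x) factors as (c - x)(x - c') with c' = -\<beta> - c the
  conjugate of \<open>c\<close>. A better approximate root is therefore close to the previous one,
  or its conjugate is.\<close>

lemma coherent_root_seq:
  assumes \<beta>: "\<beta> \<in> carrier R" and \<gamma>: "\<gamma> \<in> carrier R"
    and roots: "\<And>n::nat. \<exists>c\<in>carrier R. p divides c \<and> p [^] n divides (c \<otimes> c \<oplus> \<beta> \<otimes> c \<oplus> \<gamma>)"
  shows "\<exists>x\<in>carrier CS. (\<forall>n. p divides x n) \<and>
    (\<forall>n. p [^] n divides (x n \<otimes> x n \<oplus> \<beta> \<otimes> x n \<oplus> \<gamma>))"
proof -
  define g where "g c = c \<otimes> c \<oplus> \<beta> \<otimes> c \<oplus> \<gamma>" for c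
  \<comment> \<open>The exponent is doubled because only one of the two factors is controlled: a
    product divisible by p^(2n) yields a congruence modulo p^n.\<close>
  define P where "P n x \<longleftrightarrow> x \<in> carrier R \<and> p divides x \<and> p [^] (n + n) divides g x" for n :: nat and x
  define D where "D n x y \<longleftrightarrow> p [^] n divides (y \<ominus> x)" for n :: nat and x y
  have "\<exists>f. \<forall>n. P n (f n) \<and> D n (f n) (f (Suc n))"
  proof (rule dependent_nat_choice)
    show "\<exists>x. P 0 x" using roots[of 0] unfolding P_def g_def by auto
    fix x and n :: nat assume x: "P n x"
    have xc: "x \<in> carrier R" using x unfolding P_def by simp
    obtain c where c: "c \<in> carrier R" "p divides c" "p [^] (Suc n + Suc n) divides g c"
      using roots[of "Suc n + Suc n"] unfolding g_def by auto
    have Pc: "P (Suc n) c" using c unfolding P_def by simp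
    have "p [^] (n + n) divides (g c \<ominus> g x)"
      using x pow_divides_le[OF _ c(3), of "n + n"] unfolding P_def by (intro divides_minus) auto
    moreover have "g c \<ominus> g x = (c \<ominus> x) \<otimes> (x \<oplus> (\<beta> \<oplus> c))"
      unfolding g_def using \<beta> \<gamma> xc c(1) by algebra
    ultimately have "p [^] n divides (c \<ominus> x) \<or> p [^] n divides (x \<oplus> (\<beta> \<oplus> c))"
      using pow_double_divides_mult[of "c \<ominus> x" "x \<oplus> (\<beta> \<oplus> c)" n] xc c(1) \<beta> by simp
    then show "\<exists>y. P (Suc n) y \<and> D n x y"
    proof
      assume "p [^] n divides (c \<ominus> x)"
      then show ?thesis using Pc unfolding D_def by blast
    next
      assume d: "p [^] n divides (x \<oplus> (\<beta> \<oplus> c))"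
      \<comment> \<open>For \<open>n = 0\<close> the congruence is empty and \<open>c\<close> itself
        serves. For positive \<open>n\<close> the conjugate is \<open>x\<close> minus a multiple of
        \<open>p\<close>, so it stays in the maximal ideal.\<close>
      show ?thesis
      proof (cases "n = 0")
        case True
        then have "D n x c" unfolding D_def using xc c by (simp add: one_divides)
        then show ?thesis using Pc by blast
      next
        case False
        \<comment> \<open>The conjugate \<open>-\<beta> - c\<close> has the same value under the polynomial.\<close>
        define y where "y = \<ominus> (\<beta> \<oplus> c)"
        have yc: "y \<in> carrier R" unfolding y_def using \<beta> c by simp
        have pd: "p divides (x \<oplus> (\<beta> \<oplus> c))" using pow_divides_le[OF _ d, of 1] False by simp
        have "y \<ominus> x = (x \<oplus> (\<beta> \<oplus> c)) \<otimes> \<ominus> \<one>" "y = x \<ominus> (x \<oplus> (\<beta> \<oplus> c))"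
          unfolding y_def using \<beta> c(1) xc by algebra+
        then have "p [^] n divides (y \<ominus> x)" "p divides y"
          using d divides_mult_right(1)[OF _ d, of "\<ominus> \<one>"] divides_minus[OF p_closed _ pd, of x] x unfolding P_def by auto
        moreover have "g y = g c" unfolding g_def y_def using \<beta> \<gamma> c(1) by algebra
        ultimately have "P (Suc n) y \<and> D n x y" unfolding P_def D_def using yc c(3) by simp
        then show ?thesis by blast
      qed
    qed
  qed
  then obtain f where f: "\<And>n. P n (f n)" "\<And>n. D n (f n) (f (Suc n))" by blast
  show ?thesis
  proof (intro bexI[of _ f] conjI allI)
    show "f \<in> carrier CS" using f unfolding coherent_iff P_def D_def by blast
    show "p divides f n" for n using f(1) unfolding P_def by blast
    show "p [^] n divides (f n \<otimes> f n \<oplus> \<beta> \<otimes> f n \<oplus> \<gamma>)" for n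
      using f(1)[of n] pow_divides_le[of n "n + n"] unfolding P_def g_def by simp
  qed
qed

text \<open>The approximate roots define a root \<open>z\<close> in the completion. The ring that is
  kept consists of the fractions over R[z] inside the completion; each of its elements is determined
  by four elements of \<open>R\<close>.\<close>

lemma root_extension_unbounded:
  assumes \<beta>: "\<beta> \<in> carrier R" and \<gamma>: "\<gamma> \<in> carrier R"
    and roots: "\<And>n::nat. \<exists>c\<in>carrier R. p divides c \<and> p [^] n divides (c \<otimes> c \<oplus> \<beta> \<otimes> c \<oplus> \<gamma>)"
  shows "\<exists>(T :: 'a ring) k r w. dvr_extension R T k \<and> uniformizer T r \<and> w \<in> PIdl\<^bsub>T\<^esub> r \<and>
    w \<otimes>\<^bsub>T\<^esub> w \<oplus>\<^bsub>T\<^esub> k \<beta> \<otimes>\<^bsub>T\<^esub> w \<oplus>\<^bsub>T\<^esub> k \<gamma> = \<zero>\<^bsub>T\<^esub>"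
proof -
  obtain x where x: "x \<in> carrier CS" "\<And>n. p divides x n"
    "\<And>n. p [^] n divides (x n \<otimes> x n \<oplus> \<beta> \<otimes> x n \<oplus> \<gamma>)"
    using coherent_root_seq[OF assms] by blast
  let ?C = Comp
  define i where "i = to_completion R p"
  interpret C: uniformized ?C "i p" unfolding i_def by (rule uniformized_completion)
  interpret i: ring_hom_cring R ?C i by unfold_locales (use to_completion_hom in \<open>simp add: i_def\<close>)
  define z where "z = cls x"
  have z: "z \<in> carrier ?C" "i p divides\<^bsub>?C\<^esub> z"
    unfolding z_def i_def to_completion_def using x(1) cls_divisible[OF x(1) x(2)] by auto
  have root: "z \<otimes>\<^bsub>?C\<^esub> z \<oplus>\<^bsub>?C\<^esub> i \<beta> \<otimes>\<^bsub>?C\<^esub> z \<oplus>\<^bsub>?C\<^esub> i \<gamma> = \<zero>\<^bsub>?C\<^esub>"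
  proof -
    have cx: "(\<lambda>n. x n \<otimes> x n) \<in> carrier CS" "(\<lambda>n. \<beta> \<otimes> x n) \<in> carrier CS"
      using coherent_mult[OF x(1) x(1)] coherent_mult[OF coherent_const[OF \<beta>] x(1)] by auto
    note c2 = coherent_add[OF cx] and c3 = coherent_add[OF coherent_add[OF cx] coherent_const[OF \<gamma>]]
    have "z \<otimes>\<^bsub>?C\<^esub> z \<oplus>\<^bsub>?C\<^esub> i \<beta> \<otimes>\<^bsub>?C\<^esub> z \<oplus>\<^bsub>?C\<^esub> i \<gamma> = cls (\<lambda>n. x n \<otimes> x n \<oplus> \<beta> \<otimes> x n \<oplus> \<gamma>)"
      using cls.hom_mult[OF x(1) x(1)] cls.hom_mult[OF coherent_const[OF \<beta>] x(1)]
        cls.hom_add[OF cx] cls.hom_add[OF c2 coherent_const[OF \<gamma>]]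
      unfolding z_def i_def to_completion_def by simp
    then show ?thesis using cls_zero_iff[OF c3] x(3) by simp
  qed
  \<comment> \<open>The ring R[z]: as \<open>z\<close> satisfies a monic quadratic equation,
    expressions linear in \<open>z\<close> are closed under multiplication.\<close>
  define A where "A = {i a \<oplus>\<^bsub>?C\<^esub> i b \<otimes>\<^bsub>?C\<^esub> z | a b. a \<in> carrier R \<and> b \<in> carrier R}"
  have AI: "i a \<oplus>\<^bsub>?C\<^esub> i b \<otimes>\<^bsub>?C\<^esub> z \<in> A" if "a \<in> carrier R" "b \<in> carrier R" for a b
    using that unfolding A_def by blast
  have iA: "i a \<in> A" if "a \<in> carrier R" for a using AI[OF that zero_closed] that z(1) by simp
  have subA: "subring A ?C"
  proof (rule Comp.subringI)
    show "A \<subseteq> carrier ?C" unfolding A_def using z by auto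
    show "\<one>\<^bsub>?C\<^esub> \<in> A" using iA[of \<one>] by simp
    show "\<ominus>\<^bsub>?C\<^esub> v \<in> A" if v: "v \<in> A" for v
    proof -
      obtain a b where ab: "a \<in> carrier R" "b \<in> carrier R" "v = i a \<oplus>\<^bsub>?C\<^esub> i b \<otimes>\<^bsub>?C\<^esub> z" using v unfolding A_def by auto
      have "\<ominus>\<^bsub>?C\<^esub> v = i (\<ominus> a) \<oplus>\<^bsub>?C\<^esub> i (\<ominus> b) \<otimes>\<^bsub>?C\<^esub> z"
        using ab z by (simp add: Comp.minus_add Comp.l_minus)
      then show ?thesis using AI[OF a_inv_closed[OF ab(1)] a_inv_closed[OF ab(2)]] by (simp only:)
    qed
    fix v w assume "v \<in> A" "w \<in> A"
    then obtain a b a' b' where ab: "a \<in> carrier R" "b \<in> carrier R" "v = i a \<oplus>\<^bsub>?C\<^esub> i b \<otimes>\<^bsub>?C\<^esub> z"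
      and ab': "a' \<in> carrier R" "b' \<in> carrier R" "w = i a' \<oplus>\<^bsub>?C\<^esub> i b' \<otimes>\<^bsub>?C\<^esub> z" unfolding A_def by auto
    have ic: "i a \<in> carrier ?C" "i b \<in> carrier ?C" "i a' \<in> carrier ?C" "i b' \<in> carrier ?C"
      "i \<beta> \<in> carrier ?C" "i \<gamma> \<in> carrier ?C" using ab ab' \<beta> \<gamma> by auto
    have "v \<oplus>\<^bsub>?C\<^esub> w = (i a \<oplus>\<^bsub>?C\<^esub> i a') \<oplus>\<^bsub>?C\<^esub> (i b \<oplus>\<^bsub>?C\<^esub> i b') \<otimes>\<^bsub>?C\<^esub> z"
      unfolding ab(3) ab'(3) using ic z(1) by (simp add: Comp.l_distr Comp.a_ac)
    then show "v \<oplus>\<^bsub>?C\<^esub> w \<in> A" using AI[of "a \<oplus> a'" "b \<oplus> b'"] ab(1,2) ab'(1,2) by simp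
    define zz where "zz = z \<otimes>\<^bsub>?C\<^esub> z"
    have zz: "zz = \<ominus>\<^bsub>?C\<^esub> (i \<beta> \<otimes>\<^bsub>?C\<^esub> z \<oplus>\<^bsub>?C\<^esub> i \<gamma>)"
      using root ic z(1) unfolding zz_def by (intro Comp.minus_equality[symmetric]) (simp_all add: Comp.a_assoc)
    have "v \<otimes>\<^bsub>?C\<^esub> w = i a \<otimes>\<^bsub>?C\<^esub> i a' \<oplus>\<^bsub>?C\<^esub> (i a \<otimes>\<^bsub>?C\<^esub> i b' \<oplus>\<^bsub>?C\<^esub> i b \<otimes>\<^bsub>?C\<^esub> i a') \<otimes>\<^bsub>?C\<^esub> z \<oplus>\<^bsub>?C\<^esub> i b \<otimes>\<^bsub>?C\<^esub> i b' \<otimes>\<^bsub>?C\<^esub> zz"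
      unfolding ab(3) ab'(3) zz_def using ic z(1) by (simp add: Comp.l_distr Comp.r_distr Comp.a_ac Comp.m_ac)
    also have "\<dots> = (i a \<otimes>\<^bsub>?C\<^esub> i a' \<ominus>\<^bsub>?C\<^esub> i b \<otimes>\<^bsub>?C\<^esub> i b' \<otimes>\<^bsub>?C\<^esub> i \<gamma>)
        \<oplus>\<^bsub>?C\<^esub> (i a \<otimes>\<^bsub>?C\<^esub> i b' \<oplus>\<^bsub>?C\<^esub> i b \<otimes>\<^bsub>?C\<^esub> i a' \<ominus>\<^bsub>?C\<^esub> i b \<otimes>\<^bsub>?C\<^esub> i b' \<otimes>\<^bsub>?C\<^esub> i \<beta>) \<otimes>\<^bsub>?C\<^esub> z"
      unfolding zz using ic z(1)
      by (simp add: Comp.l_distr Comp.r_distr Comp.minus_eq Comp.minus_add Comp.r_minus Comp.l_minus Comp.a_ac Comp.m_ac)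
    finally have "v \<otimes>\<^bsub>?C\<^esub> w = i (a \<otimes> a' \<ominus> b \<otimes> b' \<otimes> \<gamma>) \<oplus>\<^bsub>?C\<^esub> i (a \<otimes> b' \<oplus> b \<otimes> a' \<ominus> b \<otimes> b' \<otimes> \<beta>) \<otimes>\<^bsub>?C\<^esub> z"
      using ab(1,2) ab'(1,2) \<beta> \<gamma> by (simp add: minus_eq Comp.minus_eq)
    moreover have "a \<otimes> a' \<ominus> b \<otimes> b' \<otimes> \<gamma> \<in> carrier R" "a \<otimes> b' \<oplus> b \<otimes> a' \<ominus> b \<otimes> b' \<otimes> \<beta> \<in> carrier R"
      using ab(1,2) ab'(1,2) \<beta> \<gamma> by simp_all
    ultimately show "v \<otimes>\<^bsub>?C\<^esub> w \<in> A" using AI by (simp only:)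
  qed
  define S where "S = frac_closure ?C A"
  let ?S = "?C\<lparr>carrier := S\<rparr>"
  have pA: "i p \<in> A" by (rule iA) simp
  interpret S: uniformized ?S "i p" unfolding S_def by (rule C.uniformized_frac_closure[OF subA pA])
  have AS: "A \<subseteq> S" unfolding S_def by (rule C.subset_frac_closure[OF subA])
  have zA: "z \<in> A" using AI[OF zero_closed one_closed] z(1) by simp
  have hom: "i \<in> ring_hom R ?S"
    by (rule ring_hom_memI) (use iA AS in auto)
  \<comment> \<open>The quadruple \<open>((a, b), (c, d))\<close> records \<open>s\<close> as a
    fraction with numerator i a + i b z and denominator i c + i d z. Choosing one for each
    \<open>s\<close> is injective, as nonzero denominators cancel in the completion.\<close>
  define P where "P s t \<longleftrightarrow> t \<in> (carrier R \<times> carrier R) \<times> (carrier R \<times> carrier R) \<and>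
      (case t of ((a, b), (c, d)) \<Rightarrow> i c \<oplus>\<^bsub>?C\<^esub> i d \<otimes>\<^bsub>?C\<^esub> z \<noteq> \<zero>\<^bsub>?C\<^esub> \<and>
        (i c \<oplus>\<^bsub>?C\<^esub> i d \<otimes>\<^bsub>?C\<^esub> z) \<otimes>\<^bsub>?C\<^esub> s = i a \<oplus>\<^bsub>?C\<^esub> i b \<otimes>\<^bsub>?C\<^esub> z)" for s t
  have "\<forall>s\<in>S. \<exists>t. P s t"
  proof
    fix s assume s: "s \<in> S"
    obtain a b c d where "a \<in> carrier R" "b \<in> carrier R" "c \<in> carrier R" "d \<in> carrier R"
      "i c \<oplus>\<^bsub>?C\<^esub> i d \<otimes>\<^bsub>?C\<^esub> z \<noteq> \<zero>\<^bsub>?C\<^esub>"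
      "(i c \<oplus>\<^bsub>?C\<^esub> i d \<otimes>\<^bsub>?C\<^esub> z) \<otimes>\<^bsub>?C\<^esub> s = i a \<oplus>\<^bsub>?C\<^esub> i b \<otimes>\<^bsub>?C\<^esub> z"
      using s unfolding S_def frac_closure_def A_def by blast
    then show "\<exists>t. P s t" unfolding P_def by (intro exI[of _ "((a, b), (c, d))"]) auto
  qed
  then have "\<exists>j. \<forall>s\<in>S. P s (j s)" by (rule bchoice)
  then obtain j where jP: "\<forall>s\<in>S. P s (j s)" ..
  note j = jP[rule_format, unfolded P_def, THEN conjunct1] jP[rule_format, unfolded P_def, THEN conjunct2]
  have SC: "S \<subseteq> carrier ?C" unfolding S_def frac_closure_def by auto
  have injj: "inj_on j S"
  proof (rule inj_onI)
    fix s s' assume s: "s \<in> S" "s' \<in> S" "j s = j s'"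
    obtain a b c d where e: "j s = ((a, b), (c, d))" by (metis surj_pair)
    have cd: "c \<in> carrier R" "d \<in> carrier R" using j(1)[OF s(1)] e by auto
    have nz: "i c \<oplus>\<^bsub>?C\<^esub> i d \<otimes>\<^bsub>?C\<^esub> z \<noteq> \<zero>\<^bsub>?C\<^esub>"
      and eq: "(i c \<oplus>\<^bsub>?C\<^esub> i d \<otimes>\<^bsub>?C\<^esub> z) \<otimes>\<^bsub>?C\<^esub> s = (i c \<oplus>\<^bsub>?C\<^esub> i d \<otimes>\<^bsub>?C\<^esub> z) \<otimes>\<^bsub>?C\<^esub> s'"
      using j(2)[OF s(1)] j(2)[OF s(2)] e s(3) by auto
    then show "s = s'" using C.m_lcancel[OF nz, of s s'] cd z(1) s SC by auto
  qed
  have dz: "i p divides\<^bsub>?S\<^esub> z"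
  proof -
    obtain y where y: "y \<in> carrier ?C" "z = i p \<otimes>\<^bsub>?C\<^esub> y" using z(2) unfolding factor_def by auto
    \<comment> \<open>The quotient of \<open>z\<close> by \<open>i p\<close> is itself a fraction of
      elements of \<open>A\<close>, so divisibility in the completion descends to
      \<open>S\<close>.\<close>
    have "y \<in> S" unfolding S_def frac_closure_def using y pA zA C.p_nonzero by auto
    then show ?thesis using y by (intro dividesI[of y]) auto
  qed
  show ?thesis
  proof (rule root_extension_transfer[OF uniformized_axioms S.uniformized_axioms hom _ _ _ _ \<beta> \<gamma>])
    show "i p divides\<^bsub>?S\<^esub> i p" by (rule S.divides_refl[OF S.p_closed])
    show "i p \<noteq> \<zero>\<^bsub>?S\<^esub>" using C.p_nonzero by simp
    show "inj_on j (carrier ?S)" using injj by simp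
    show "j ` carrier ?S \<subseteq> (carrier R \<times> carrier R) \<times> (carrier R \<times> carrier R)"
      using j(1) by (simp add: image_subset_iff)
    show "z \<in> carrier ?S" using zA AS by auto
    show "i p divides\<^bsub>?S\<^esub> z" by (rule dz)
    show "z \<otimes>\<^bsub>?S\<^esub> z \<oplus>\<^bsub>?S\<^esub> i \<beta> \<otimes>\<^bsub>?S\<^esub> z \<oplus>\<^bsub>?S\<^esub> i \<gamma> = \<zero>\<^bsub>?S\<^esub>" using root by simp
  qed
qed

lemma root_extension:
  assumes \<beta>: "\<beta> \<in> carrier R" and \<gamma>: "\<gamma> \<in> carrier R" "p divides \<gamma>"
  shows "\<exists>(T :: 'a ring) k r w. dvr_extension R T k \<and> uniformizer T r \<and> w \<in> PIdl\<^bsub>T\<^esub> r \<and>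
    w \<otimes>\<^bsub>T\<^esub> w \<oplus>\<^bsub>T\<^esub> k \<beta> \<otimes>\<^bsub>T\<^esub> w \<oplus>\<^bsub>T\<^esub> k \<gamma> = \<zero>\<^bsub>T\<^esub>"
proof -
  define A where "A n \<longleftrightarrow> (\<exists>c\<in>carrier R. p divides c \<and> p [^] n divides (c \<otimes> c \<oplus> \<beta> \<otimes> c \<oplus> \<gamma>))" for n :: nat
  show ?thesis
  proof (cases "\<forall>n. A n")
    case True
    then show ?thesis using root_extension_unbounded[OF \<beta> \<gamma>(1)] unfolding A_def by blast
  next
    case False
    have "A 0" unfolding A_def using \<beta> \<gamma> divides_zero by (intro bexI[of _ \<zero>]) (auto simp: one_divides)
    \<comment> \<open>The last exponent that is attained before the first failure is the maximal
      valuation of the bounded case.\<close>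
    then obtain m where "A m" "\<not> A (Suc m)" using False by (metis nat_induct)
    then show ?thesis using root_extension_bounded[OF \<beta> \<gamma>] unfolding A_def by metis
  qed
qed

end

section \<open>Cyclic cokernels and quadratic maps\<close>

text \<open>The action on a coset is a union over its representatives. They all yield the same coset
  because \<open>N\<close> is closed under scalars.\<close>

lemma (in module) quotient_module_smult:
  assumes N: "submodule N R M" and a: "a \<in> carrier R" and x: "x \<in> carrier M"
  shows "a \<odot>\<^bsub>quotient_module M N\<^esub> (N +>\<^bsub>M\<^esub> x) = N +>\<^bsub>M\<^esub> (a \<odot>\<^bsub>M\<^esub> x)"
proof -
  have sub: "N \<subseteq> carrier M" and Nsm: "\<And>n. n \<in> N \<Longrightarrow> a \<odot>\<^bsub>M\<^esub> n \<in> N"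
    using submoduleE(1,4)[OF N] a by auto
  have sg: "subgroup N (add_monoid M)" using submodule.axioms(1)[OF N] .
  have z: "\<zero>\<^bsub>M\<^esub> \<in> N" using subgroup.one_closed[OF sg] by simp
  have eq: "N +>\<^bsub>M\<^esub> (a \<odot>\<^bsub>M\<^esub> y) = N +>\<^bsub>M\<^esub> (a \<odot>\<^bsub>M\<^esub> x)" if y: "y \<in> N +>\<^bsub>M\<^esub> x" for y
  proof -
    obtain n where n: "n \<in> N" "y = n \<oplus>\<^bsub>M\<^esub> x" using y unfolding a_r_coset_def' by auto
    have nc: "n \<in> carrier M" "a \<odot>\<^bsub>M\<^esub> n \<in> carrier M" "a \<odot>\<^bsub>M\<^esub> x \<in> carrier M" using n sub a x by auto
    have "a \<odot>\<^bsub>M\<^esub> y = a \<odot>\<^bsub>M\<^esub> n \<oplus>\<^bsub>M\<^esub> a \<odot>\<^bsub>M\<^esub> x" unfolding n(2) using a x nc(1) by (simp add: smult_r_distr)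
    then have "N +>\<^bsub>M\<^esub> (a \<odot>\<^bsub>M\<^esub> y) = (N +>\<^bsub>M\<^esub> (a \<odot>\<^bsub>M\<^esub> n)) +>\<^bsub>M\<^esub> (a \<odot>\<^bsub>M\<^esub> x)"
      using M.a_coset_add_assoc[OF sub nc(2,3)] by simp
    also have "N +>\<^bsub>M\<^esub> (a \<odot>\<^bsub>M\<^esub> n) = N" using M.a_coset_join2[OF nc(2) sg Nsm[OF n(1)]] .
    finally show ?thesis .
  qed
  have "x \<in> N +>\<^bsub>M\<^esub> x" using z x unfolding a_r_coset_def' by force
  then have "(\<Union>y\<in>N +>\<^bsub>M\<^esub> x. N +>\<^bsub>M\<^esub> (a \<odot>\<^bsub>M\<^esub> y)) = N +>\<^bsub>M\<^esub> (a \<odot>\<^bsub>M\<^esub> x)"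
    using eq by blast
  then show ?thesis by (simp add: quotient_module_def)
qed

text \<open>The generator \<open>g\<close> is pulled back to a coset of \<open>N\<close>, and
  \<open>e\<close> is a representative of it. Injectivity of the isomorphism turns an equality of
  images into an equality of cosets.\<close>

lemma (in module) quotient_module_cyclicD:
  assumes N: "submodule N R M"
    and iso: "module_isomorphic R (quotient_module M N) P"
    and g: "g \<in> carrier P" and gen: "\<And>u. u \<in> carrier P \<Longrightarrow> \<exists>a\<in>carrier R. u = a \<odot>\<^bsub>P\<^esub> g"
  shows "\<exists>e\<in>carrier M. \<forall>v\<in>carrier M. \<exists>a\<in>carrier R. \<exists>n\<in>N. v = n \<oplus>\<^bsub>M\<^esub> a \<odot>\<^bsub>M\<^esub> e"
proof -
  have sub: "N \<subseteq> carrier M" using submoduleE(1)[OF N] .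
  have z: "\<zero>\<^bsub>M\<^esub> \<in> N" using subgroup.one_closed[OF submodule.axioms(1)[OF N]] by simp
  have carr: "carrier (quotient_module M N) = {N +>\<^bsub>M\<^esub> x | x. x \<in> carrier M}"
    unfolding quotient_module_def A_RCOSETS_def' by auto
  obtain h where bij: "bij_betw h (carrier (quotient_module M N)) (carrier P)"
    and hs: "\<And>a x. a \<in> carrier R \<Longrightarrow> x \<in> carrier (quotient_module M N) \<Longrightarrow> h (a \<odot>\<^bsub>quotient_module M N\<^esub> x) = a \<odot>\<^bsub>P\<^esub> h x"
    using iso unfolding module_isomorphic_def by blast
  have "g \<in> h ` carrier (quotient_module M N)" using bij_betw_imp_surj_on[OF bij] g by simp
  then obtain E where "E \<in> carrier (quotient_module M N)" "g = h E" by (elim imageE)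
  then obtain e where e: "e \<in> carrier M" "h (N +>\<^bsub>M\<^esub> e) = g" unfolding carr by blast
  have Ec: "N +>\<^bsub>M\<^esub> e \<in> carrier (quotient_module M N)" unfolding carr using e(1) by blast
  show ?thesis
  proof (intro bexI[of _ e] ballI)
    fix v assume v: "v \<in> carrier M"
    then have "h (N +>\<^bsub>M\<^esub> v) \<in> carrier P" using bij_betwE[OF bij] carr by blast
    then obtain a where a: "a \<in> carrier R" "h (N +>\<^bsub>M\<^esub> v) = a \<odot>\<^bsub>P\<^esub> g" using gen by blast
    have ae: "a \<odot>\<^bsub>M\<^esub> e \<in> carrier M" using a e by simp
    have "h (N +>\<^bsub>M\<^esub> v) = h (a \<odot>\<^bsub>quotient_module M N\<^esub> (N +>\<^bsub>M\<^esub> e))"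
      using hs[OF a(1) Ec] a(2) e(2) by simp
    also have "\<dots> = h (N +>\<^bsub>M\<^esub> (a \<odot>\<^bsub>M\<^esub> e))" using quotient_module_smult[OF N a(1) e(1)] by simp
    finally have "N +>\<^bsub>M\<^esub> v = N +>\<^bsub>M\<^esub> (a \<odot>\<^bsub>M\<^esub> e)"
      using inj_onD[OF bij_betw_imp_inj_on[OF bij]] v ae unfolding carr by blast
    moreover have "v \<in> N +>\<^bsub>M\<^esub> v" using z v unfolding a_r_coset_def' by force
    ultimately have "v \<in> N +>\<^bsub>M\<^esub> (a \<odot>\<^bsub>M\<^esub> e)" by simp
    then show "\<exists>a\<in>carrier R. \<exists>n\<in>N. v = n \<oplus>\<^bsub>M\<^esub> a \<odot>\<^bsub>M\<^esub> e"
      using a(1) unfolding a_r_coset_def' by auto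
  qed (rule e(1))
qed

lemma (in cring) module_regular: "module R (regular_module R)"
proof (rule moduleI[OF is_cring])
  show "abelian_group (regular_module R)"
  proof (rule abelian_groupI)
    show "\<exists>y\<in>carrier (regular_module R). y \<oplus>\<^bsub>regular_module R\<^esub> x = \<zero>\<^bsub>regular_module R\<^esub>"
      if "x \<in> carrier (regular_module R)" for x
      using that by (intro bexI[of _ "\<ominus> x"]) (auto simp: regular_module_def l_neg)
  qed (auto simp: regular_module_def a_ac)
qed (auto simp: regular_module_def l_distr r_distr m_assoc)

lemma (in module) submoduleI2:
  assumes sub: "H \<subseteq> carrier M" and ne: "H \<noteq> {}"
    and add: "\<And>x y. x \<in> H \<Longrightarrow> y \<in> H \<Longrightarrow> x \<oplus>\<^bsub>M\<^esub> y \<in> H"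
    and smult: "\<And>a x. a \<in> carrier R \<Longrightarrow> x \<in> H \<Longrightarrow> a \<odot>\<^bsub>M\<^esub> x \<in> H"
  shows "submodule H R M"
proof -
  obtain x where x: "x \<in> H" using ne by blast
  then have "\<zero> \<odot>\<^bsub>M\<^esub> x = \<zero>\<^bsub>M\<^esub>" using sub by (intro smult_l_null) auto
  then have zero: "\<zero>\<^bsub>M\<^esub> \<in> H" using smult[OF R.zero_closed x] by simp
  have "\<ominus>\<^bsub>M\<^esub> u \<in> H" if u: "u \<in> H" for u
  proof -
    have "u \<in> carrier M" using u sub by blast
    then have "(\<ominus> \<one>) \<odot>\<^bsub>M\<^esub> u = \<ominus>\<^bsub>M\<^esub> u" by (simp add: smult_l_minus)
    then show ?thesis using smult[of "\<ominus> \<one>" u] u by simp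
  qed
  then show ?thesis by (intro submoduleI sub zero add smult)
qed

lemma (in cring) submodule_PIdl:
  assumes "a \<in> carrier R" shows "submodule (PIdl a) R (regular_module R)"
proof -
  interpret P: module R "regular_module R" by (rule module_regular)
  interpret I: ideal "PIdl a" R by (rule cgenideal_ideal[OF assms])
  show ?thesis
  proof (rule P.submoduleI2)
    show "PIdl a \<noteq> {}" using cgenideal_self[OF assms] by blast
  qed (use I.a_subset I.I_l_closed I.a_closed in \<open>auto simp: regular_module_def\<close>)
qed

section \<open>Free modules, dot products and matrix maps\<close>

lemma free_module_simps:
  "carrier (free_module R n) = {..<n} \<rightarrow>\<^sub>E carrier R"
  "\<zero>\<^bsub>free_module R n\<^esub> = (\<lambda>k\<in>{..<n}. \<zero>\<^bsub>R\<^esub>)"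
  "v \<oplus>\<^bsub>free_module R n\<^esub> w = (\<lambda>k\<in>{..<n}. v k \<oplus>\<^bsub>R\<^esub> w k)"
  "a \<odot>\<^bsub>free_module R n\<^esub> v = (\<lambda>k\<in>{..<n}. a \<otimes>\<^bsub>R\<^esub> v k)"
  by (simp_all add: free_module_def)

lemma free_module_eqI:
  assumes "v \<in> carrier (free_module R n)" "w \<in> carrier (free_module R n)" "\<And>k. k < n \<Longrightarrow> v k = w k"
  shows "v = w"
  using assms unfolding free_module_simps by (intro PiE_ext) auto

lemma (in cring) module_free: "module R (free_module R n)"
proof -
  note simps = free_module_simps(2-4)
  have closed: "(\<lambda>k\<in>{..<n}. g k) \<in> carrier (free_module R n)" if "\<And>k. k < n \<Longrightarrow> g k \<in> carrier R" for g
    using that unfolding free_module_simps by (intro restrict_PiE_iff[THEN iffD2]) auto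
  have mem: "x k \<in> carrier R" if "x \<in> carrier (free_module R n)" "k < n" for x k
    using that PiE_mem[of x "{..<n}" "\<lambda>_. carrier R" k] by (simp add: free_module_simps(1))
  have arb: "x k = undefined" if "x \<in> carrier (free_module R n)" "\<not> k < n" for x k
    using that PiE_arb[of x "{..<n}" "\<lambda>_. carrier R" k] by (simp add: free_module_simps(1))
  show ?thesis
  proof (rule moduleI[OF is_cring])
    show "abelian_group (free_module R n)"
    proof (rule abelian_groupI)
      fix x assume x: "x \<in> carrier (free_module R n)"
      show "\<exists>y\<in>carrier (free_module R n). y \<oplus>\<^bsub>free_module R n\<^esub> x = \<zero>\<^bsub>free_module R n\<^esub>"
      proof (rule bexI)
        show "(\<lambda>k\<in>{..<n}. \<ominus> x k) \<in> carrier (free_module R n)" using mem[OF x] by (intro closed) simp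
        show "(\<lambda>k\<in>{..<n}. \<ominus> x k) \<oplus>\<^bsub>free_module R n\<^esub> x = \<zero>\<^bsub>free_module R n\<^esub>"
          by (rule ext) (simp add: simps mem[OF x] l_neg)
      qed
      show "\<zero>\<^bsub>free_module R n\<^esub> \<oplus>\<^bsub>free_module R n\<^esub> x = x"
        by (rule ext) (simp add: simps mem[OF x] arb[OF x])
      fix y assume y: "y \<in> carrier (free_module R n)"
      show "x \<oplus>\<^bsub>free_module R n\<^esub> y \<in> carrier (free_module R n)"
        unfolding simps using mem[OF x] mem[OF y] by (intro closed) simp
      show "x \<oplus>\<^bsub>free_module R n\<^esub> y = y \<oplus>\<^bsub>free_module R n\<^esub> x"
        by (rule ext) (simp add: simps mem[OF x] mem[OF y] a_comm)
      fix z assume z: "z \<in> carrier (free_module R n)"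
      show "x \<oplus>\<^bsub>free_module R n\<^esub> y \<oplus>\<^bsub>free_module R n\<^esub> z = x \<oplus>\<^bsub>free_module R n\<^esub> (y \<oplus>\<^bsub>free_module R n\<^esub> z)"
        by (rule ext) (simp add: simps mem[OF x] mem[OF y] mem[OF z] a_assoc)
    qed (unfold simps, intro closed, simp)
  next
    fix a x assume a: "a \<in> carrier R" and x: "x \<in> carrier (free_module R n)"
    show "a \<odot>\<^bsub>free_module R n\<^esub> x \<in> carrier (free_module R n)"
      unfolding simps using a mem[OF x] by (intro closed) simp
    fix b assume b: "b \<in> carrier R"
    show "(a \<oplus> b) \<odot>\<^bsub>free_module R n\<^esub> x = a \<odot>\<^bsub>free_module R n\<^esub> x \<oplus>\<^bsub>free_module R n\<^esub> b \<odot>\<^bsub>free_module R n\<^esub> x"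
      by (rule ext) (simp add: simps a b mem[OF x] l_distr)
    show "(a \<otimes> b) \<odot>\<^bsub>free_module R n\<^esub> x = a \<odot>\<^bsub>free_module R n\<^esub> (b \<odot>\<^bsub>free_module R n\<^esub> x)"
      by (rule ext) (simp add: simps a b mem[OF x] m_assoc)
  next
    fix a x y assume a: "a \<in> carrier R" and x: "x \<in> carrier (free_module R n)" and y: "y \<in> carrier (free_module R n)"
    show "a \<odot>\<^bsub>free_module R n\<^esub> (x \<oplus>\<^bsub>free_module R n\<^esub> y) = a \<odot>\<^bsub>free_module R n\<^esub> x \<oplus>\<^bsub>free_module R n\<^esub> a \<odot>\<^bsub>free_module R n\<^esub> y"
      by (rule ext) (simp add: simps a mem[OF x] mem[OF y] r_distr)
  next
    fix x assume x: "x \<in> carrier (free_module R n)"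
    show "\<one> \<odot>\<^bsub>free_module R n\<^esub> x = x" by (rule ext) (simp add: simps mem[OF x] arb[OF x])
  qed
qed

text \<open>The common building block of both parts of the system: an entry of A v is one dot
  product, and the value v^t M w of a bilinear form is a nested one, so its linearity comes from
  that of \<open>dot\<close>.\<close>

definition dot :: "('a, 'm) ring_scheme \<Rightarrow> nat \<Rightarrow> (nat \<Rightarrow> 'a) \<Rightarrow> (nat \<Rightarrow> 'a) \<Rightarrow> 'a" where
  "dot R n a v = (\<Oplus>\<^bsub>R\<^esub>l\<in>{..<n}. a l \<otimes>\<^bsub>R\<^esub> v l)"

context cring
begin

lemma dot_closed [simp]:
  "a \<in> {..<n} \<rightarrow> carrier R \<Longrightarrow> v \<in> {..<n} \<rightarrow> carrier R \<Longrightarrow> dot R n a v \<in> carrier R"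
  unfolding dot_def by (rule finsum_closed) auto

lemma dot_cong:
  "(\<And>l. l < n \<Longrightarrow> a l = a' l) \<Longrightarrow> (\<And>l. l < n \<Longrightarrow> v l = v' l) \<Longrightarrow>
   a' \<in> {..<n} \<rightarrow> carrier R \<Longrightarrow> v' \<in> {..<n} \<rightarrow> carrier R \<Longrightarrow> dot R n a v = dot R n a' v'"
  unfolding dot_def by (rule finsum_cong') auto

lemma dot_commute:
  "a \<in> {..<n} \<rightarrow> carrier R \<Longrightarrow> v \<in> {..<n} \<rightarrow> carrier R \<Longrightarrow> dot R n a v = dot R n v a"
  unfolding dot_def by (rule finsum_cong') (auto simp: m_comm Pi_iff)

lemma dot_add:
  assumes "a \<in> {..<n} \<rightarrow> carrier R" "v \<in> {..<n} \<rightarrow> carrier R" "w \<in> {..<n} \<rightarrow> carrier R"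
  shows "dot R n a (\<lambda>l. v l \<oplus> w l) = dot R n a v \<oplus> dot R n a w"
proof -
  have "dot R n a (\<lambda>l. v l \<oplus> w l) = (\<Oplus>l\<in>{..<n}. a l \<otimes> v l \<oplus> a l \<otimes> w l)"
    unfolding dot_def by (rule finsum_cong') (use assms in \<open>auto simp: r_distr Pi_iff\<close>)
  also have "\<dots> = dot R n a v \<oplus> dot R n a w"
    unfolding dot_def by (rule finsum_addf) (use assms in auto)
  finally show ?thesis .
qed

lemma dot_smult:
  assumes "a \<in> {..<n} \<rightarrow> carrier R" "v \<in> {..<n} \<rightarrow> carrier R" "c \<in> carrier R"
  shows "dot R n a (\<lambda>l. c \<otimes> v l) = c \<otimes> dot R n a v"
proof -
  have "c \<otimes> dot R n a v = (\<Oplus>l\<in>{..<n}. c \<otimes> (a l \<otimes> v l))"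
    unfolding dot_def by (rule finsum_rdistr) (use assms in auto)
  also have "\<dots> = dot R n a (\<lambda>l. c \<otimes> v l)"
    unfolding dot_def by (rule finsum_cong') (use assms in \<open>auto simp: m_lcomm Pi_iff\<close>)
  finally show ?thesis ..
qed

lemma mat_vec_dot: "k < m \<Longrightarrow> mat_vec R m n A v k = dot R n (A k) v"
  by (simp add: mat_vec_def dot_def)

lemma quad_vec_dot:
  assumes "k < m" "is_mat R n n (Q k)" "x \<in> {..<n} \<rightarrow> carrier R"
  shows "quad_vec R m n Q x k = dot R n x (\<lambda>i. dot R n (Q k i) x)"
proof -
  have Q: "i < n \<Longrightarrow> j < n \<Longrightarrow> Q k i j \<in> carrier R" for i j using assms(2) unfolding is_mat_def by auto
  have x: "i < n \<Longrightarrow> x i \<in> carrier R" for i using assms(3) by auto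
  have "(\<Oplus>j\<in>{..<n}. x i \<otimes> Q k i j \<otimes> x j) = x i \<otimes> dot R n (Q k i) x" if i: "i < n" for i
  proof -
    have "x i \<otimes> dot R n (Q k i) x = (\<Oplus>j\<in>{..<n}. x i \<otimes> (Q k i j \<otimes> x j))"
      unfolding dot_def by (rule finsum_rdistr) (use Q x i in auto)
    also have "\<dots> = (\<Oplus>j\<in>{..<n}. x i \<otimes> Q k i j \<otimes> x j)"
      by (rule finsum_cong') (use Q x i in \<open>auto simp: m_assoc\<close>)
    finally show ?thesis ..
  qed
  moreover have "dot R n (Q k i) x \<in> carrier R" if "i < n" for i
    by (rule dot_closed) (use Q x that in auto)
  ultimately have "(\<Oplus>i\<in>{..<n}. \<Oplus>j\<in>{..<n}. x i \<otimes> Q k i j \<otimes> x j) = (\<Oplus>i\<in>{..<n}. x i \<otimes> dot R n (Q k i) x)"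
    by (intro finsum_cong') (use x in auto)
  then show ?thesis using assms(1) by (simp add: quad_vec_def dot_def)
qed

text \<open>Here \<open>B v w\<close> is v^t M w. Symmetry of M is not assumed, so the linear
  coefficient is the sum of both mixed values. Linearity on the left comes from commuting the outer
  dot product.\<close>

lemma quad_expand:
  assumes Q: "is_mat R n n M" and x: "x \<in> {..<n} \<rightarrow> carrier R" and f: "f \<in> {..<n} \<rightarrow> carrier R"
    and z: "z \<in> carrier R"
  defines "B \<equiv> \<lambda>v w. dot R n v (\<lambda>i. dot R n (M i) w)"
  shows "B (\<lambda>l. x l \<oplus> z \<otimes> f l) (\<lambda>l. x l \<oplus> z \<otimes> f l) =
    B x x \<oplus> z \<otimes> (B x f \<oplus> B f x) \<oplus> z \<otimes> z \<otimes> B f f"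
proof -
  have Mi: "M i \<in> {..<n} \<rightarrow> carrier R" if "i < n" for i using Q that unfolding is_mat_def by auto
  have Mv: "(\<lambda>i. dot R n (M i) v) \<in> {..<n} \<rightarrow> carrier R" if "v \<in> {..<n} \<rightarrow> carrier R" for v
    using Mi that by auto
  have zf: "(\<lambda>l. z \<otimes> f l) \<in> {..<n} \<rightarrow> carrier R" using f z by auto
  have xzf: "(\<lambda>l. x l \<oplus> z \<otimes> f l) \<in> {..<n} \<rightarrow> carrier R" using x f z by auto
  have B: "B v w \<in> carrier R" if "v \<in> {..<n} \<rightarrow> carrier R" "w \<in> {..<n} \<rightarrow> carrier R" for v w
    unfolding B_def using that Mv by simp
  have right: "B v (\<lambda>l. x l \<oplus> z \<otimes> f l) = B v x \<oplus> z \<otimes> B v f" if v: "v \<in> {..<n} \<rightarrow> carrier R" for v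
  proof -
    have "B v (\<lambda>l. x l \<oplus> z \<otimes> f l) = dot R n v (\<lambda>i. dot R n (M i) x \<oplus> z \<otimes> dot R n (M i) f)"
      unfolding B_def using v Mi x f z zf
      by (intro dot_cong) (auto simp: dot_add dot_smult)
    also have "\<dots> = B v x \<oplus> dot R n v (\<lambda>i. z \<otimes> dot R n (M i) f)"
      unfolding B_def using v Mv[OF x] Mv[OF f] z by (intro dot_add) auto
    also have "\<dots> = B v x \<oplus> z \<otimes> B v f"
      unfolding B_def using dot_smult[OF v Mv[OF f] z] by simp
    finally show ?thesis .
  qed
  have left: "B (\<lambda>l. x l \<oplus> z \<otimes> f l) w = B x w \<oplus> z \<otimes> B f w" if w: "w \<in> {..<n} \<rightarrow> carrier R" for w
  proof -
    have "B (\<lambda>l. x l \<oplus> z \<otimes> f l) w = dot R n (\<lambda>i. dot R n (M i) w) (\<lambda>l. x l \<oplus> z \<otimes> f l)"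
      unfolding B_def by (rule dot_commute[OF xzf Mv[OF w]])
    also have "\<dots> = dot R n (\<lambda>i. dot R n (M i) w) x \<oplus> z \<otimes> dot R n (\<lambda>i. dot R n (M i) w) f"
      using dot_add[OF Mv[OF w] x zf] dot_smult[OF Mv[OF w] f z] by simp
    also have "\<dots> = B x w \<oplus> z \<otimes> B f w"
      unfolding B_def using dot_commute[OF Mv[OF w] x] dot_commute[OF Mv[OF w] f] by simp
    finally show ?thesis .
  qed
  show ?thesis unfolding right[OF xzf] left[OF x] left[OF f]
    using B[OF x x] B[OF x f] B[OF f x] B[OF f f] z by algebra
qed

lemma mat_vec_closed:
  assumes "is_mat R m n A" "v \<in> carrier (free_module R n)"
  shows "mat_vec R m n A v \<in> carrier (free_module R m)"
proof -
  have "dot R n (A k) v \<in> carrier R" if "k < m" for k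
    using assms that unfolding is_mat_def free_module_simps by (intro dot_closed) auto
  then show ?thesis unfolding free_module_simps by (auto simp: mat_vec_def dot_def)
qed

lemma mat_vec_lincomb:
  assumes A: "is_mat R m n A" and v: "v \<in> carrier (free_module R n)" and w: "w \<in> carrier (free_module R n)"
    and c: "c \<in> carrier R" and k: "k < m"
  shows "mat_vec R m n A (w \<oplus>\<^bsub>free_module R n\<^esub> c \<odot>\<^bsub>free_module R n\<^esub> v) k =
    mat_vec R m n A w k \<oplus> c \<otimes> mat_vec R m n A v k"
proof -
  have Ak: "A k \<in> {..<n} \<rightarrow> carrier R" using A k unfolding is_mat_def by auto
  have v': "v \<in> {..<n} \<rightarrow> carrier R" and w': "w \<in> {..<n} \<rightarrow> carrier R" using v w unfolding free_module_simps by auto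
  have "dot R n (A k) (w \<oplus>\<^bsub>free_module R n\<^esub> c \<odot>\<^bsub>free_module R n\<^esub> v) = dot R n (A k) (\<lambda>l. w l \<oplus> c \<otimes> v l)"
    by (rule dot_cong) (use Ak v' w' c in \<open>auto simp: free_module_simps\<close>)
  also have "\<dots> = dot R n (A k) w \<oplus> c \<otimes> dot R n (A k) v"
    using dot_add[OF Ak w', of "\<lambda>l. c \<otimes> v l"] dot_smult[OF Ak v' c] v' c by auto
  finally show ?thesis using k by (simp add: mat_vec_dot)
qed

lemma submodule_mat_image:
  assumes A: "is_mat R m n A" shows "submodule (mat_image R m n A) R (free_module R m)"
proof -
  interpret M: module R "free_module R m" by (rule module_free)
  interpret N: module R "free_module R n" by (rule module_free)
  let ?I = "mat_image R m n A"
  have sub: "?I \<subseteq> carrier (free_module R m)" unfolding mat_image_def using mat_vec_closed[OF A] by auto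
  have comb: "u \<oplus>\<^bsub>free_module R m\<^esub> c \<odot>\<^bsub>free_module R m\<^esub> u' \<in> ?I"
    if c: "c \<in> carrier R" and u: "u \<in> ?I" "u' \<in> ?I" for c u u'
  proof -
    obtain v w where v: "v \<in> carrier (free_module R n)" "u' = mat_vec R m n A v"
      and w: "w \<in> carrier (free_module R n)" "u = mat_vec R m n A w" using u unfolding mat_image_def by auto
    have "u \<oplus>\<^bsub>free_module R m\<^esub> c \<odot>\<^bsub>free_module R m\<^esub> u' =
      mat_vec R m n A (w \<oplus>\<^bsub>free_module R n\<^esub> c \<odot>\<^bsub>free_module R n\<^esub> v)"
    proof (rule free_module_eqI[of _ R m])
      show "u \<oplus>\<^bsub>free_module R m\<^esub> c \<odot>\<^bsub>free_module R m\<^esub> u' \<in> carrier (free_module R m)" using u sub c by auto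
      show "mat_vec R m n A (w \<oplus>\<^bsub>free_module R n\<^esub> c \<odot>\<^bsub>free_module R n\<^esub> v) \<in> carrier (free_module R m)"
        using mat_vec_closed[OF A] v w c by simp
      fix k assume k: "k < m"
      show "(u \<oplus>\<^bsub>free_module R m\<^esub> c \<odot>\<^bsub>free_module R m\<^esub> u') k =
          mat_vec R m n A (w \<oplus>\<^bsub>free_module R n\<^esub> c \<odot>\<^bsub>free_module R n\<^esub> v) k"
        unfolding mat_vec_lincomb[OF A v(1) w(1) c k] v(2) w(2) using k by (simp add: free_module_simps)
    qed
    then show ?thesis unfolding mat_image_def using v w c by auto
  qed
  have ne: "mat_vec R m n A \<zero>\<^bsub>free_module R n\<^esub> \<in> ?I" unfolding mat_image_def by auto
  show ?thesis
  proof (rule M.submoduleI2[OF sub])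
    show "?I \<noteq> {}" using ne by blast
    show "u \<oplus>\<^bsub>free_module R m\<^esub> v \<in> ?I" if uv: "u \<in> ?I" "v \<in> ?I" for u v
    proof -
      have "v \<in> carrier (free_module R m)" using uv sub by blast
      then show ?thesis using comb[OF one_closed uv] by simp
    qed
    show "c \<odot>\<^bsub>free_module R m\<^esub> u \<in> ?I" if c: "c \<in> carrier R" and u: "u \<in> ?I" for c u
    proof -
      have uc: "u \<in> carrier (free_module R m)" using u sub by blast
      have "u \<oplus>\<^bsub>free_module R m\<^esub> (c \<ominus> \<one>) \<odot>\<^bsub>free_module R m\<^esub> u = c \<odot>\<^bsub>free_module R m\<^esub> u"
      proof -
        have "u \<oplus>\<^bsub>free_module R m\<^esub> (c \<ominus> \<one>) \<odot>\<^bsub>free_module R m\<^esub> u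
          = (\<one> \<oplus> (c \<ominus> \<one>)) \<odot>\<^bsub>free_module R m\<^esub> u" using uc c by (simp add: M.smult_l_distr)
        also have "\<one> \<oplus> (c \<ominus> \<one>) = c" using c by algebra
        finally show ?thesis .
      qed
      then show ?thesis using comb[OF _ u u, of "c \<ominus> \<one>"] c by simp
    qed
  qed
qed

text \<open>Both possible targets of the isomorphism are generated by 1 or by its class, so a
  preimage generates the cokernel.\<close>

lemma coker_cyclic:
  assumes p: "p \<in> carrier R" and d: "is_mat R s t d"
    and H1: "module_isomorphic R (coker R s t d) (regular_module R) \<or>
      (\<exists>n::nat. 0 < n \<and>
        module_isomorphic R (coker R s t d)
          (quotient_module (regular_module R) (PIdl (p [^] n))))"
  shows "\<exists>e\<in>carrier (free_module R s). \<forall>v\<in>carrier (free_module R s).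
    \<exists>a\<in>carrier R. \<exists>n\<in>mat_image R s t d. v = n \<oplus>\<^bsub>free_module R s\<^esub> a \<odot>\<^bsub>free_module R s\<^esub> e"
proof -
  interpret M: module R "free_module R s" by (rule module_free)
  interpret P: module R "regular_module R" by (rule module_regular)
  note sm = submodule_mat_image[OF d]
  from H1 show ?thesis
  proof (elim disjE exE conjE)
    assume iso: "module_isomorphic R (coker R s t d) (regular_module R)"
    show ?thesis
    proof (rule M.quotient_module_cyclicD[OF sm iso[unfolded coker_def]])
      show "\<one> \<in> carrier (regular_module R)" by (simp add: regular_module_def)
      fix u assume "u \<in> carrier (regular_module R)"
      then have "u \<in> carrier R" "u = u \<odot>\<^bsub>regular_module R\<^esub> \<one>" by (simp_all add: regular_module_def)
      then show "\<exists>a\<in>carrier R. u = a \<odot>\<^bsub>regular_module R\<^esub> \<one>" by blast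
    qed
  next
    fix n :: nat
    assume iso: "module_isomorphic R (coker R s t d) (quotient_module (regular_module R) (PIdl (p [^] n)))"
    let ?I = "PIdl (p [^] n)" and ?M = "regular_module R"
    have si: "submodule ?I R ?M" using p by (intro submodule_PIdl) simp
    have carr: "carrier (quotient_module ?M ?I) = {?I +>\<^bsub>?M\<^esub> x | x. x \<in> carrier R}"
      unfolding quotient_module_def A_RCOSETS_def' by (auto simp: regular_module_def)
    show ?thesis
    proof (rule M.quotient_module_cyclicD[OF sm iso[unfolded coker_def]])
      show "?I +>\<^bsub>?M\<^esub> \<one> \<in> carrier (quotient_module ?M ?I)" unfolding carr by blast
      fix u assume "u \<in> carrier (quotient_module ?M ?I)"
      then obtain x where x: "x \<in> carrier R" "u = ?I +>\<^bsub>?M\<^esub> x" unfolding carr by blast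
      have "x \<odot>\<^bsub>quotient_module ?M ?I\<^esub> (?I +>\<^bsub>?M\<^esub> \<one>) = ?I +>\<^bsub>?M\<^esub> (x \<odot>\<^bsub>?M\<^esub> \<one>)"
        by (rule P.quotient_module_smult[OF si x(1)]) (simp add: regular_module_def)
      also have "x \<odot>\<^bsub>?M\<^esub> \<one> = x" using x by (simp add: regular_module_def)
      finally show "\<exists>a\<in>carrier R. u = a \<odot>\<^bsub>quotient_module ?M ?I\<^esub> (?I +>\<^bsub>?M\<^esub> \<one>)" using x by blast
    qed
  qed
qed

end

lemma (in cring) minus_minus_cancel:
  "x \<in> carrier R \<Longrightarrow> y \<in> carrier R \<Longrightarrow> z \<in> carrier R \<Longrightarrow> (x \<ominus> z) \<ominus> (y \<ominus> z) = x \<ominus> y"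
  by algebra

lemma (in cring) minus_add_minus:
  "x \<in> carrier R \<Longrightarrow> y \<in> carrier R \<Longrightarrow> z \<in> carrier R \<Longrightarrow> (x \<ominus> y) \<oplus> (y \<ominus> z) = x \<ominus> z"
  by algebra

text \<open>Nakayama's lemma for a cyclic module, by hand: if F = d w0 + c e with \<open>e\<close> a
  generator, then \<open>p\<close> dividing \<open>c\<close> would put F into the excluded sum
  \<open>H2\<close>. So \<open>c\<close> is a unit and F generates as well.\<close>

lemma (in uniformized) coker_generator:
  assumes d: "is_mat R s t d" and F: "F \<in> carrier (free_module R s)"
    and H1: "module_isomorphic R (coker R s t d) (regular_module R) \<or>
      (\<exists>n::nat. 0 < n \<and>
        module_isomorphic R (coker R s t d)
          (quotient_module (regular_module R) (PIdl (p [^] n))))"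
    and H2: "F \<notin> multiples R p s <+>\<^bsub>free_module R s\<^esub> mat_image R s t d"
    and v: "v \<in> carrier (free_module R s)"
  shows "\<exists>a\<in>carrier R. \<exists>w\<in>carrier (free_module R t). \<forall>k<s. v k = a \<otimes> F k \<oplus> mat_vec R s t d w k"
proof -
  interpret M: module R "free_module R s" by (rule module_free)
  interpret N: module R "free_module R t" by (rule module_free)
  obtain e where e: "e \<in> carrier (free_module R s)" and
    gen: "\<And>v. v \<in> carrier (free_module R s) \<Longrightarrow>
      \<exists>a\<in>carrier R. \<exists>n\<in>mat_image R s t d. v = n \<oplus>\<^bsub>free_module R s\<^esub> a \<odot>\<^bsub>free_module R s\<^esub> e"
    using coker_cyclic[OF p_closed d H1] by blast
  obtain c w0 where c: "c \<in> carrier R" and w0: "w0 \<in> carrier (free_module R t)"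
    and F_eq: "F = mat_vec R s t d w0 \<oplus>\<^bsub>free_module R s\<^esub> c \<odot>\<^bsub>free_module R s\<^esub> e"
    using gen[OF F] unfolding mat_image_def by blast
  obtain a w1 where a: "a \<in> carrier R" and w1: "w1 \<in> carrier (free_module R t)"
    and v_eq: "v = mat_vec R s t d w1 \<oplus>\<^bsub>free_module R s\<^esub> a \<odot>\<^bsub>free_module R s\<^esub> e"
    using gen[OF v] unfolding mat_image_def by blast
  note dw0 = mat_vec_closed[OF d w0]
  have "\<not> p divides c"
  proof
    assume "p divides c"
    then obtain b where b: "b \<in> carrier R" "c = p \<otimes> b" unfolding factor_def by blast
    have "F = p \<odot>\<^bsub>free_module R s\<^esub> (b \<odot>\<^bsub>free_module R s\<^esub> e) \<oplus>\<^bsub>free_module R s\<^esub> mat_vec R s t d w0"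
      unfolding F_eq b(2) using b(1) e dw0 by (simp add: M.smult_assoc1 M.a_comm)
    moreover have "p \<odot>\<^bsub>free_module R s\<^esub> (b \<odot>\<^bsub>free_module R s\<^esub> e) \<in> multiples R p s"
      unfolding multiples_def using b(1) e by blast
    moreover have "mat_vec R s t d w0 \<in> mat_image R s t d" unfolding mat_image_def using w0 by blast
    ultimately have "F \<in> multiples R p s <+>\<^bsub>free_module R s\<^esub> mat_image R s t d"
      unfolding set_add_def' by blast
    then show False using H2 by blast
  qed
  then have cu: "c \<in> Units R" using unit_iff c by simp
  define c' where "c' = inv c"
  have c': "c' \<in> carrier R" "c' \<otimes> c = \<one>" using cu unfolding c'_def by auto
  \<comment> \<open>Substituting e = (F - d w0)/c into v = d w1 + a e gives v = (a/c) F + d (w1 -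
    (a/c) w0).\<close>
  define w where "w = w1 \<oplus>\<^bsub>free_module R t\<^esub> (\<ominus> (a \<otimes> c')) \<odot>\<^bsub>free_module R t\<^esub> w0"
  have wc: "w \<in> carrier (free_module R t)" unfolding w_def using w0 w1 a c' by simp
  have "v k = (a \<otimes> c') \<otimes> F k \<oplus> mat_vec R s t d w k" if k: "k < s" for k
  proof -
    have cl: "mat_vec R s t d w0 k \<in> carrier R" "mat_vec R s t d w1 k \<in> carrier R" "e k \<in> carrier R"
      using mat_vec_closed[OF d w0] mat_vec_closed[OF d w1] e k unfolding free_module_simps by auto
    have Fk: "F k = mat_vec R s t d w0 k \<oplus> c \<otimes> e k" unfolding F_eq using k by (simp add: free_module_simps)
    have vk: "v k = mat_vec R s t d w1 k \<oplus> a \<otimes> e k" unfolding v_eq using k by (simp add: free_module_simps)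
    have wk: "mat_vec R s t d w k = mat_vec R s t d w1 k \<oplus> \<ominus> (a \<otimes> c') \<otimes> mat_vec R s t d w0 k"
      unfolding w_def using mat_vec_lincomb[OF d w0 w1 _ k, of "\<ominus> (a \<otimes> c')"] a c' by simp
    have "(a \<otimes> c') \<otimes> F k \<oplus> mat_vec R s t d w k = mat_vec R s t d w1 k \<oplus> a \<otimes> (c' \<otimes> c) \<otimes> e k"
      unfolding Fk wk using a c c'(1) cl by algebra
    also have "\<dots> = v k" unfolding vk c'(2) using a by simp
    finally show ?thesis ..
  qed
  then show ?thesis using a c'(1) wc by (intro bexI[of _ "a \<otimes> c'"] bexI[of _ w]) auto
qed

section \<open>Change of rings and lifts of residue vectors\<close>

lemma (in ring_hom_cring) hom_dot:
  assumes "a \<in> {..<n} \<rightarrow> carrier R" "v \<in> {..<n} \<rightarrow> carrier R"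
  shows "h (dot R n a v) = dot S n (\<lambda>l. h (a l)) (\<lambda>l. h (v l))"
proof -
  have "(\<lambda>l. a l \<otimes> v l) \<in> {..<n} \<rightarrow> carrier R" using assms by auto
  then have "h (dot R n a v) = (\<Oplus>\<^bsub>S\<^esub>l\<in>{..<n}. (h \<circ> (\<lambda>l. a l \<otimes> v l)) l)"
    unfolding dot_def by (rule hom_finsum)
  also have "\<dots> = dot S n (\<lambda>l. h (a l)) (\<lambda>l. h (v l))"
    unfolding dot_def by (rule S.finsum_cong') (use assms in \<open>auto simp: Pi_iff\<close>)
  finally show ?thesis .
qed

lemma lift_exists:
  assumes "cring R" and p: "p \<in> carrier R" and xbar: "xbar \<in> carrier (free_module (residue_ring_mod R p) n)"
  obtains x where "is_lift R n xbar x"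
proof -
  interpret cring R by fact
  interpret I: ideal "PIdl\<^bsub>R\<^esub> p" R by (rule cgenideal_ideal[OF p])
  have "\<forall>k\<in>{..<n}. \<exists>y. y \<in> carrier R \<and> y \<in> xbar k"
  proof
    fix k assume "k \<in> {..<n}"
    then have "xbar k \<in> carrier (R Quot PIdl\<^bsub>R\<^esub> p)"
      using xbar PiE_mem[of xbar "{..<n}" "\<lambda>_. carrier (residue_ring_mod R p)" k]
      by (simp add: free_module_simps(1) residue_ring_mod_def)
    then obtain y where y: "y \<in> carrier R" "xbar k = PIdl\<^bsub>R\<^esub> p +>\<^bsub>R\<^esub> y"
      unfolding FactRing_def A_RCOSETS_def' by auto
    then show "\<exists>y. y \<in> carrier R \<and> y \<in> xbar k" using I.a_rcos_self by auto
  qed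
  then have "\<exists>g. \<forall>k\<in>{..<n}. g k \<in> carrier R \<and> g k \<in> xbar k" by (rule bchoice)
  then obtain g where g: "\<forall>k\<in>{..<n}. g k \<in> carrier R \<and> g k \<in> xbar k" ..
  have "is_lift R n xbar (restrict g {..<n})"
    using g unfolding is_lift_def free_module_simps(1) by auto
  then show thesis by (rule that)
qed

text \<open>One lift \<open>x0\<close> is enough for comparison: two lifts of a class differ by a
  multiple of \<open>p\<close>, and \<open>q\<close> divides \<open>i p\<close> since a local
  homomorphism keeps \<open>p\<close> a nonunit.\<close>

lemma lifts_alongI:
  assumes ext: "dvr_extension R S i" and p: "uniformizer R p" and q: "uniformizer S q"
    and xbar: "xbar \<in> carrier (free_module (residue_ring_mod R p) n)" and x0: "is_lift R n xbar x0"
    and x: "x \<in> carrier (free_module S n)"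
    and cong: "\<And>k. k < n \<Longrightarrow> q divides\<^bsub>S\<^esub> (x k \<ominus>\<^bsub>S\<^esub> i (x0 k))"
  shows "lifts_along S q i n xbar x"
proof -
  have dvrs: "dvr R" "dvr S" and i: "i \<in> ring_hom R S"
    and loc: "\<And>a. a \<in> carrier R \<Longrightarrow> i a \<in> Units S \<Longrightarrow> a \<in> Units R"
    using ext unfolding dvr_extension_def by auto
  interpret R: uniformized R p by (rule uniformizedI[OF dvrs(1) p])
  interpret S: uniformized S q by (rule uniformizedI[OF dvrs(2) q])
  interpret i: ring_hom_cring R S i by unfold_locales (rule i)
  interpret I: ideal "PIdl\<^bsub>R\<^esub> p" R by (rule R.cgenideal_ideal[OF R.p_closed])
  have qp: "q divides\<^bsub>S\<^esub> i p" using loc[OF R.p_closed] R.p_nonunit S.nonunit_dvd[of "i p"] by auto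
  have "x k \<ominus>\<^bsub>S\<^esub> i a \<in> PIdl\<^bsub>S\<^esub> q" if k: "k < n" and a: "a \<in> xbar k" for k a
  proof -
    have "xbar k \<in> carrier (R Quot PIdl\<^bsub>R\<^esub> p)"
      using xbar k PiE_mem[of xbar "{..<n}" "\<lambda>_. carrier (residue_ring_mod R p)" k]
      by (simp add: free_module_simps(1) residue_ring_mod_def)
    then obtain y where y: "y \<in> carrier R" "xbar k = PIdl\<^bsub>R\<^esub> p +>\<^bsub>R\<^esub> y"
      unfolding FactRing_def A_RCOSETS_def' by auto
    have x0k: "x0 k \<in> xbar k" "x0 k \<in> carrier R" using x0 k unfolding is_lift_def free_module_simps(1) by auto
    have ac: "a \<in> carrier R" using a y I.a_elemrcos_carrier by simp
    have "p divides\<^bsub>R\<^esub> (x0 k \<ominus>\<^bsub>R\<^esub> y)" "p divides\<^bsub>R\<^esub> (a \<ominus>\<^bsub>R\<^esub> y)"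
      using I.a_rcos_module_minus[OF R.ring_axioms y(1) x0k(2)] I.a_rcos_module_minus[OF R.ring_axioms y(1) ac]
        x0k(1) a unfolding y(2) R.mem_PIdl_iff_divides[OF R.p_closed] by auto
    then have "p divides\<^bsub>R\<^esub> ((x0 k \<ominus>\<^bsub>R\<^esub> y) \<ominus>\<^bsub>R\<^esub> (a \<ominus>\<^bsub>R\<^esub> y))" by (rule R.divides_minus[OF R.p_closed])
    moreover have "(x0 k \<ominus>\<^bsub>R\<^esub> y) \<ominus>\<^bsub>R\<^esub> (a \<ominus>\<^bsub>R\<^esub> y) = x0 k \<ominus>\<^bsub>R\<^esub> a" by (rule R.minus_minus_cancel[OF x0k(2) ac y(1)])
    ultimately obtain b where b: "b \<in> carrier R" "x0 k \<ominus>\<^bsub>R\<^esub> a = p \<otimes>\<^bsub>R\<^esub> b" unfolding factor_def by auto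
    have "i (x0 k) \<ominus>\<^bsub>S\<^esub> i a = i p \<otimes>\<^bsub>S\<^esub> i b"
      using arg_cong[OF b(2), of i] x0k(2) ac b(1) by (simp add: R.minus_eq S.minus_eq)
    then have "q divides\<^bsub>S\<^esub> (i (x0 k) \<ominus>\<^bsub>S\<^esub> i a)" using S.divides_mult_right(1)[OF S.p_closed qp, of "i b"] b(1) by simp
    note 1 = S.divides_add[OF S.p_closed cong[OF k] this]
    have xk: "x k \<in> carrier S" using x k unfolding free_module_simps(1) by auto
    have "(x k \<ominus>\<^bsub>S\<^esub> i (x0 k)) \<oplus>\<^bsub>S\<^esub> (i (x0 k) \<ominus>\<^bsub>S\<^esub> i a) = x k \<ominus>\<^bsub>S\<^esub> i a"
      using S.minus_add_minus[OF xk, of "i (x0 k)" "i a"] x0k(2) ac by simp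
    then show ?thesis using 1 by (simp only: S.mem_PIdl_iff_divides[OF S.p_closed])
  qed
  then show ?thesis using x unfolding lifts_along_def by blast
qed

text \<open>One coordinate of the system at the corrected point. The terms in \<open>u\<close> and
  \<open>v\<close> cancel, and what is left is the quadratic polynomial at \<open>z\<close> times
  the coordinate of F.\<close>

lemma (in cring) root_identity:
  assumes cl: "q0 \<in> carrier R" "y0 \<in> carrier R" "P \<in> carrier R" "A \<in> carrier R" "F \<in> carrier R"
      "u \<in> carrier R" "v \<in> carrier R" "\<beta> \<in> carrier R" "z \<in> carrier R"
    and const: "q0 \<oplus> y0 = P \<otimes> (A \<otimes> F \<oplus> u)" and lin: "b = \<beta> \<otimes> F \<oplus> v"
    and root: "z \<otimes> z \<oplus> \<beta> \<otimes> z \<oplus> P \<otimes> A = \<zero>"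
  shows "(q0 \<oplus> z \<otimes> b \<oplus> z \<otimes> z \<otimes> F) \<oplus> (y0 \<oplus> \<ominus> P \<otimes> u \<oplus> \<ominus> z \<otimes> v) = \<zero>"
proof -
  have "(q0 \<oplus> z \<otimes> b \<oplus> z \<otimes> z \<otimes> F) \<oplus> (y0 \<oplus> \<ominus> P \<otimes> u \<oplus> \<ominus> z \<otimes> v) =
    (q0 \<oplus> y0) \<oplus> (z \<otimes> (\<beta> \<otimes> F \<oplus> v) \<oplus> z \<otimes> z \<otimes> F \<oplus> \<ominus> P \<otimes> u \<oplus> \<ominus> z \<otimes> v)"
    unfolding lin using cl by algebra
  also have "\<dots> = (z \<otimes> z \<oplus> \<beta> \<otimes> z \<oplus> P \<otimes> A) \<otimes> F" unfolding const using cl by algebra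
  also have "\<dots> = \<zero>" unfolding root using cl by simp
  finally show ?thesis .
qed

theorem theorem2p3:
  fixes R :: "('a, 'm) ring_scheme"
    and p :: 'a
    and r s t :: nat
    and d :: "nat \<Rightarrow> nat \<Rightarrow> 'a"
    and Sig :: "nat \<Rightarrow> nat \<Rightarrow> nat \<Rightarrow> 'a"
    and xbar ybar :: "nat \<Rightarrow> 'a set"
  assumes dvr: "dvr R"
    and unif: "uniformizer R p"
    and pos: "0 < r" "0 < s" "0 < t"
    and d: "is_mat R s t d"
    and Sig: "\<And>k. k < s \<Longrightarrow> is_mat R r r (Sig k)"
    and H1: "module_isomorphic R (coker R s t d) (regular_module R) \<or>
      (\<exists>n::nat. 0 < n \<and>
        module_isomorphic R (coker R s t d)
          (quotient_module (regular_module R) (PIdl\<^bsub>R\<^esub> (p [^]\<^bsub>R\<^esub> n))))"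
    and H2: "\<exists>f \<in> carrier (free_module R r).
      quad_vec R s r Sig f \<notin> multiples R p s <+>\<^bsub>free_module R s\<^esub> mat_image R s t d"
    and sol: "mod_solution R p r s t Sig d xbar ybar"
  shows "\<exists>(S :: 'a ring) i q x y.
    dvr_extension R S i \<and> uniformizer S q \<and>
    lifts_along S q i r xbar x \<and> lifts_along S q i t ybar y \<and>
    system S r s t (\<lambda>k l m. i (Sig k l m)) (\<lambda>k l. i (d k l)) x y = \<zero>\<^bsub>free_module S s\<^esub>"
proof -
  interpret R: uniformized R p by (rule uniformizedI[OF dvr unif])
  have Pi_free: "v \<in> {..<n} \<rightarrow> carrier R" if "v \<in> carrier (free_module R n)" for v n
    using that unfolding free_module_simps(1) by auto
  have free_mem: "v k \<in> carrier R" if "v \<in> carrier (free_module R n)" "k < n" for v n k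
    using Pi_free[OF that(1)] that(2) by auto
  define B where "B k v w = dot R r v (\<lambda>i. dot R r (Sig k i) w)" for k v w
  have Sigi: "Sig k i \<in> {..<r} \<rightarrow> carrier R" if "k < s" "i < r" for k i
    using Sig[OF that(1)] that(2) unfolding is_mat_def by auto
  have SigB: "(\<lambda>i. dot R r (Sig k i) w) \<in> {..<r} \<rightarrow> carrier R" if "k < s" "w \<in> {..<r} \<rightarrow> carrier R" for k w
    using Sigi that by auto
  have Bc: "B k v w \<in> carrier R" if "k < s" "v \<in> carrier (free_module R r)" "w \<in> carrier (free_module R r)" for k v w
    unfolding B_def using SigB Pi_free that by (intro R.dot_closed) auto
  have quadB: "quad_vec R s r Sig v k = B k v v" if "k < s" "v \<in> carrier (free_module R r)" for k v
    unfolding B_def by (rule R.quad_vec_dot[where Q = Sig, OF that(1) Sig[OF that(1)] Pi_free[OF that(2)]])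
  obtain f where f: "f \<in> carrier (free_module R r)"
    and fH2: "quad_vec R s r Sig f \<notin> multiples R p s <+>\<^bsub>free_module R s\<^esub> mat_image R s t d"
    using H2 by blast
  define F where "F = quad_vec R s r Sig f"
  have Fk: "F k = B k f f" if "k < s" for k unfolding F_def using quadB that f by simp
  have Fc: "F \<in> carrier (free_module R s)"
  proof -
    have "F \<in> extensional {..<s}" unfolding F_def quad_vec_def by simp
    then show ?thesis unfolding free_module_simps(1) PiE_iff using Fk Bc f by auto
  qed
  have xbar: "xbar \<in> carrier (free_module (residue_ring_mod R p) r)"
    and ybar: "ybar \<in> carrier (free_module (residue_ring_mod R p) t)"
    and sys: "\<And>x y. is_lift R r xbar x \<Longrightarrow> is_lift R t ybar y \<Longrightarrow> system R r s t Sig d x y \<in> multiples R p s"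
    using sol unfolding mod_solution_def by auto
  obtain x0 where x0: "is_lift R r xbar x0" using lift_exists[OF R.is_cring R.p_closed xbar] .
  obtain y0 where y0: "is_lift R t ybar y0" using lift_exists[OF R.is_cring R.p_closed ybar] .
  have x0c: "x0 \<in> carrier (free_module R r)" and y0c: "y0 \<in> carrier (free_module R t)"
    using x0 y0 unfolding is_lift_def by auto
  obtain W where W: "W \<in> carrier (free_module R s)" "system R r s t Sig d x0 y0 = p \<odot>\<^bsub>free_module R s\<^esub> W"
    using sys[OF x0 y0] unfolding multiples_def by auto
  have Wk: "B k x0 x0 \<oplus>\<^bsub>R\<^esub> mat_vec R s t d y0 k = p \<otimes>\<^bsub>R\<^esub> W k" if "k < s" for k
    using fun_cong[OF W(2), of k] that quadB[OF that x0c] unfolding system_def free_module_simps by simp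
  \<comment> \<open>Used for W, the value of the system at the lift divided by \<open>p\<close>, and
    for the vector of mixed terms. Both decompositions are over \<open>R\<close>, and their
    coefficients of F do not depend on the coordinate, so one \<open>z\<close> solves all equations
    at once.\<close>
  note gen = R.coker_generator[OF d Fc H1 fH2[folded F_def]]
  obtain \<alpha> u where \<alpha>: "\<alpha> \<in> carrier R" and u: "u \<in> carrier (free_module R t)"
    and W_eq: "\<And>k. k < s \<Longrightarrow> W k = \<alpha> \<otimes>\<^bsub>R\<^esub> F k \<oplus>\<^bsub>R\<^esub> mat_vec R s t d u k"
    using gen[OF W(1)] by blast
  have "(\<lambda>k\<in>{..<s}. B k x0 f \<oplus>\<^bsub>R\<^esub> B k f x0) \<in> carrier (free_module R s)"
    unfolding free_module_simps(1) using Bc x0c f by auto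
  then obtain \<beta> v where \<beta>: "\<beta> \<in> carrier R" and v: "v \<in> carrier (free_module R t)"
    and "\<forall>k<s. (\<lambda>k\<in>{..<s}. B k x0 f \<oplus>\<^bsub>R\<^esub> B k f x0) k = \<beta> \<otimes>\<^bsub>R\<^esub> F k \<oplus>\<^bsub>R\<^esub> mat_vec R s t d v k"
    using gen by blast
  then have b_eq: "B k x0 f \<oplus>\<^bsub>R\<^esub> B k f x0 = \<beta> \<otimes>\<^bsub>R\<^esub> F k \<oplus>\<^bsub>R\<^esub> mat_vec R s t d v k" if "k < s" for k
    using that by simp
  \<comment> \<open>The constant term keeps the factor \<open>p\<close> of the solution modulo
    \<open>p\<close>; this is what permits a root in the maximal ideal.\<close>
  have \<gamma>: "p \<otimes>\<^bsub>R\<^esub> \<alpha> \<in> carrier R" "p divides\<^bsub>R\<^esub> (p \<otimes>\<^bsub>R\<^esub> \<alpha>)"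
    using \<alpha> by (auto intro: dividesI)
  obtain S :: "'a ring" and i q z where ext: "dvr_extension R S i" and q: "uniformizer S q"
    and z: "z \<in> PIdl\<^bsub>S\<^esub> q" and root: "z \<otimes>\<^bsub>S\<^esub> z \<oplus>\<^bsub>S\<^esub> i \<beta> \<otimes>\<^bsub>S\<^esub> z \<oplus>\<^bsub>S\<^esub> i (p \<otimes>\<^bsub>R\<^esub> \<alpha>) = \<zero>\<^bsub>S\<^esub>"
    using R.root_extension[OF \<beta> \<gamma>] by (elim exE conjE)
  have "dvr S" and i: "i \<in> ring_hom R S"
    and loc: "\<And>a. a \<in> carrier R \<Longrightarrow> i a \<in> Units S \<Longrightarrow> a \<in> Units R"
    using ext unfolding dvr_extension_def by auto
  interpret S: uniformized S q by (rule uniformizedI[OF \<open>dvr S\<close> q])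
  interpret i: ring_hom_cring R S i by unfold_locales (rule i)
  have qz: "q divides\<^bsub>S\<^esub> z" using z by (simp only: S.mem_PIdl_iff_divides[OF S.p_closed])
  have zc: "z \<in> carrier S" using qz unfolding factor_def by auto
  have qp: "q divides\<^bsub>S\<^esub> i p" using loc[OF R.p_closed] R.p_nonunit S.nonunit_dvd[of "i p"] by auto
  have iPi: "(\<lambda>l. i (w l)) \<in> {..<n} \<rightarrow> carrier S" if "w \<in> carrier (free_module R n)" for w n
    using Pi_free[OF that] by auto
  \<comment> \<open>The corrected vectors are first plain functions, to which the rules for
    \<open>dot\<close> apply, and are then restricted to the index range, as the extensional carrier
    of \<open>free_module\<close> demands.\<close>
  define x' where "x' l = i (x0 l) \<oplus>\<^bsub>S\<^esub> z \<otimes>\<^bsub>S\<^esub> i (f l)" for l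
  define y' where "y' l = (i (y0 l) \<oplus>\<^bsub>S\<^esub> \<ominus>\<^bsub>S\<^esub> i p \<otimes>\<^bsub>S\<^esub> i (u l)) \<oplus>\<^bsub>S\<^esub> \<ominus>\<^bsub>S\<^esub> z \<otimes>\<^bsub>S\<^esub> i (v l)" for l
  define x where "x = restrict x' {..<r}"
  define y where "y = restrict y' {..<t}"
  have x'c: "x' \<in> {..<r} \<rightarrow> carrier S" unfolding x'_def using iPi[OF x0c] iPi[OF f] zc by (auto simp: Pi_iff)
  have y'c: "y' \<in> {..<t} \<rightarrow> carrier S"
    unfolding y'_def using iPi[OF y0c] iPi[OF u] iPi[OF v] zc by (auto simp: Pi_iff)
  have xc: "x \<in> carrier (free_module S r)" and yc: "y \<in> carrier (free_module S t)"
    unfolding x_def y_def free_module_simps(1) using x'c y'c by auto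
  have "lifts_along S q i r xbar x"
  proof (rule lifts_alongI[OF ext unif q xbar x0 xc])
    fix k assume k: "k < r"
    have c: "i (x0 k) \<in> carrier S" "i (f k) \<in> carrier S" using free_mem[OF x0c k] free_mem[OF f k] by auto
    have "x k \<ominus>\<^bsub>S\<^esub> i (x0 k) = z \<otimes>\<^bsub>S\<^esub> i (f k)"
      unfolding x_def x'_def using k c zc by (simp add: S.minus_eq S.a_ac S.r_neg1 S.r_neg2 S.r_neg)
    then show "q divides\<^bsub>S\<^esub> (x k \<ominus>\<^bsub>S\<^esub> i (x0 k))" using S.divides_mult_right(1)[OF S.p_closed qz c(2)] by simp
  qed
  moreover have "lifts_along S q i t ybar y"
  proof (rule lifts_alongI[OF ext unif q ybar y0 yc])
    fix k assume k: "k < t"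
    have c: "i (y0 k) \<in> carrier S" "i (u k) \<in> carrier S" "i (v k) \<in> carrier S"
      using free_mem[OF y0c k] free_mem[OF u k] free_mem[OF v k] by auto
    \<comment> \<open>The correction is a combination of \<open>i p\<close> and \<open>z\<close>,
      both multiples of \<open>q\<close>. Here it matters that \<open>z\<close> lies in the maximal
      ideal.\<close>
    have "y k \<ominus>\<^bsub>S\<^esub> i (y0 k) = i p \<otimes>\<^bsub>S\<^esub> \<ominus>\<^bsub>S\<^esub> i (u k) \<oplus>\<^bsub>S\<^esub> z \<otimes>\<^bsub>S\<^esub> \<ominus>\<^bsub>S\<^esub> i (v k)"
      unfolding y_def y'_def using k c zc
      by (simp add: S.minus_eq S.a_ac S.r_neg1 S.r_neg2 S.r_neg S.l_minus S.r_minus)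
    moreover have "q divides\<^bsub>S\<^esub> (i p \<otimes>\<^bsub>S\<^esub> \<ominus>\<^bsub>S\<^esub> i (u k) \<oplus>\<^bsub>S\<^esub> z \<otimes>\<^bsub>S\<^esub> \<ominus>\<^bsub>S\<^esub> i (v k))"
      using c by (intro S.divides_add S.divides_mult_right(1) S.p_closed qp qz) auto
    ultimately show "q divides\<^bsub>S\<^esub> (y k \<ominus>\<^bsub>S\<^esub> i (y0 k))" by simp
  qed
  moreover have "system S r s t (\<lambda>k l m. i (Sig k l m)) (\<lambda>k l. i (d k l)) x y = \<zero>\<^bsub>free_module S s\<^esub>"
  proof -
    let ?Q = "\<lambda>k l m. i (Sig k l m)" and ?d = "\<lambda>k l. i (d k l)"
    have "quad_vec S s r ?Q x k \<oplus>\<^bsub>S\<^esub> mat_vec S s t ?d y k = \<zero>\<^bsub>S\<^esub>" if k: "k < s" for k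
    proof -
      have Qm: "is_mat S r r (?Q k)" using Sig[OF k] unfolding is_mat_def by auto
      have Qi: "(\<lambda>m. ?Q k l m) \<in> {..<r} \<rightarrow> carrier S" if "l < r" for l using Qm that unfolding is_mat_def by auto
      \<comment> \<open>Values of the bilinear forms at vectors from \<open>R\<close> are images
        under \<open>i\<close>, so the relations found over \<open>R\<close> can be pushed forward
        to \<open>S\<close>.\<close>
      have iB: "dot S r (\<lambda>l. i (a l)) (\<lambda>l. dot S r (?Q k l) (\<lambda>m. i (b m))) = i (B k a b)"
        if a: "a \<in> carrier (free_module R r)" and b: "b \<in> carrier (free_module R r)" for a b
      proof -
        have "i (B k a b) = dot S r (\<lambda>l. i (a l)) (\<lambda>l. i (dot R r (Sig k l) b))"
          unfolding B_def by (rule i.hom_dot[OF Pi_free[OF a] SigB[OF k Pi_free[OF b]]])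
        also have "\<dots> = dot S r (\<lambda>l. i (a l)) (\<lambda>l. dot S r (?Q k l) (\<lambda>m. i (b m)))"
          using iPi[OF a] iPi[OF b] Qi i.hom_dot[OF Sigi[OF k] Pi_free[OF b]]
          by (intro S.dot_cong) auto
        finally show ?thesis ..
      qed
      have x_eq: "x l = x' l" if "l < r" for l unfolding x_def using that by simp
      have y_eq: "y l = y' l" if "l < t" for l unfolding y_def using that by simp
      have "quad_vec S s r ?Q x k = dot S r x (\<lambda>l. dot S r (?Q k l) x)"
        using xc unfolding free_module_simps(1) by (intro S.quad_vec_dot[where Q = ?Q, OF k Qm]) auto
      also have "\<dots> = dot S r x' (\<lambda>l. dot S r (?Q k l) x')"
      proof (rule S.dot_cong[OF x_eq _ x'c])
        show "dot S r (?Q k l) x = dot S r (?Q k l) x'" if "l < r" for l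
          by (rule S.dot_cong[OF refl x_eq Qi[OF that] x'c])
      qed (use Qi x'c in auto)
      also have "\<dots> = i (B k x0 x0) \<oplus>\<^bsub>S\<^esub> z \<otimes>\<^bsub>S\<^esub> (i (B k x0 f) \<oplus>\<^bsub>S\<^esub> i (B k f x0)) \<oplus>\<^bsub>S\<^esub> z \<otimes>\<^bsub>S\<^esub> z \<otimes>\<^bsub>S\<^esub> i (B k f f)"
        using S.quad_expand[OF Qm iPi[OF x0c] iPi[OF f] zc]
        unfolding iB[OF x0c x0c] iB[OF x0c f] iB[OF f x0c] iB[OF f f] x'_def .
      finally have quad: "quad_vec S s r ?Q x k = i (B k x0 x0) \<oplus>\<^bsub>S\<^esub> z \<otimes>\<^bsub>S\<^esub> (i (B k x0 f) \<oplus>\<^bsub>S\<^esub> i (B k f x0)) \<oplus>\<^bsub>S\<^esub> z \<otimes>\<^bsub>S\<^esub> z \<otimes>\<^bsub>S\<^esub> i (F k)"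
        unfolding Fk[OF k] .
      have dk: "d k \<in> {..<t} \<rightarrow> carrier R" "?d k \<in> {..<t} \<rightarrow> carrier S" using d k unfolding is_mat_def by auto
      have id: "dot S t (?d k) (\<lambda>l. i (w l)) = i (mat_vec R s t d w k)" if w: "w \<in> carrier (free_module R t)" for w
        using i.hom_dot[OF dk(1) Pi_free[OF w]] R.mat_vec_dot[OF k, of t d w] by simp
      have smc: "(\<lambda>l. c \<otimes>\<^bsub>S\<^esub> i (w l)) \<in> {..<t} \<rightarrow> carrier S"
        if "c \<in> carrier S" "w \<in> carrier (free_module R t)" for c w using that iPi by (auto simp: Pi_iff)
      have pc: "\<ominus>\<^bsub>S\<^esub> i p \<in> carrier S" and mzc: "\<ominus>\<^bsub>S\<^esub> z \<in> carrier S" using zc by auto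
      have yu: "(\<lambda>l. i (y0 l) \<oplus>\<^bsub>S\<^esub> \<ominus>\<^bsub>S\<^esub> i p \<otimes>\<^bsub>S\<^esub> i (u l)) \<in> {..<t} \<rightarrow> carrier S"
        using iPi[OF y0c] smc[OF pc u] by (auto simp: Pi_iff)
      have "mat_vec S s t ?d y k = dot S t (?d k) y" by (rule S.mat_vec_dot[OF k])
      also have "\<dots> = dot S t (?d k) y'" by (rule S.dot_cong[OF refl y_eq dk(2) y'c])
      also have "\<dots> = dot S t (?d k) (\<lambda>l. i (y0 l)) \<oplus>\<^bsub>S\<^esub> \<ominus>\<^bsub>S\<^esub> i p \<otimes>\<^bsub>S\<^esub> dot S t (?d k) (\<lambda>l. i (u l))
          \<oplus>\<^bsub>S\<^esub> \<ominus>\<^bsub>S\<^esub> z \<otimes>\<^bsub>S\<^esub> dot S t (?d k) (\<lambda>l. i (v l))"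
        unfolding y'_def S.dot_add[OF dk(2) yu smc[OF mzc v]] S.dot_add[OF dk(2) iPi[OF y0c] smc[OF pc u]]
          S.dot_smult[OF dk(2) iPi[OF u] pc] S.dot_smult[OF dk(2) iPi[OF v] mzc] ..
      finally have mat: "mat_vec S s t ?d y k = i (mat_vec R s t d y0 k) \<oplus>\<^bsub>S\<^esub> \<ominus>\<^bsub>S\<^esub> i p \<otimes>\<^bsub>S\<^esub> i (mat_vec R s t d u k)
          \<oplus>\<^bsub>S\<^esub> \<ominus>\<^bsub>S\<^esub> z \<otimes>\<^bsub>S\<^esub> i (mat_vec R s t d v k)" unfolding id[OF y0c] id[OF u] id[OF v] .
      have cl: "B k x0 x0 \<in> carrier R" "B k x0 f \<in> carrier R" "B k f x0 \<in> carrier R" "F k \<in> carrier R"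
        "mat_vec R s t d y0 k \<in> carrier R" "mat_vec R s t d u k \<in> carrier R" "mat_vec R s t d v k \<in> carrier R"
        using Bc[OF k] x0c f free_mem[OF Fc k] free_mem[OF R.mat_vec_closed[OF d] k] y0c u v by auto
      \<comment> \<open>The image of \<open>Wk\<close> combined with \<open>W_eq\<close> gives the
        relation between the constant terms, and the image of \<open>b_eq\<close> the one for the
        coefficient of \<open>z\<close>.\<close>
      show ?thesis unfolding quad mat
      proof (rule S.root_identity)
        show "i (B k x0 x0) \<oplus>\<^bsub>S\<^esub> i (mat_vec R s t d y0 k) = i p \<otimes>\<^bsub>S\<^esub> (i \<alpha> \<otimes>\<^bsub>S\<^esub> i (F k) \<oplus>\<^bsub>S\<^esub> i (mat_vec R s t d u k))"
          using arg_cong[OF Wk[OF k], of i] cl \<alpha> unfolding W_eq[OF k] by simp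
        show "i (B k x0 f) \<oplus>\<^bsub>S\<^esub> i (B k f x0) = i \<beta> \<otimes>\<^bsub>S\<^esub> i (F k) \<oplus>\<^bsub>S\<^esub> i (mat_vec R s t d v k)"
          using arg_cong[OF b_eq[OF k], of i] cl \<beta> by simp
        show "z \<otimes>\<^bsub>S\<^esub> z \<oplus>\<^bsub>S\<^esub> i \<beta> \<otimes>\<^bsub>S\<^esub> z \<oplus>\<^bsub>S\<^esub> i p \<otimes>\<^bsub>S\<^esub> i \<alpha> = \<zero>\<^bsub>S\<^esub>"
          using root \<alpha> by simp
      qed (use cl \<alpha> \<beta> zc in auto)
    qed
    then show ?thesis unfolding system_def free_module_simps by (intro restrict_ext) simp
  qed
  ultimately show ?thesis using ext q by blast
qed

end
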